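(* Let $\Omega\subset\mathbb{R}^n$ be a domain, $T>0$, $I=(0,T)$, $V=H^1(\Omega)$, $H=L^2(\Omega)$, and let $u\in W=\{u\in L^2(I;V):\ \partial_t u\in L^2(I;V^* )\}$ be given. Then $$\int_0^T\langle \partial_t u(t),\,u^+(t)\rangle_{V^*,V}\,dt=\frac12\int_0^T\partial_t\|u^+(t)\|_H^2\,dt=\frac12\left(\|u^+(T)\|_H^2-\|u^+(0)\|_H^2\right).$$
   Context: All functions are real-valued. $V\subset H=H^*\subset V^*$ is the evolution (Gelfand) triple in which $h\in H$ is identified with the functional $v\mapsto (h,v)_H$ on $V$; $\langle\cdot,\cdot\rangle_{V^*,V}$ is the duality pairing. $L^2(I;X)$ are Bochner spaces and $\partial_t$ is the weak derivative with respect to $t\in I$. The positive part is $u^+(t,x)=\max(u(t,x),0)$. Elements of $W$ are identified with their representatives in $C([0,T];H)$, so that $u^+\in L^2(I;V)\cap C([0,T];H)$ and $u^+(0),u^+(T)\in H$ are well defined. *)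

theory Defs
  imports "HOL-Analysis.Analysis"
begin

text \<open>
  Elements of \<open>L\<^sup>2(\<Omega>)\<close> and \<open>H\<^sup>1(\<Omega>)\<close> are represented by functions on the whole space; the norms
  below are seminorms on these representatives that vanish exactly on the functions which are zero
  almost everywhere on \<open>\<Omega>\<close>. Values outside \<open>\<Omega>\<close> are irrelevant throughout.
\<close>

definition is_domain :: "'a::euclidean_space set \<Rightarrow> bool" where
  "is_domain \<Omega> \<longleftrightarrow> open \<Omega> \<and> connected \<Omega> \<and> \<Omega> \<noteq> {}"


subsection \<open>Test functions and weak derivatives\<close>

primrec Ck :: "nat \<Rightarrow> ('a::euclidean_space \<Rightarrow> real) \<Rightarrow> bool" where
  "Ck 0 f \<longleftrightarrow> continuous_on UNIV f"
| "Ck (Suc k) f \<longleftrightarrow> (\<forall>x. f differentiable (at x)) \<and>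
     (\<forall>b\<in>Basis. Ck k (\<lambda>x. frechet_derivative f (at x) b))"

definition test_functions :: "'a::euclidean_space set \<Rightarrow> ('a \<Rightarrow> real) set" where
  "test_functions \<Omega> = {\<phi>. (\<forall>k. Ck k \<phi>) \<and>
     compact (closure {x. \<phi> x \<noteq> 0}) \<and> closure {x. \<phi> x \<noteq> 0} \<subseteq> \<Omega>}"

definition locally_integrable_on :: "('a::euclidean_space \<Rightarrow> real) \<Rightarrow> 'a set \<Rightarrow> bool" where
  "locally_integrable_on f \<Omega> \<longleftrightarrow> (\<forall>K. compact K \<and> K \<subseteq> \<Omega> \<longrightarrow> integrable (lebesgue_on K) f)"

definition has_weak_partial ::
  "'a::euclidean_space set \<Rightarrow> 'a \<Rightarrow> ('a \<Rightarrow> real) \<Rightarrow> ('a \<Rightarrow> real) \<Rightarrow> bool" where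
  "has_weak_partial \<Omega> b f g \<longleftrightarrow>
     locally_integrable_on f \<Omega> \<and> locally_integrable_on g \<Omega> \<and>
     (\<forall>\<phi>\<in>test_functions \<Omega>.
        (LINT x|lebesgue_on \<Omega>. f x * frechet_derivative \<phi> (at x) b) =
        - (LINT x|lebesgue_on \<Omega>. g x * \<phi> x))"

text \<open>Weak derivatives are unique almost everywhere, so the choice below does not affect integrals.\<close>

definition weak_partial :: "'a::euclidean_space set \<Rightarrow> 'a \<Rightarrow> ('a \<Rightarrow> real) \<Rightarrow> 'a \<Rightarrow> real" where
  "weak_partial \<Omega> b f = (SOME g. has_weak_partial \<Omega> b f g)"


subsection \<open>The triple \<open>V = H\<^sup>1(\<Omega>) \<subseteq> H = L\<^sup>2(\<Omega>) \<subseteq> V\<^sup>*\<close>\<close>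

definition L2 :: "'a::euclidean_space set \<Rightarrow> ('a \<Rightarrow> real) set" where
  "L2 \<Omega> = {f \<in> borel_measurable (lebesgue_on \<Omega>). integrable (lebesgue_on \<Omega>) (\<lambda>x. (f x)\<^sup>2)}"

definition L2_inner :: "'a::euclidean_space set \<Rightarrow> ('a \<Rightarrow> real) \<Rightarrow> ('a \<Rightarrow> real) \<Rightarrow> real" where
  "L2_inner \<Omega> f g = (LINT x|lebesgue_on \<Omega>. f x * g x)"

definition L2_norm :: "'a::euclidean_space set \<Rightarrow> ('a \<Rightarrow> real) \<Rightarrow> real" where
  "L2_norm \<Omega> f = sqrt (L2_inner \<Omega> f f)"

definition H1 :: "'a::euclidean_space set \<Rightarrow> ('a \<Rightarrow> real) set" where
  "H1 \<Omega> = {v \<in> L2 \<Omega>. \<forall>b\<in>Basis. \<exists>g\<in>L2 \<Omega>. has_weak_partial \<Omega> b v g}"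

definition H1_norm :: "'a::euclidean_space set \<Rightarrow> ('a \<Rightarrow> real) \<Rightarrow> real" where
  "H1_norm \<Omega> v = sqrt ((L2_norm \<Omega> v)\<^sup>2 + (\<Sum>b\<in>Basis. (L2_norm \<Omega> (weak_partial \<Omega> b v))\<^sup>2))"

text \<open>
  The dual of \<open>H\<^sup>1(\<Omega>)\<close>; the duality pairing of \<open>l\<close> and \<open>v\<close> is \<open>l v\<close>. The values of a
  functional outside \<open>H\<^sup>1(\<Omega>)\<close> are unconstrained. Boundedness with respect to the seminorm forces
  functionals to respect equality almost everywhere.
\<close>

definition H1_dual :: "'a::euclidean_space set \<Rightarrow> (('a \<Rightarrow> real) \<Rightarrow> real) set" where
  "H1_dual \<Omega> = {l.
     (\<forall>v\<in>H1 \<Omega>. \<forall>w\<in>H1 \<Omega>. l (\<lambda>x. v x + w x) = l v + l w) \<and>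
     (\<forall>c. \<forall>v\<in>H1 \<Omega>. l (\<lambda>x. c * v x) = c * l v) \<and>
     (\<exists>C. \<forall>v\<in>H1 \<Omega>. \<bar>l v\<bar> \<le> C * H1_norm \<Omega> v)}"

definition H1_dual_norm :: "'a::euclidean_space set \<Rightarrow> (('a \<Rightarrow> real) \<Rightarrow> real) \<Rightarrow> real" where
  "H1_dual_norm \<Omega> l = (SUP v\<in>{v \<in> H1 \<Omega>. H1_norm \<Omega> v \<le> 1}. \<bar>l v\<bar>)"

definition H_embed :: "'a::euclidean_space set \<Rightarrow> ('a \<Rightarrow> real) \<Rightarrow> ('a \<Rightarrow> real) \<Rightarrow> real" where
  "H_embed \<Omega> h = (\<lambda>v. L2_inner \<Omega> h v)"


subsection \<open>Bochner spaces\<close>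

text \<open>
  A (semi)normed space of real functions is given by its carrier \<open>X\<close> and its (semi)norm \<open>N\<close>.
  This covers both \<open>H\<^sup>1(\<Omega>)\<close>, with functions on the Euclidean space, and its dual, with functionals.
  The library's Bochner integral requires a normed type, which is not available for spaces that
  depend on \<open>\<Omega>\<close>; the definitions below are the same construction relative to \<open>X\<close> and \<open>N\<close>, for
  finite measures \<open>M\<close>.
\<close>

definition simple_in :: "'t measure \<Rightarrow> ('b \<Rightarrow> real) set \<Rightarrow> ('t \<Rightarrow> 'b \<Rightarrow> real) \<Rightarrow> bool" where
  "simple_in M X s \<longleftrightarrow> simple_function M s \<and> s ` space M \<subseteq> X"

definition simple_integral_in :: "'t measure \<Rightarrow> ('t \<Rightarrow> 'b \<Rightarrow> real) \<Rightarrow> 'b \<Rightarrow> real" where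
  "simple_integral_in M s = (\<lambda>v. \<Sum>c\<in>s ` space M. measure M {t \<in> space M. s t = c} * c v)"

definition strongly_measurable_in ::
  "'t measure \<Rightarrow> ('b \<Rightarrow> real) set \<Rightarrow> (('b \<Rightarrow> real) \<Rightarrow> real) \<Rightarrow> ('t \<Rightarrow> 'b \<Rightarrow> real) \<Rightarrow> bool" where
  "strongly_measurable_in M X N f \<longleftrightarrow> (AE t in M. f t \<in> X) \<and>
     (\<exists>s. (\<forall>k. simple_in M X (s k)) \<and>
          (AE t in M. (\<lambda>k::nat. N (\<lambda>v. f t v - s k t v)) \<longlonglongrightarrow> 0))"

definition has_integral_in ::
  "'t measure \<Rightarrow> ('b \<Rightarrow> real) set \<Rightarrow> (('b \<Rightarrow> real) \<Rightarrow> real) \<Rightarrow> ('t \<Rightarrow> 'b \<Rightarrow> real) \<Rightarrow> ('b \<Rightarrow> real) \<Rightarrow> bool"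
  where
  "has_integral_in M X N f y \<longleftrightarrow> strongly_measurable_in M X N f \<and> y \<in> X \<and>
     (\<exists>s. (\<forall>k. simple_in M X (s k)) \<and>
          (\<lambda>k::nat. \<integral>\<^sup>+ t. ennreal (N (\<lambda>v. f t v - s k t v)) \<partial>M) \<longlonglongrightarrow> 0 \<and>
          (\<lambda>k::nat. N (\<lambda>v. simple_integral_in M (s k) v - y v)) \<longlonglongrightarrow> 0)"

definition L2_in ::
  "'t measure \<Rightarrow> ('b \<Rightarrow> real) set \<Rightarrow> (('b \<Rightarrow> real) \<Rightarrow> real) \<Rightarrow> ('t \<Rightarrow> 'b \<Rightarrow> real) set" where
  "L2_in M X N = {f. strongly_measurable_in M X N f \<and> integrable M (\<lambda>t. (N (f t))\<^sup>2)}"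

definition C_in ::
  "real set \<Rightarrow> ('b \<Rightarrow> real) set \<Rightarrow> (('b \<Rightarrow> real) \<Rightarrow> real) \<Rightarrow> (real \<Rightarrow> 'b \<Rightarrow> real) set" where
  "C_in S X N = {f. (\<forall>t\<in>S. f t \<in> X) \<and>
     (\<forall>t\<in>S. ((\<lambda>s. N (\<lambda>v. f s v - f t v)) \<longlongrightarrow> 0) (at t within S))}"


subsection \<open>The space \<open>W\<close>\<close>

text \<open>
  The identity \<open>\<integral> \<phi>'(t) u(t) dt = - \<integral> \<phi>(t) u'(t) dt\<close> of Bochner integrals in \<open>V\<^sup>*\<close>, for all test
  functions \<open>\<phi>\<close> on \<open>(0, T)\<close>.
\<close>

definition has_weak_time_derivative ::
  "'a::euclidean_space set \<Rightarrow> real \<Rightarrow> (real \<Rightarrow> 'a \<Rightarrow> real) \<Rightarrow> (real \<Rightarrow> ('a \<Rightarrow> real) \<Rightarrow> real) \<Rightarrow> bool" where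
  "has_weak_time_derivative \<Omega> T u u' \<longleftrightarrow>
     (\<forall>\<phi>\<in>test_functions {0<..<T}. \<exists>y.
        has_integral_in (lebesgue_on {0<..<T}) (H1_dual \<Omega>) (H1_dual_norm \<Omega>)
          (\<lambda>t v. deriv \<phi> t * H_embed \<Omega> (u t) v) y \<and>
        has_integral_in (lebesgue_on {0<..<T}) (H1_dual \<Omega>) (H1_dual_norm \<Omega>)
          (\<lambda>t v. \<phi> t * u' t v) (\<lambda>v. - y v))"

definition W_space :: "'a::euclidean_space set \<Rightarrow> real \<Rightarrow> (real \<Rightarrow> 'a \<Rightarrow> real) set" where
  "W_space \<Omega> T = {u \<in> L2_in (lebesgue_on {0<..<T}) (H1 \<Omega>) (H1_norm \<Omega>).
     \<exists>u'\<in>L2_in (lebesgue_on {0<..<T}) (H1_dual \<Omega>) (H1_dual_norm \<Omega>).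
       has_weak_time_derivative \<Omega> T u u'}"

definition pos_part :: "('a \<Rightarrow> real) \<Rightarrow> 'a \<Rightarrow> real" where
  "pos_part f = (\<lambda>x. max (f x) 0)"

end

theory Submission
  imports Defs "HOL-Computational_Algebra.Polynomial"
begin

text \<open>
  The functional \<open>F(w) = \<parallel>w\<^sup>+\<parallel>\<^sup>2 / 2\<close> on \<open>L\<^sup>2(\<Omega>)\<close> is convex with gradient \<open>w\<^sup>+\<close>, so for \<open>h > 0\<close>
  \<open>\<integral>\<^bsub>[t,t+h]\<^esub> \<langle>u'(r), u\<^sup>+(t)\<rangle> dr \<le> F(u(t+h)) - F(u(t)) \<le> \<integral>\<^bsub>[t,t+h]\<^esub> \<langle>u'(r), u\<^sup>+(t+h)\<rangle> dr\<close>.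
  Dividing by \<open>h\<close>, integrating over \<open>t \<in> (a,b)\<close> and letting \<open>h \<rightarrow> 0\<close>, the middle term tends to
  \<open>F(u(b)) - F(u(a))\<close> by continuity of \<open>u\<close> in \<open>L\<^sup>2\<close>. Both outer terms tend to \<open>\<integral>\<^bsub>[a,b]\<^esub> \<langle>u', u\<^sup>+\<rangle> dt\<close>,
  because \<open>u'\<close> can be approximated in \<open>L\<^sup>2(I; V\<^sup>*)\<close> by simple functions, for which Lebesgue's
  differentiation theorem applies. Neither a density theorem for \<open>W\<close> nor a chain rule in \<open>W\<close> is used.

  In space this needs that \<open>v\<^sup>+ \<in> H\<^sup>1\<close> with \<open>\<nabla>v\<^sup>+ = 1\<^bsub>v > 0\<^esub> \<nabla>v\<close>. The chain rule for smooth \<open>G(v)\<close> is obtained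
  without mollifiers: the difference quotients of \<open>v\<close> along a coordinate direction are averages of the weak
  derivative, which converge to it in \<open>L\<^sup>1\<close>.
\<close>

subsection \<open>Smooth functions\<close>

text \<open>The obstacle is that the kernel K(r,t) = <u'(r), u+(t)> is wanted on the diagonal r = t,
  a null set of the square, on which statements for almost every (r,t) say nothing. Replacing u' by
  a simple function turns K into a finite sum of products phi(r) W(t); for a product, Lebesgue
  differentiation acts on phi alone and W is only an integrable weight. The error is bounded by a
  product d(r) n(t), which Young's inequality splits into rho(r) + kappa(t). Both summands survive
  the averaging in r: kappa(t) is constant there, and averages of rho are difference quotients of
  its primitive, so that primitive can be added to F(u). One inequality uses averages to the right
  of t, the other to the left. These averages leave [a,b], whence 0 < a and b < T; the values at 0
  and T come last, by continuity. That an increment is the integral of the weak derivative is used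
  twice: for the chain rule in space and for t -> (u(t), v) in time. Fubini and translations need
  Borel functions on the whole space, so statements over \<Omega> are transferred to Borel versions
  extended by zero and back.\<close>

lemma Ck_SucI:
  assumes "\<And>x. (f has_derivative f' x) (at x)" "\<And>b. b \<in> Basis \<Longrightarrow> Ck k (\<lambda>x. f' x b)"
  shows "Ck (Suc k) f"
proof -
  have "frechet_derivative f (at x) = f' x" for x
    using frechet_derivative_at[OF assms(1)] by simp
  then show ?thesis
    using assms by (auto simp: differentiable_def)
qed

lemma Ck_has_derivative:
  "Ck (Suc k) f \<Longrightarrow> (f has_derivative frechet_derivative f (at x)) (at x)"
  by (simp add: frechet_derivative_works)

lemma Ck_continuous: "Ck k f \<Longrightarrow> continuous_on UNIV f"
  by (cases k) (auto simp: differentiable_imp_continuous_on differentiable_on_def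
      differentiable_at_withinI)

lemma Ck_Suc_imp: "Ck (Suc k) f \<Longrightarrow> Ck k f"
proof (induction k arbitrary: f)
  case 0
  then show ?case using Ck_continuous[of "Suc 0" f] by simp
qed auto

lemma Ck_const: "Ck k (\<lambda>x. c)"
proof (induction k arbitrary: c)
  case (Suc k)
  show ?case
    by (rule Ck_SucI[where f' = "\<lambda>_ _. 0"]) (use Suc in auto)
qed auto

lemma Ck_add: "Ck k f \<Longrightarrow> Ck k g \<Longrightarrow> Ck k (\<lambda>x. f x + g x)"
proof (induction k arbitrary: f g)
  case (Suc k)
  show ?case
    by (rule Ck_SucI[OF has_derivative_add[OF Ck_has_derivative[OF Suc.prems(1)]
            Ck_has_derivative[OF Suc.prems(2)]]]) (use Suc in auto)
qed (auto intro: continuous_intros)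

lemma Ck_mult: "Ck k f \<Longrightarrow> Ck k g \<Longrightarrow> Ck k (\<lambda>x. f x * g x)"
proof (induction k arbitrary: f g)
  case (Suc k)
  show ?case
    by (rule Ck_SucI[OF has_derivative_mult[OF Ck_has_derivative[OF Suc.prems(1)]
            Ck_has_derivative[OF Suc.prems(2)]]])
      (use Suc Ck_Suc_imp[OF Suc.prems(1)] Ck_Suc_imp[OF Suc.prems(2)] in \<open>auto intro!: Ck_add\<close>)
qed (auto intro: continuous_intros)

lemma Ck_prod: "(\<And>i. i \<in> I \<Longrightarrow> Ck k (f i)) \<Longrightarrow> Ck k (\<lambda>x. \<Prod>i\<in>I. f i x)"
  by (induction I rule: infinite_finite_induct) (auto intro!: Ck_const Ck_mult)

text \<open>Each partial derivative is a constant times the same expression with the derivative of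
  \<open>f\<close> in place of \<open>f\<close>, so the induction closes. It lets one-dimensional
  profiles be used along coordinate axes.\<close>

lemma Ck_compose_affine:
  fixes f :: "real \<Rightarrow> real" and a :: "'a::euclidean_space"
  shows "Ck k f \<Longrightarrow> Ck k (\<lambda>x. f (x \<bullet> a + d))"
proof (induction k arbitrary: f)
  case 0
  then show ?case
    by (auto intro!: continuous_intros continuous_on_compose2[of UNIV f])
next
  case (Suc k)
  have D: "((\<lambda>x. f (x \<bullet> a + d)) has_derivative
      (\<lambda>y. frechet_derivative f (at (x \<bullet> a + d)) (y \<bullet> a))) (at x)" for x
    by (rule has_derivative_compose[OF _ Ck_has_derivative[OF Suc.prems], where f = "\<lambda>x. x \<bullet> a + d"])
      (auto intro!: derivative_eq_intros)
  have scale: "frechet_derivative f (at s) y = y * frechet_derivative f (at s) 1" for s y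
  proof -
    have "linear (frechet_derivative f (at s))"
      using Ck_has_derivative[OF Suc.prems] has_derivative_linear by blast
    from linear_scale[OF this, of y 1] show ?thesis by simp
  qed
  have "((\<lambda>x. f (x \<bullet> a + d)) has_derivative
      (\<lambda>y. (y \<bullet> a) * frechet_derivative f (at (x \<bullet> a + d)) 1)) (at x)" for x
    using D[of x] by (subst (asm) scale)
  then show ?case
    by (rule Ck_SucI) (use Suc in \<open>auto intro!: Ck_mult Ck_const\<close>)
qed

lemma Ck_translate: "Ck k f \<Longrightarrow> Ck k (\<lambda>x. f (x + a))"
proof (induction k arbitrary: f)
  case 0
  then show ?case
    by (auto intro!: continuous_intros continuous_on_compose2[of UNIV f])
next
  case (Suc k)
  have "((\<lambda>x. f (x + a)) has_derivative frechet_derivative f (at (x + a))) (at x)" for x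
    by (rule has_derivative_compose[OF _ Ck_has_derivative[OF Suc.prems], where f = "\<lambda>x. x + a"])
      (auto intro!: derivative_eq_intros)
  then show ?case
    by (rule Ck_SucI) (use Suc in auto)
qed

text \<open>The classical function exp(-1/s), flat at 0. The polynomial factor makes the family
  closed under differentiation, so that smoothness of every order is a single induction over all
  \<open>p\<close>.\<close>

definition flat_exp :: "real poly \<Rightarrow> real \<Rightarrow> real" where
  "flat_exp p s = (if s > 0 then poly p (1 / s) * exp (- 1 / s) else 0)"

lemma poly_exp_tendsto_0: "((\<lambda>y. poly p y * exp (- y)) \<longlongrightarrow> (0::real)) at_top"
proof -
  have "((\<lambda>y. \<Sum>i\<le>degree p. coeff p i * (y ^ i / exp y)) \<longlongrightarrow> (\<Sum>i\<le>degree p. coeff p i * 0)) at_top"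
    by (intro tendsto_sum tendsto_mult tendsto_const tendsto_power_div_exp_0)
  then show ?thesis
    by (simp add: poly_altdef exp_minus sum_distrib_right divide_inverse mult.assoc)
qed

text \<open>In the variable y = 1/s the derivative of p(y) exp(-y) with respect to s is y^2 (p(y) -
  p'(y)) exp(-y), which explains the polynomial. At s = 0 the right-hand difference quotient is y
  p(y) exp(-y) with y tending to infinity.\<close>

lemma flat_exp_deriv:
  "(flat_exp p has_real_derivative flat_exp (monom 1 2 * (p - pderiv p)) s) (at s)"
proof (cases s "0::real" rule: linorder_cases)
  case less
  have "((\<lambda>_. 0) has_real_derivative 0) (at s)" by simp
  then have "(flat_exp p has_real_derivative 0) (at s)"
    by (rule has_field_derivative_transform_within_open[where S = "{..<0}"])
      (use less in \<open>auto simp: flat_exp_def\<close>)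
  with less show ?thesis by (simp add: flat_exp_def)
next
  case greater
  have inv: "((\<lambda>s. 1 / s) has_real_derivative - (1 / s\<^sup>2)) (at s)"
    using greater by (auto intro!: derivative_eq_intros simp: power2_eq_square)
  have p: "((\<lambda>s. poly p (1 / s)) has_real_derivative poly (pderiv p) (1 / s) * - (1 / s\<^sup>2)) (at s)"
    by (rule DERIV_chain2[OF poly_DERIV inv])
  have e: "((\<lambda>s. exp (- (1 / s))) has_real_derivative exp (- (1 / s)) * - (- (1 / s\<^sup>2))) (at s)"
    by (rule DERIV_chain2[OF DERIV_exp DERIV_minus[OF inv]])
  have "flat_exp (monom 1 2 * (p - pderiv p)) s =
      poly (pderiv p) (1 / s) * - (1 / s\<^sup>2) * exp (- (1 / s)) + exp (- (1 / s)) * - (- (1 / s\<^sup>2)) * poly p (1 / s)"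
    using greater by (simp add: flat_exp_def poly_monom power_one_over algebra_simps)
  with DERIV_mult[OF p e] have "((\<lambda>s. poly p (1 / s) * exp (- 1 / s)) has_real_derivative
      flat_exp (monom 1 2 * (p - pderiv p)) s) (at s)"
    by simp
  then show ?thesis
    by (rule has_field_derivative_transform_within_open[where S = "{0<..}"])
      (use greater in \<open>auto simp: flat_exp_def\<close>)
next
  case equal
  \<comment> \<open>The factor \<open>monom 1 1\<close> evaluated at 1/t is the division by t in the
    difference quotient.\<close>
  have "((\<lambda>t. poly (monom 1 1 * p) (inverse t) * exp (- inverse t)) \<longlongrightarrow> 0) (at_right (0::real))"
    by (rule filterlim_compose[OF poly_exp_tendsto_0 filterlim_inverse_at_top_right])
  moreover have "\<forall>\<^sub>F t in at_right 0. poly (monom 1 1 * p) (inverse t) * exp (- inverse t) = flat_exp p t / t"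
    by (rule eventually_at_right_less[THEN eventually_mono]) (simp add: flat_exp_def poly_monom inverse_eq_divide)
  ultimately have R: "((\<lambda>t. flat_exp p t / t) \<longlongrightarrow> 0) (at_right 0)"
    by (rule Lim_transform_eventually)
  have "\<forall>\<^sub>F t in at_left 0. 0 = flat_exp p t / t"
    by (auto simp: flat_exp_def eventually_at_filter)
  with tendsto_const have "((\<lambda>t. flat_exp p t / t) \<longlongrightarrow> 0) (at_left 0)"
    by (rule Lim_transform_eventually)
  with R have "((\<lambda>t. flat_exp p t / t) \<longlongrightarrow> 0) (at 0)"
    by (rule filterlim_split_at[rotated])
  with equal show ?thesis
    by (simp add: flat_exp_def has_field_derivative_iff)
qed

lemma Ck_flat_exp: "Ck k (flat_exp p)"
proof (induction k arbitrary: p)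
  case 0
  show ?case
    using flat_exp_deriv by (auto intro!: continuous_at_imp_continuous_on DERIV_isCont)
next
  case (Suc k)
  show ?case
    by (rule Ck_SucI[OF flat_exp_deriv[unfolded has_field_derivative_def]])
      (use Suc in auto)
qed

subsection \<open>Test functions\<close>

lemma test_functions_Ck: "\<phi> \<in> test_functions \<Omega> \<Longrightarrow> Ck k \<phi>"
  by (simp add: test_functions_def)

lemma test_functions_has_derivative:
  "\<phi> \<in> test_functions \<Omega> \<Longrightarrow> (\<phi> has_derivative frechet_derivative \<phi> (at x)) (at x)"
  by (rule Ck_has_derivative[OF test_functions_Ck])

lemma test_functions_continuous: "\<phi> \<in> test_functions \<Omega> \<Longrightarrow> continuous_on A \<phi>"
  by (meson Ck_continuous continuous_on_subset subset_UNIV test_functions_Ck)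

lemma test_functions_continuous_partial:
  assumes "\<phi> \<in> test_functions \<Omega>" "b \<in> Basis"
  shows "continuous_on A (\<lambda>x. frechet_derivative \<phi> (at x) b)"
proof -
  have "Ck (Suc 0) \<phi>" using assms by (simp only: test_functions_Ck)
  then have "continuous_on UNIV (\<lambda>x. frechet_derivative \<phi> (at x) b)"
    using assms by simp
  then show ?thesis using continuous_on_subset by blast
qed

lemma test_functions_support:
  assumes "\<phi> \<in> test_functions \<Omega>"
  obtains K where "compact K" "K \<subseteq> \<Omega>" "\<And>x. x \<notin> K \<Longrightarrow> \<phi> x = 0"
    "\<And>x b. x \<notin> K \<Longrightarrow> frechet_derivative \<phi> (at x) b = 0"
proof -
  define K where "K = closure {x. \<phi> x \<noteq> 0}"
  have "frechet_derivative \<phi> (at x) b = 0" if "x \<notin> K" for x b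
  proof -
    have "((\<lambda>_. 0) has_derivative (\<lambda>_. 0)) (at x)" by simp
    then have "(\<phi> has_derivative (\<lambda>_. 0)) (at x)"
      by (rule has_derivative_transform_within_open[where s = "- K"])
        (use that closure_subset[of "{x. \<phi> x \<noteq> 0}"] in \<open>auto simp: K_def\<close>)
    from frechet_derivative_at[OF this, symmetric] show ?thesis by simp
  qed
  moreover have "\<phi> x = 0" if "x \<notin> K" for x
    using that closure_subset[of "{x. \<phi> x \<noteq> 0}"] by (auto simp: K_def)
  moreover have "compact K" "K \<subseteq> \<Omega>"
    using assms by (simp_all only: test_functions_def K_def mem_Collect_eq)
  ultimately show ?thesis
    by (intro that[of K])
qed

lemma test_functions_mono: "\<Omega> \<subseteq> \<Omega>' \<Longrightarrow> \<phi> \<in> test_functions \<Omega> \<Longrightarrow> \<phi> \<in> test_functions \<Omega>'"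
  by (auto simp: test_functions_def)

lemma test_functions_translate:
  fixes \<phi> :: "'a::euclidean_space \<Rightarrow> real"
  assumes "\<phi> \<in> test_functions U" "\<And>x. x \<in> U \<Longrightarrow> x + a \<in> \<Omega>"
  shows "(\<lambda>x. \<phi> (x - a)) \<in> test_functions \<Omega>"
proof -
  have "{x. \<phi> (x - a) \<noteq> 0} = (+) a ` {x. \<phi> x \<noteq> 0}"
    by (auto simp: image_iff) (metis add_diff_cancel_left' diff_add_cancel add.commute)
  then have "closure {x. \<phi> (x - a) \<noteq> 0} = (+) a ` closure {x. \<phi> x \<noteq> 0}"
    by (simp add: closure_translation)
  moreover have "compact ((+) a ` closure {x. \<phi> x \<noteq> 0})"
    using assms(1) by (auto simp: test_functions_def intro!: compact_translation)
  moreover have "(+) a ` closure {x. \<phi> x \<noteq> 0} \<subseteq> \<Omega>"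
    using assms by (force simp: test_functions_def add.commute)
  ultimately show ?thesis
    using assms(1) Ck_translate[of _ \<phi> "-a"]
    by (simp add: test_functions_def del: compact_closure Ck.simps)
qed

lemma frechet_derivative_translate:
  fixes \<phi> :: "'a::euclidean_space \<Rightarrow> real"
  assumes "\<phi> \<in> test_functions U"
  shows "frechet_derivative (\<lambda>x. \<phi> (x - a)) (at x) = frechet_derivative \<phi> (at (x - a))"
proof -
  have "((\<lambda>x. \<phi> (x - a)) has_derivative frechet_derivative \<phi> (at (x - a))) (at x)"
    by (rule has_derivative_compose[OF _ test_functions_has_derivative[OF assms], where f = "\<lambda>x. x - a"])
      (auto intro!: derivative_eq_intros)
  then show ?thesis by (rule frechet_derivative_at[symmetric])
qed

lemma test_functions_bounded:
  assumes "\<phi> \<in> test_functions \<Omega>" "b \<in> Basis"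
  obtains C where "C \<ge> 0" "\<And>x. \<bar>\<phi> x\<bar> \<le> C" "\<And>x. \<bar>frechet_derivative \<phi> (at x) b\<bar> \<le> C"
proof -
  obtain K where K: "compact K" "K \<subseteq> \<Omega>" "\<And>x. x \<notin> K \<Longrightarrow> \<phi> x = 0"
    "\<And>x b. x \<notin> K \<Longrightarrow> frechet_derivative \<phi> (at x) b = 0"
    by (rule test_functions_support[OF assms(1)]) (rule that; assumption)
  have bd: "\<exists>C. \<forall>x\<in>K. \<bar>f x\<bar> \<le> C" if "continuous_on K f" for f :: "'a \<Rightarrow> real"
    using compact_imp_bounded[OF compact_continuous_image[OF that K(1)]]
    by (simp add: bounded_iff)
  obtain C1 C2 where C: "\<forall>x\<in>K. \<bar>\<phi> x\<bar> \<le> C1" "\<forall>x\<in>K. \<bar>frechet_derivative \<phi> (at x) b\<bar> \<le> C2"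
    using bd[OF test_functions_continuous[OF assms(1)]]
      bd[OF test_functions_continuous_partial[OF assms]] by metis
  show ?thesis
  proof (rule that[of "\<bar>C1\<bar> + \<bar>C2\<bar>"])
    show "\<bar>\<phi> x\<bar> \<le> \<bar>C1\<bar> + \<bar>C2\<bar>" for x
      using C(1)[rule_format, of x] K(3)[of x] by (cases "x \<in> K") auto
    show "\<bar>frechet_derivative \<phi> (at x) b\<bar> \<le> \<bar>C1\<bar> + \<bar>C2\<bar>" for x
      using C(2)[rule_format, of x] K(4)[of x b] by (cases "x \<in> K") auto
  qed simp
qed

lemma test_functions_DERIV:
  fixes \<phi> :: "'a::euclidean_space \<Rightarrow> real"
  assumes "\<phi> \<in> test_functions \<Omega>"
  shows "((\<lambda>s. \<phi> (x - s *\<^sub>R b)) has_real_derivative - frechet_derivative \<phi> (at (x - s *\<^sub>R b)) b) (at s)"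
proof -
  have lin: "frechet_derivative \<phi> (at y) (- (c *\<^sub>R b)) = - frechet_derivative \<phi> (at y) b * c" for c y
  proof -
    have "linear (frechet_derivative \<phi> (at y))"
      using test_functions_has_derivative[OF assms(1)] has_derivative_linear by blast
    from linear_scale[OF this, of "-c" b] show ?thesis
      by (simp only: scaleR_minus_left real_scaleR_def mult_minus_left mult.commute)
  qed
  have "((\<lambda>s. x - s *\<^sub>R b) has_derivative (\<lambda>c. - (c *\<^sub>R b))) (at s)"
    by (auto intro!: derivative_eq_intros)
  from has_derivative_compose[OF this test_functions_has_derivative[OF assms(1)]]
  show ?thesis
    by (simp only: has_field_derivative_def lin)
qed

lemma test_functions_increment:
  fixes \<phi> :: "'a::euclidean_space \<Rightarrow> real"
  assumes "\<phi> \<in> test_functions \<Omega>" "h \<ge> 0"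
  shows "((\<lambda>s. frechet_derivative \<phi> (at (x - s *\<^sub>R b)) b) has_integral \<phi> x - \<phi> (x - h *\<^sub>R b)) {0..h}"
proof -
  have "((\<lambda>s. - \<phi> (x - s *\<^sub>R b)) has_vector_derivative
      frechet_derivative \<phi> (at (x - s *\<^sub>R b)) b) (at s within {0..h})" for s
    using has_field_derivative_at_within[OF DERIV_minus[OF test_functions_DERIV[OF assms(1), of x b s]], of "{0..h}"]
    by (simp add: has_real_derivative_iff_has_vector_derivative)
  then have "((\<lambda>s. frechet_derivative \<phi> (at (x - s *\<^sub>R b)) b) has_integral
      - \<phi> (x - h *\<^sub>R b) - - \<phi> (x - 0 *\<^sub>R b)) {0..h}"
    using assms(2) by (intro fundamental_theorem_of_calculus)
  then show ?thesis by simp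
qed

text \<open>Smooth approximations of the indicator of an open box from inside: for each face a
  factor exp(-1/(n s)), where s is the signed distance to that face. It vanishes for s at most 0 and
  tends to 1 for s > 0 as n grows. The supports stay in the closed box.\<close>

lemma test_functions_boxes:
  fixes l u :: "'a::euclidean_space"
  assumes "cbox l u \<subseteq> \<Omega>"
  obtains \<phi> where "\<And>n::nat. \<phi> n \<in> test_functions \<Omega>" "\<And>n x. 0 \<le> \<phi> n x \<and> \<phi> n x \<le> 1"
    "\<And>n x. x \<notin> box l u \<Longrightarrow> \<phi> n x = 0" "\<And>x. x \<in> box l u \<Longrightarrow> (\<lambda>n. \<phi> n x) \<longlonglongrightarrow> 1"
proof -
  define \<psi> where "\<psi> = flat_exp 1"
  have \<psi>: "0 \<le> \<psi> s" "\<psi> s \<le> 1" "s \<le> 0 \<Longrightarrow> \<psi> s = 0" for s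
    by (auto simp: \<psi>_def flat_exp_def)
  have lim: "(\<lambda>n. \<psi> (real (Suc n) * s)) \<longlonglongrightarrow> 1" if "s > 0" for s
  proof -
    have "(\<lambda>n. exp (- (1 / s) * inverse (real (Suc n)))) \<longlonglongrightarrow> exp (- (1 / s) * 0)"
      by (intro tendsto_intros LIMSEQ_inverse_real_of_nat)
    moreover have "\<psi> (real (Suc n) * s) = exp (- (1 / s) * inverse (real (Suc n)))" for n
      using that by (auto simp: \<psi>_def flat_exp_def divide_simps zero_less_mult_iff)
    ultimately show ?thesis by simp
  qed
  define \<phi> where "\<phi> n x = (\<Prod>b\<in>Basis. \<psi> (real (Suc n) * (x \<bullet> b - l \<bullet> b)) * \<psi> (real (Suc n) * (u \<bullet> b - x \<bullet> b)))"
    for n and x :: 'a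
  have Ck: "Ck k (\<phi> n)" for k n
  proof -
    have "Ck k (\<lambda>x. \<psi> (x \<bullet> (real (Suc n) *\<^sub>R b) + (- real (Suc n) * (l \<bullet> b))) *
        \<psi> (x \<bullet> (- real (Suc n) *\<^sub>R b) + real (Suc n) * (u \<bullet> b)))" for b :: 'a
      unfolding \<psi>_def by (intro Ck_mult Ck_compose_affine Ck_flat_exp)
    then have "Ck k (\<lambda>x. \<Prod>b\<in>Basis. \<psi> (x \<bullet> (real (Suc n) *\<^sub>R b) + (- real (Suc n) * (l \<bullet> b))) *
        \<psi> (x \<bullet> (- real (Suc n) *\<^sub>R b) + real (Suc n) * (u \<bullet> b)))"
      by (rule Ck_prod)
    then show ?thesis
      by (simp add: \<phi>_def[abs_def] algebra_simps)
  qed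
  have outside: "\<phi> n x = 0" if "x \<notin> box l u" for n x
  proof -
    from that obtain b where "b \<in> Basis" "x \<bullet> b - l \<bullet> b \<le> 0 \<or> u \<bullet> b - x \<bullet> b \<le> 0"
      by (force simp: mem_box)
    then have "\<psi> (real (Suc n) * (x \<bullet> b - l \<bullet> b)) * \<psi> (real (Suc n) * (u \<bullet> b - x \<bullet> b)) = 0"
      using \<psi>(3) mult_nonneg_nonpos[of "real (Suc n)"] by (elim disjE) (simp_all del: of_nat_Suc)
    with \<open>b \<in> Basis\<close> show ?thesis
      unfolding \<phi>_def by (intro prod_zero bexI[of _ b]) simp_all
  qed
  then have sub: "closure {x. \<phi> n x \<noteq> 0} \<subseteq> cbox l u" for n
    using box_subset_cbox by (intro closure_minimal) blast+
  then have "compact (closure {x. \<phi> n x \<noteq> 0})" for n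
    using bounded_subset[OF bounded_cbox sub] by (simp only: compact_eq_bounded_closed closed_closure simp_thms)
  with sub assms Ck have "\<phi> n \<in> test_functions \<Omega>" for n
    by (auto simp only: test_functions_def)
  moreover have "0 \<le> \<phi> n x \<and> \<phi> n x \<le> 1" for n x
    unfolding \<phi>_def using \<psi> by (auto intro!: prod_nonneg prod_le_1 mult_nonneg_nonneg mult_le_one)
  moreover have "(\<lambda>n. \<phi> n x) \<longlonglongrightarrow> 1" if "x \<in> box l u" for x
  proof -
    have "(\<lambda>n. \<phi> n x) \<longlonglongrightarrow> (\<Prod>b\<in>(Basis::'a set). 1 * 1)"
      unfolding \<phi>_def using that
      by (intro tendsto_prod tendsto_mult lim) (auto simp: mem_box)
    then show ?thesis by simp
  qed
  ultimately show ?thesis using outside by (intro that[of \<phi>])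
qed

subsection \<open>The fundamental lemma of the calculus of variations\<close>

text \<open>Almost every value of \<open>g\<close> is a limit of averages over cubes that have the
  point as lower corner. For a point of the open box all small cubes of this kind lie in the box,
  and their averages are 0.\<close>

lemma lebesgue_differentiation_zero:
  fixes g :: "'a::euclidean_space \<Rightarrow> real"
  assumes "integrable (lebesgue_on (cbox l u)) g"
    and "\<And>a b. cbox a b \<subseteq> cbox l u \<Longrightarrow> integral (cbox a b) g = 0"
  shows "AE x in lebesgue. x \<in> box l u \<longrightarrow> g x = 0"
proof -
  \<comment> \<open>The differentiation theorem asks for integrability over every box, hence the
    extension by zero.\<close>
  define f where "f x = (if x \<in> cbox l u then g x else 0)" for x
  have "g absolutely_integrable_on cbox l u"
    using assms(1) by (simp add: set_integrable_def integrable_restrict_space)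
  then have "f absolutely_integrable_on UNIV"
    by (simp add: f_def[abs_def] absolutely_integrable_restrict_UNIV)
  then have "f integrable_on cbox a b" for a b
    by (meson integrable_on_subcbox set_lebesgue_integral_eq_integral(1) subset_UNIV)
  then obtain N where N: "negligible N" and lim: "\<And>x e. \<lbrakk>x \<notin> N; 0 < e\<rbrakk> \<Longrightarrow>
      \<exists>d>0. \<forall>h. 0 < h \<and> h < d \<longrightarrow>
        norm (integral (cbox x (x + h *\<^sub>R One)) f /\<^sub>R h ^ DIM('a) - f x) < e"
    by (rule integrable_ccontinuous_explicit) blast
  have "g x = 0" if "x \<in> box l u" "x \<notin> N" for x
  proof (rule ccontr)
    assume "g x \<noteq> 0"
    with lim[of x "\<bar>g x\<bar>"] that obtain d where d: "d > 0"
      "\<And>h. 0 < h \<Longrightarrow> h < d \<Longrightarrow>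
        norm (integral (cbox x (x + h *\<^sub>R One)) f /\<^sub>R h ^ DIM('a) - f x) < \<bar>g x\<bar>"
      by auto
    have "\<forall>\<^sub>F h in at_right 0. \<forall>b\<in>Basis. x \<bullet> b + h < u \<bullet> b"
    proof (subst eventually_ball_finite_distrib)
      show "\<forall>b\<in>Basis. \<forall>\<^sub>F h in at_right 0. x \<bullet> b + h < u \<bullet> b"
      proof
        fix b :: 'a assume "b \<in> Basis"
        then have "0 < u \<bullet> b - x \<bullet> b" using that by (auto simp: mem_box)
        from eventually_at_right_real[OF this]
        show "\<forall>\<^sub>F h in at_right 0. x \<bullet> b + h < u \<bullet> b"
          by eventually_elim auto
      qed
    qed auto
    moreover have "\<forall>\<^sub>F h in at_right 0. h \<in> {0<..<d}"
      using d(1) by (rule eventually_at_right_real)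
    ultimately have "\<forall>\<^sub>F h in at_right (0::real). h \<in> {0<..<d} \<and> (\<forall>b\<in>Basis. x \<bullet> b + h < u \<bullet> b)"
      by eventually_elim simp
    then obtain h where h: "h \<in> {0<..<d}" "\<forall>b\<in>Basis. x \<bullet> b + h < u \<bullet> b"
      using eventually_happens[of _ "at_right (0::real)"] trivial_limit_at_right_real by blast
    have sub: "cbox x (x + h *\<^sub>R One) \<subseteq> cbox l u"
      using h that by (fastforce simp: mem_box subset_iff inner_simps)
    then have "integral (cbox x (x + h *\<^sub>R One)) f = integral (cbox x (x + h *\<^sub>R One)) g"
      by (intro integral_cong) (auto simp: f_def)
    with assms(2)[OF sub] d(2)[of h] h that box_subset_cbox[of l u] show False
      by (auto simp: f_def)
  qed
  then show ?thesis
    using N by (intro AE_I'[of N]) (auto simp: negligible_iff_null_sets)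
qed

text \<open>Test functions converging boundedly to the indicator of a box show that \<open>g\<close>
  has integral 0 over every closed box in \<Omega>. Lebesgue differentiation then gives
  \<open>g\<close> = 0 almost everywhere in each box, and countably many boxes exhaust
  \<Omega>.\<close>

lemma fundamental_lemma:
  fixes g :: "'a::euclidean_space \<Rightarrow> real"
  assumes "open \<Omega>" "locally_integrable_on g \<Omega>"
    and test: "\<And>\<phi>. \<phi> \<in> test_functions \<Omega> \<Longrightarrow> (LINT x|lebesgue_on \<Omega>. g x * \<phi> x) = 0"
  shows "AE x in lebesgue_on \<Omega>. g x = 0"
proof -
  have [simp]: "\<Omega> \<in> sets lebesgue"
    using assms(1) by (simp add: borel_open sets_completionI_sets)
  have int0: "integral (cbox l u) g = 0" if sub: "cbox l u \<subseteq> \<Omega>" for l u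
  proof -
    have g: "integrable (lebesgue_on (cbox l u)) g"
      using assms(2) sub by (auto simp: locally_integrable_on_def)
    obtain \<phi> where \<phi>: "\<And>n::nat. \<phi> n \<in> test_functions \<Omega>" "\<And>n x. 0 \<le> \<phi> n x \<and> \<phi> n x \<le> 1"
      "\<And>n x. x \<notin> box l u \<Longrightarrow> \<phi> n x = 0" "\<And>x. x \<in> box l u \<Longrightarrow> (\<lambda>n. \<phi> n x) \<longlonglongrightarrow> 1"
      using test_functions_boxes[OF sub] by blast
    have meas: "\<phi> n \<in> borel_measurable (lebesgue_on (cbox l u))" for n
      by (rule continuous_imp_measurable_on_sets_lebesgue[OF test_functions_continuous[OF \<phi>(1)]]) simp
    have ind: "(indicator (box l u) :: 'a \<Rightarrow> real) \<in> borel_measurable (lebesgue_on (cbox l u))"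
      using box_subset_cbox[of l u]
      by (intro borel_measurable_indicator) (simp add: sets_restrict_space_iff)
    have "(\<lambda>n. LINT x|lebesgue_on (cbox l u). g x * \<phi> n x) \<longlonglongrightarrow>
        (LINT x|lebesgue_on (cbox l u). g x * indicator (box l u) x)"
    proof (rule integral_dominated_convergence[where w = "\<lambda>x. \<bar>g x\<bar>"])
      show "AE x in lebesgue_on (cbox l u). (\<lambda>n. g x * \<phi> n x) \<longlonglongrightarrow> g x * indicator (box l u) x"
        using \<phi>(3,4) by (intro always_eventually allI tendsto_mult tendsto_const)
          (auto simp: indicator_def)
      show "AE x in lebesgue_on (cbox l u). norm (g x * \<phi> n x) \<le> \<bar>g x\<bar>" for n
        using \<phi>(2) by (auto simp: abs_mult intro!: mult_left_le)
    qed (use g meas ind in auto)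
    moreover have "(LINT x|lebesgue_on (cbox l u). g x * \<phi> n x) = 0" for n
    proof -
      have "(LINT x|lebesgue_on (cbox l u). g x * \<phi> n x) = (LINT x|lebesgue_on \<Omega>. g x * \<phi> n x)"
      proof -
        have e: "indicator (cbox l u) x *\<^sub>R (g x * \<phi> n x) = indicator \<Omega> x *\<^sub>R (g x * \<phi> n x)" for x
          using sub \<phi>(3)[of x n] box_subset_cbox[of l u] by (auto simp: indicator_def)
        show ?thesis
          by (subst (1 2) integral_restrict_space; (simp only: e)?) simp_all
      qed
      with test[OF \<phi>(1)] show ?thesis by simp
    qed
    ultimately have "(LINT x|lebesgue_on (cbox l u). g x * indicator (box l u) x) = 0"
      by (simp add: LIMSEQ_const_iff)
    moreover have "(LINT x|lebesgue_on (cbox l u). g x * indicator (box l u) x) =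
        integral\<^sup>L (lebesgue_on (cbox l u)) g"
    proof (rule integral_cong_AE)
      \<comment> \<open>The test functions approach the indicator of the open box, while integrals
        over closed boxes are wanted; the faces form a null set.\<close>
      have "AE x in lebesgue. x \<notin> cbox l u - box l u"
        by (intro AE_not_in negligible_frontier_interval[unfolded negligible_iff_null_sets])
      then have "AE x in lebesgue. x \<in> cbox l u \<longrightarrow> g x * indicator (box l u) x = g x"
        by (rule eventually_mono) (auto simp: indicator_def)
      then show "AE x in lebesgue_on (cbox l u). g x * indicator (box l u) x = g x"
        by (simp add: AE_restrict_space_iff)
    qed (use g ind in auto)
    ultimately show ?thesis
      using lebesgue_integral_eq_integral[OF g] by simp
  qed
  obtain \<D> where \<D>: "countable \<D>" "\<D> \<subseteq> Pow \<Omega>" "\<And>X. X \<in> \<D> \<Longrightarrow> \<exists>a b. X = cbox a b" "\<Union>\<D> = \<Omega>"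
    using open_countable_Union_open_cbox[OF assms(1)] by metis
  have "AE x in lebesgue. x \<in> X \<longrightarrow> g x = 0" if X: "X \<in> \<D>" for X
  proof -
    obtain l u where lu: "X = cbox l u" "cbox l u \<subseteq> \<Omega>" using \<D>(2,3) X by blast
    have g: "integrable (lebesgue_on (cbox l u)) g"
      using assms(2) lu by (auto simp: locally_integrable_on_def)
    have boundary: "AE x in lebesgue. x \<notin> cbox l u - box l u"
      by (intro AE_not_in negligible_frontier_interval[unfolded negligible_iff_null_sets])
    have "AE x in lebesgue. x \<in> box l u \<longrightarrow> g x = 0"
      using lu(2) by (intro lebesgue_differentiation_zero g int0) blast
    with boundary show ?thesis
      unfolding lu(1) by eventually_elim auto
  qed
  then have "AE x in lebesgue. \<forall>X\<in>\<D>. x \<in> X \<longrightarrow> g x = 0"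
    by (subst AE_ball_countable[OF \<D>(1)]) blast
  then have "AE x in lebesgue. x \<in> \<Omega> \<longrightarrow> g x = 0"
    by (rule eventually_mono) (use \<D>(4) in blast)
  then show ?thesis
    by (simp add: AE_restrict_space_iff)
qed

subsection \<open>Averages of integrable functions along a direction\<close>

lemma integrable_lborel_translate:
  fixes f :: "'a::euclidean_space \<Rightarrow> real"
  assumes "integrable lborel f"
  shows "integrable lborel (\<lambda>x. f (x + a))"
proof -
  have "integrable (distr lborel borel ((+) a)) f"
    using assms by (simp only: lborel_distr_plus)
  then show ?thesis
    using assms by (subst (asm) integrable_distr_eq) (auto simp: add.commute)
qed

lemma integral_lborel_translate:
  fixes f :: "'a::euclidean_space \<Rightarrow> real"
  assumes "f \<in> borel_measurable borel"
  shows "(LINT x|lborel. f (x + a)) = (LINT x|lborel. f x)"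
proof -
  have "(LINT x|distr lborel borel ((+) a). f x) = (LINT x|lborel. f (a + x))"
    using assms by (intro integral_distr) auto
  then show ?thesis by (simp add: lborel_distr_plus add.commute)
qed

text \<open>Three epsilons: translation invariance gives f(x + a) - g(x + a) the same L^1 norm as f
  - g, so convergence passes from the approximations \<open>g\<close> to \<open>f\<close>. The
  hypothesis is phrased to fit both indicators and the limit step of the induction below.\<close>

lemma L1_translation_approx:
  fixes f :: "'a::euclidean_space \<Rightarrow> real"
  assumes f: "integrable lborel f"
    and approx: "\<And>e. e > 0 \<Longrightarrow> \<exists>g. integrable lborel g \<and> (LINT x|lborel. \<bar>f x - g x\<bar>) < e \<and>
      (\<lambda>k. LINT x|lborel. \<bar>g (x + a k) - g x\<bar>) \<longlonglongrightarrow> 0"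
  shows "(\<lambda>k. LINT x|lborel. \<bar>f (x + a k) - f x\<bar>) \<longlonglongrightarrow> 0"
proof (rule LIMSEQ_I)
  fix e :: real assume "e > 0"
  then obtain g where g: "integrable lborel g" "(LINT x|lborel. \<bar>f x - g x\<bar>) < e / 3"
    "(\<lambda>k. LINT x|lborel. \<bar>g (x + a k) - g x\<bar>) \<longlonglongrightarrow> 0"
    using approx[of "e / 3"] by auto
  obtain N where N: "\<And>k. k \<ge> N \<Longrightarrow> \<bar>LINT x|lborel. \<bar>g (x + a k) - g x\<bar>\<bar> < e / 3"
    using LIMSEQ_D[OF g(3), of "e / 3"] \<open>e > 0\<close> by auto
  have "norm ((LINT x|lborel. \<bar>f (x + a k) - f x\<bar>) - 0) < e" if "k \<ge> N" for k
  proof -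
    note I = f g(1) integrable_lborel_translate[OF f] integrable_lborel_translate[OF g(1)]
    have "(LINT x|lborel. \<bar>f (x + a k) - f x\<bar>) \<le> (LINT x|lborel. \<bar>f (x + a k) - g (x + a k)\<bar> +
        (\<bar>g (x + a k) - g x\<bar> + \<bar>f x - g x\<bar>))"
      by (intro integral_mono Bochner_Integration.integrable_add integrable_abs
          Bochner_Integration.integrable_diff I) auto
    also have "\<dots> = (LINT x|lborel. \<bar>f (x + a k) - g (x + a k)\<bar>) +
        ((LINT x|lborel. \<bar>g (x + a k) - g x\<bar>) + (LINT x|lborel. \<bar>f x - g x\<bar>))"
      by (subst Bochner_Integration.integral_add;
          (intro Bochner_Integration.integrable_add integrable_abs Bochner_Integration.integrable_diff I)?)
        (subst Bochner_Integration.integral_add;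
          (intro Bochner_Integration.integrable_add integrable_abs Bochner_Integration.integrable_diff I)?; simp)
    also have "(LINT x|lborel. \<bar>f (x + a k) - g (x + a k)\<bar>) = (LINT x|lborel. \<bar>f x - g x\<bar>)"
      using f g(1) by (intro integral_lborel_translate[where f = "\<lambda>x. \<bar>f x - g x\<bar>"]) auto
    also have "\<dots> + ((LINT x|lborel. \<bar>g (x + a k) - g x\<bar>) + \<dots>) < e"
      using g(2) N[OF that] by linarith
    finally show ?thesis by simp
  qed
  then show "\<exists>no. \<forall>n\<ge>no. norm ((LINT x|lborel. \<bar>f (x + a n) - f x\<bar>) - 0) < e" by blast
qed

text \<open>The indicator of an open set is lower semicontinuous, so the positive part of 1(x) - 1(x
  + a) tends to 0 at every point and is dominated by the indicator itself. The negative part has the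
  same integral, because 1(x) - 1(x + a) integrates to 0; hence the factor 2.\<close>

lemma L1_translation_open:
  fixes U :: "'a::euclidean_space set"
  assumes "open U" "emeasure lborel U < \<infinity>" "a \<longlonglongrightarrow> 0"
  shows "(\<lambda>k. LINT x|lborel. \<bar>indicator U (x + a k) - indicator U x :: real\<bar>) \<longlonglongrightarrow> 0"
proof -
  let ?i = "indicator U :: 'a \<Rightarrow> real"
  have I: "integrable lborel ?i" using assms by auto
  note I' = I integrable_lborel_translate[OF I]
  have "(\<lambda>k. LINT x|lborel. 2 * max 0 (?i x - ?i (x + a k))) \<longlonglongrightarrow> (LINT x::'a|lborel. 0 :: real)"
  proof (rule integral_dominated_convergence[where w = "\<lambda>x. 2 * ?i x"])
    show "AE x in lborel. (\<lambda>k. 2 * max 0 (?i x - ?i (x + a k))) \<longlonglongrightarrow> 0"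
    proof (intro always_eventually allI)
      fix x
      show "(\<lambda>k. 2 * max 0 (?i x - ?i (x + a k))) \<longlonglongrightarrow> 0"
      proof (cases "x \<in> U")
        case True
        have "(\<lambda>k. x + a k) \<longlonglongrightarrow> x + 0" by (intro tendsto_intros assms)
        then have "\<forall>\<^sub>F k in sequentially. x + a k \<in> U"
          using topological_tendstoD[of _ _ _ U] assms(1) True by simp
        then have "\<forall>\<^sub>F k in sequentially. 2 * max 0 (?i x - ?i (x + a k)) = 0"
          by eventually_elim (simp add: True)
        then show ?thesis by (rule tendsto_eventually)
      next
        case False
        then have "2 * max 0 (?i x - ?i (x + a k)) = 0" for k by (simp add: indicator_def)
        then show ?thesis by simp
      qed
    qed
    show "AE x in lborel. norm (2 * max 0 (?i x - ?i (x + a k))) \<le> 2 * ?i x" for k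
      by (auto simp: indicator_def)
  qed (use I' in auto)
  moreover have "(LINT x|lborel. 2 * max 0 (?i x - ?i (x + a k))) =
      (LINT x|lborel. \<bar>?i (x + a k) - ?i x\<bar>)" for k
  proof -
    have "(LINT x|lborel. ?i x - ?i (x + a k)) = 0"
      using I' integral_lborel_translate[of ?i "a k"] assms(1) by simp
    moreover have "\<bar>?i (x + a k) - ?i x\<bar> = 2 * max 0 (?i x - ?i (x + a k)) - (?i x - ?i (x + a k))" for x
      by (auto simp: max_def)
    ultimately show ?thesis
      using I' by simp
  qed
  ultimately show ?thesis by (simp only: integral_zero)
qed

text \<open>Induction over integrable functions. For a Borel set of finite measure, outer regularity
  supplies an open superset that is close in measure, which reduces the claim to open sets.\<close>

proposition L1_translation_continuous:
  fixes f :: "'a::euclidean_space \<Rightarrow> real"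
  assumes "integrable lborel f" "a \<longlonglongrightarrow> 0"
  shows "(\<lambda>k. LINT x|lborel. \<bar>f (x + a k) - f x\<bar>) \<longlonglongrightarrow> 0"
  using assms(1)
proof (induction rule: integrable_induct)
  case (base A c)
  then have A: "A \<in> sets borel" "emeasure lborel A < \<infinity>" by auto
  have "(\<lambda>k. LINT x|lborel. \<bar>indicator A (x + a k) - indicator A x :: real\<bar>) \<longlonglongrightarrow> 0"
  proof (rule L1_translation_approx)
    show "integrable lborel (indicator A :: 'a \<Rightarrow> real)" using A by auto
    fix e :: real assume "e > 0"
    then obtain U where U: "open U" "A \<subseteq> U" "emeasure lborel (U - A) < ennreal e"
      using outer_regular_lborel[OF A(1), of e] by metis
    have "emeasure lborel U = emeasure lborel A + emeasure lborel (U - A)"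
      using U A by (subst plus_emeasure) (auto simp: Un_absorb1)
    also have "\<dots> < \<infinity>"
      using A(2) U(3) by (simp add: less_top) (metis ennreal_less_top order_less_trans less_top)
    finally have fin: "emeasure lborel U < \<infinity>" .
    have "(LINT x|lborel. \<bar>indicator A x - indicator U x :: real\<bar>) = (LINT x|lborel. indicator (U - A) x)"
      using U(2) by (intro Bochner_Integration.integral_cong) (auto simp: indicator_def)
    also have "\<dots> = measure lborel (U - A)" by simp
    also have "\<dots> < e"
    proof -
      have "emeasure lborel (U - A) \<noteq> \<infinity>" using U(3) by auto
      then show ?thesis
        using U(3) by (simp add: emeasure_eq_ennreal_measure ennreal_less_iff)
    qed
    finally show "\<exists>g. integrable lborel g \<and> (LINT x|lborel. \<bar>indicator A x - g x\<bar>) < e \<and>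
        (\<lambda>k. LINT x|lborel. \<bar>g (x + a k) - g x\<bar>) \<longlonglongrightarrow> 0"
      using fin U(1) L1_translation_open[OF U(1) fin assms(2)]
      by (intro exI[of _ "indicator U"]) auto
  qed
  then have "(\<lambda>k. \<bar>c\<bar> * (LINT x|lborel. \<bar>indicator A (x + a k) - indicator A x :: real\<bar>)) \<longlonglongrightarrow> \<bar>c\<bar> * 0"
    by (intro tendsto_intros)
  moreover have "\<bar>indicator A (x + a k) *\<^sub>R c - indicator A x *\<^sub>R c\<bar> =
      \<bar>c\<bar> * \<bar>indicator A (x + a k) - indicator A x :: real\<bar>" for x k
    by (simp add: abs_mult[symmetric] algebra_simps)
  ultimately show ?case by simp
next
  case (add f g)
  note I = add(1,2) integrable_lborel_translate[OF add(1)] integrable_lborel_translate[OF add(2)]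
  show ?case
  proof (rule tendsto_sandwich[where f = "\<lambda>_. 0"])
    show "(\<lambda>k. (LINT x|lborel. \<bar>f (x + a k) - f x\<bar>) + (LINT x|lborel. \<bar>g (x + a k) - g x\<bar>)) \<longlonglongrightarrow> 0"
      using tendsto_add[OF add(3,4)] by simp
    have "(LINT x|lborel. \<bar>f (x + a k) + g (x + a k) - (f x + g x)\<bar>) \<le>
        (LINT x|lborel. \<bar>f (x + a k) - f x\<bar> + \<bar>g (x + a k) - g x\<bar>)" for k
      using I by (intro integral_mono) auto
    also have "\<dots>k = (LINT x|lborel. \<bar>f (x + a k) - f x\<bar>) + (LINT x|lborel. \<bar>g (x + a k) - g x\<bar>)" for k
      using I by simp
    finally show "\<forall>\<^sub>F k in sequentially. (LINT x|lborel. \<bar>f (x + a k) + g (x + a k) - (f x + g x)\<bar>) \<le>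
        (LINT x|lborel. \<bar>f (x + a k) - f x\<bar>) + (LINT x|lborel. \<bar>g (x + a k) - g x\<bar>)"
      by (intro always_eventually allI)
    show "(\<lambda>k. 0::real) \<longlonglongrightarrow> 0" by simp
  qed (auto intro!: always_eventually)
next
  case (lim f s)
  show ?case
  proof (rule L1_translation_approx[OF lim(4)])
    fix e :: real assume "e > 0"
    \<comment> \<open>The simple approximants are bounded by 2 |f|, which gives the dominating
      function 3 |f|.\<close>
    have "(\<lambda>i. LINT x|lborel. \<bar>f x - s i x\<bar>) \<longlonglongrightarrow> (LINT x::'a|lborel. 0 :: real)"
    proof (rule integral_dominated_convergence[where w = "\<lambda>x. 3 * \<bar>f x\<bar>"])
      show "AE x in lborel. (\<lambda>i. \<bar>f x - s i x\<bar>) \<longlonglongrightarrow> 0"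
      proof (intro always_eventually allI)
        fix x
        have "(\<lambda>i. \<bar>f x - s i x\<bar>) \<longlonglongrightarrow> \<bar>f x - f x\<bar>"
          using lim(2)[of x] by (intro tendsto_intros) auto
        then show "(\<lambda>i. \<bar>f x - s i x\<bar>) \<longlonglongrightarrow> 0" by simp
      qed
      show "AE x in lborel. norm \<bar>f x - s i x\<bar> \<le> 3 * \<bar>f x\<bar>" for i
      proof (intro always_eventually allI)
        fix x show "norm \<bar>f x - s i x\<bar> \<le> 3 * \<bar>f x\<bar>"
          using lim(3)[of x i] by simp
      qed
    qed (use lim in auto)
    then have "(\<lambda>i. LINT x|lborel. \<bar>f x - s i x\<bar>) \<longlonglongrightarrow> 0" by simp
    from eventually_happens[OF order_tendstoD(2)[OF this \<open>e > 0\<close>]]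
    obtain i where "(LINT x|lborel. \<bar>f x - s i x\<bar>) < e" by auto
    then show "\<exists>g. integrable lborel g \<and> (LINT x|lborel. \<bar>f x - g x\<bar>) < e \<and>
        (\<lambda>k. LINT x|lborel. \<bar>g (x + a k) - g x\<bar>) \<longlonglongrightarrow> 0"
      using lim(1,5) by blast
  qed
qed

section \<open>Averages along a segment and Fubini's theorem\<close>

lemma integrable_lborel_pair_product:
  fixes p :: "real \<Rightarrow> real" and f :: "'a::euclidean_space \<Rightarrow> real"
  assumes p: "integrable lborel p" and f: "integrable lborel f"
  shows "integrable (lborel \<Otimes>\<^sub>M lborel) (\<lambda>(s, x). p s * f (x + s *\<^sub>R b))"
    and "integrable (lborel \<Otimes>\<^sub>M lborel) (\<lambda>(s, x). p s * f x)"
proof -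
  have [measurable]: "p \<in> borel_measurable borel" "f \<in> borel_measurable borel"
    using assms by auto
  have inner: "(LINT x|lborel. norm (p s * f (x + s *\<^sub>R b))) = \<bar>p s\<bar> * (LINT x|lborel. \<bar>f x\<bar>)" for s b
    using integral_lborel_translate[of "\<lambda>x. \<bar>f x\<bar>" "s *\<^sub>R b"] by (simp add: abs_mult)
  have *: "integrable (lborel \<Otimes>\<^sub>M lborel) (\<lambda>(s, x). p s * f (x + s *\<^sub>R b))" for b
  proof (rule lborel_pair.Fubini_integrable)
    show "(\<lambda>(s, x). p s * f (x + s *\<^sub>R b)) \<in> borel_measurable (lborel \<Otimes>\<^sub>M lborel)"
      by measurable
    show "integrable lborel (\<lambda>s. LINT x|lborel. norm (case (s, x) of (s, x) \<Rightarrow> p s * f (x + s *\<^sub>R b)))"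
      using p by (simp only: prod.case inner) auto
    show "AE s in lborel. integrable lborel (\<lambda>x. case (s, x) of (s, x) \<Rightarrow> p s * f (x + s *\<^sub>R b))"
      using integrable_lborel_translate[OF f] by auto
  qed
  show "integrable (lborel \<Otimes>\<^sub>M lborel) (\<lambda>(s, x). p s * f (x + s *\<^sub>R b))" by (rule *)
  show "integrable (lborel \<Otimes>\<^sub>M lborel) (\<lambda>(s, x). p s * f x)" using *[of 0] by simp
qed

lemma integral_pair_swap:
  fixes F :: "real \<Rightarrow> 'a::euclidean_space \<Rightarrow> real"
  assumes "integrable (lborel \<Otimes>\<^sub>M lborel) (case_prod F)"
  shows "(LINT x|lborel. LINT s|lborel. F s x) = (LINT s|lborel. LINT x|lborel. F s x)"
    and "integrable lborel (\<lambda>x. LINT s|lborel. F s x)"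
    and "integrable lborel (\<lambda>s. LINT x|lborel. F s x)"
    and "AE x in lborel. integrable lborel (\<lambda>s. F s x)"
  using lborel_pair.Fubini_integral[OF assms] lborel_pair.integrable_snd[OF assms]
    lborel_pair.integrable_fst'[OF assms] lborel_pair.AE_integrable_snd[OF assms] by simp_all

text \<open>Divided by \<open>h\<close> this is the mean of \<open>f\<close> over the segment from x
  to x + h b. The indicator in place of a restricted domain puts the integrand directly on the
  product of two full spaces.\<close>

definition dir_integral :: "'a::euclidean_space \<Rightarrow> real \<Rightarrow> ('a \<Rightarrow> real) \<Rightarrow> 'a \<Rightarrow> real" where
  "dir_integral b h f x = (LINT s|lborel. indicator {0..h} s * f (x + s *\<^sub>R b))"

lemma integrable_indicator_Icc: "integrable lborel (indicator {a..b::real} :: real \<Rightarrow> real)"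
  by (rule integrable_real_indicator) (auto simp: emeasure_lborel_Icc_eq)

lemma integrable_dir_integral:
  "integrable lborel f \<Longrightarrow> integrable lborel (dir_integral b h f)"
  unfolding dir_integral_def[abs_def]
  by (rule integral_pair_swap(2)[OF integrable_lborel_pair_product(1)[OF integrable_indicator_Icc]])

text \<open>By Fubini the L^1 distance between the average and \<open>f\<close> is at most the mean
  over s in [0,h] of the L^1 distance between \<open>f\<close> and its translate by s b, and that
  distance tends to 0 with s.\<close>

lemma dir_average_tendsto_L1:
  fixes f :: "'a::euclidean_space \<Rightarrow> real"
  assumes f: "integrable lborel f" and h: "\<And>k. h k > 0" "h \<longlonglongrightarrow> 0"
  shows "(\<lambda>k. LINT x|lborel. \<bar>dir_integral b (h k) f x / h k - f x\<bar>) \<longlonglongrightarrow> 0"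
proof (rule LIMSEQ_I)
  fix e :: real assume "e > 0"
  define \<tau> where "\<tau> s = (LINT x|lborel. \<bar>f (x + s *\<^sub>R b) - f x\<bar>)" for s
  have "(\<tau> \<longlongrightarrow> 0) (at 0)"
    unfolding tendsto_at_iff_sequentially o_def \<tau>_def
  proof (intro allI impI)
    fix X :: "nat \<Rightarrow> real" assume "X \<longlonglongrightarrow> 0"
    then have "(\<lambda>i. X i *\<^sub>R b) \<longlonglongrightarrow> 0 *\<^sub>R b" by (intro tendsto_intros)
    then show "(\<lambda>k. LINT x|lborel. \<bar>f (x + X k *\<^sub>R b) - f x\<bar>) \<longlonglongrightarrow> 0"
      by (intro L1_translation_continuous f) simp
  qed
  then have "\<forall>\<^sub>F s in at 0. \<tau> s < e / 2"
    using order_tendstoD(2)[of \<tau> 0 _ "e / 2"] \<open>e > 0\<close> by auto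
  then obtain d where d: "d > 0" "\<And>s. s \<noteq> 0 \<Longrightarrow> \<bar>s\<bar> < d \<Longrightarrow> \<tau> s < e / 2"
    by (auto simp: eventually_at)
  have \<tau>: "\<tau> s \<le> e / 2" if "\<bar>s\<bar> < d" for s
    using d(2)[of s] that \<open>e > 0\<close> by (cases "s = 0") (auto simp: \<tau>_def)
  have bound: "(LINT x|lborel. \<bar>dir_integral b r f x / r - f x\<bar>) < e" if "0 < r" "r < d" for r
  proof -
    define F where "F s x = indicator {0..r} s * \<bar>f (x + s *\<^sub>R b) - f x\<bar>" for s x
    have "integrable (lborel \<Otimes>\<^sub>M lborel) (\<lambda>z. \<bar>(case z of (s, x) \<Rightarrow> indicator {0..r} s * f (x + s *\<^sub>R b)) -
        (case z of (s, x) \<Rightarrow> indicator {0..r} s * f x)\<bar>)"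
      by (intro integrable_abs Bochner_Integration.integrable_diff
          integrable_lborel_pair_product f integrable_indicator_Icc)
    also have "(\<lambda>z. \<bar>(case z of (s, x) \<Rightarrow> indicator {0..r} s * f (x + s *\<^sub>R b)) -
        (case z of (s, x) \<Rightarrow> indicator {0..r} s * f x)\<bar>) = case_prod F"
      by (auto simp: F_def fun_eq_iff indicator_def)
    finally have F: "integrable (lborel \<Otimes>\<^sub>M lborel) (case_prod F)" .
    have AE: "AE x in lborel. integrable lborel (\<lambda>s. indicator {0..r} s * f (x + s *\<^sub>R b))"
      by (rule integral_pair_swap(4)[OF integrable_lborel_pair_product(1)[OF integrable_indicator_Icc f]])
    have "(LINT x|lborel. \<bar>dir_integral b r f x / r - f x\<bar>) \<le> (LINT x|lborel. (LINT s|lborel. F s x) / r)"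
    proof (rule integral_mono_AE)
      show "AE x in lborel. \<bar>dir_integral b r f x / r - f x\<bar> \<le> (LINT s|lborel. F s x) / r"
        using AE integral_pair_swap(4)[OF F]
      proof eventually_elim
        case (elim x)
        have "(LINT s|lborel. indicator {0..r} s * f x) = r * f x"
          using that by simp
        then have "dir_integral b r f x / r - f x =
            (LINT s|lborel. indicator {0..r} s * f (x + s *\<^sub>R b) - indicator {0..r} s * f x) / r"
          using that elim by (simp add: dir_integral_def divide_simps mult.commute)
        also have "\<bar>\<dots>\<bar> \<le> (LINT s|lborel. \<bar>indicator {0..r} s * f (x + s *\<^sub>R b) - indicator {0..r} s * f x\<bar>) / r"
          using that integral_abs_bound by (auto simp: abs_divide intro!: divide_right_mono)
        also have "\<dots> = (LINT s|lborel. F s x) / r"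
          by (auto simp: F_def indicator_def intro!: arg_cong[where f = "\<lambda>y. y / r"] Bochner_Integration.integral_cong)
        finally show ?case .
      qed
    qed (use integrable_dir_integral[OF f] f integral_pair_swap(2)[OF F] in auto)
    also have "\<dots> = (LINT s|lborel. indicator {0..r} s * \<tau> s) / r"
      using integral_pair_swap(1)[OF F] by (simp add: F_def \<tau>_def)
    also have "\<dots> \<le> (LINT s|lborel. indicator {0..r} s * (e / 2)) / r"
    proof (intro divide_right_mono integral_mono)
      show "integrable lborel (\<lambda>s. indicator {0..r} s * \<tau> s)"
        using integral_pair_swap(3)[OF F] by (simp add: F_def \<tau>_def)
      show "indicator {0..r} s * \<tau> s \<le> indicator {0..r} s * (e / 2)" for s
        using that \<tau>[of s] by (auto simp: indicator_def)
    qed (use that in auto)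
    also have "\<dots> < e" using that \<open>e > 0\<close> by simp
    finally show ?thesis .
  qed
  have "\<forall>\<^sub>F k in sequentially. h k < d" using order_tendstoD(2)[OF h(2) d(1)] .
  then obtain N where "\<And>k. k \<ge> N \<Longrightarrow> h k < d" by (auto simp: eventually_sequentially)
  then show "\<exists>no. \<forall>n\<ge>no. norm ((LINT x|lborel. \<bar>dir_integral b (h n) f x / h n - f x\<bar>) - 0) < e"
    using bound h(1) by (intro exI[of _ N]) auto
qed

subsection \<open>Increments and the chain rule\<close>

text \<open>The bridge between the completed, restricted measure of the definitions and the Borel
  measure on the whole space, where translation and Fubini are carried out.\<close>

lemma integral_lebesgue_on_eq_lborel:
  fixes F :: "'a::euclidean_space \<Rightarrow> real"
  assumes "\<Omega> \<in> sets borel" "F \<in> borel_measurable borel" "\<And>x. x \<notin> \<Omega> \<Longrightarrow> F x = 0"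
  shows "(LINT x|lebesgue_on \<Omega>. F x) = (LINT x|lborel. F x)"
    and "integrable (lebesgue_on \<Omega>) F \<longleftrightarrow> integrable lborel F"
proof -
  have eq: "(\<lambda>x. indicator \<Omega> x * F x) = F"
    using assms(3) by (auto simp: indicator_def fun_eq_iff)
  have \<Omega>: "\<Omega> \<inter> space lebesgue \<in> sets lebesgue"
    using assms(1) by (simp add: sets_completionI_sets)
  show "(LINT x|lebesgue_on \<Omega>. F x) = (LINT x|lborel. F x)"
    using assms(2) by (simp add: integral_restrict_space[OF \<Omega>] eq integral_completion)
  show "integrable (lebesgue_on \<Omega>) F \<longleftrightarrow> integrable lborel F"
    using assms(2) by (simp add: integrable_restrict_space[OF \<Omega>] eq integrable_completion)
qed

lemma integrable_lborel_imp_locally_integrable: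
  fixes F :: "'a::euclidean_space \<Rightarrow> real"
  assumes "integrable lborel F"
  shows "locally_integrable_on F \<Omega>"
  unfolding locally_integrable_on_def
proof (intro allI impI)
  fix K :: "'a set" assume "compact K \<and> K \<subseteq> \<Omega>"
  then have K: "K \<in> sets borel" by (simp add: borel_compact)
  then have "integrable lborel (\<lambda>x. indicator K x *\<^sub>R F x)"
    using assms by (intro integrable_mult_indicator) auto
  then have "integrable lebesgue (\<lambda>x. indicator K x *\<^sub>R F x)"
    by (subst integrable_completion) (rule borel_measurable_integrable)
  with K show "integrable (lebesgue_on K) F"
    by (simp add: integrable_restrict_space sets_completionI_sets)
qed

text \<open>Only the integration by parts, over the whole space: test functions vanish outside
  \<Omega>, so for suitable representatives this agrees with the identity in
  \<open>has_weak_partial\<close>.\<close>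

definition weak_partial_lborel ::
  "'a::euclidean_space set \<Rightarrow> 'a \<Rightarrow> ('a \<Rightarrow> real) \<Rightarrow> ('a \<Rightarrow> real) \<Rightarrow> bool" where
  "weak_partial_lborel \<Omega> b f g \<longleftrightarrow> (\<forall>\<phi>\<in>test_functions \<Omega>.
     (LINT x|lborel. f x * frechet_derivative \<phi> (at x) b) = - (LINT x|lborel. g x * \<phi> x))"

lemma integrable_mult_bounded:
  fixes f \<phi> :: "'a \<Rightarrow> real"
  assumes "integrable M f" "\<phi> \<in> borel_measurable M" "\<And>x. \<bar>\<phi> x\<bar> \<le> C"
  shows "integrable M (\<lambda>x. f x * \<phi> x)"
proof (rule Bochner_Integration.integrable_bound)
  show "integrable M (\<lambda>x. C * f x)" using assms(1) by simp
  have "\<bar>f x\<bar> * \<bar>\<phi> x\<bar> \<le> \<bar>C\<bar> * \<bar>f x\<bar>" for x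
    using assms(3)[of x] by (subst mult.commute) (auto intro!: mult_right_mono)
  then show "AE x in M. norm (f x * \<phi> x) \<le> norm (C * f x)"
    by (simp add: abs_mult)
qed (use assms in auto)

text \<open>For a test function \<phi> on \<open>U\<close> and s in [0,h] the translate \<phi>(x - s
  b) is a test function on \<Omega>. Integrating its integration by parts over s moves the average
  of \<open>g\<close> to \<open>f\<close> times the integral of the derivative of \<phi>, that is,
  to \<phi>(x) - \<phi>(x - h b). Translating back gives the increment of \<open>f\<close>, and the
  fundamental lemma removes \<phi>.\<close>

lemma weak_partial_increment:
  fixes f g :: "'a::euclidean_space \<Rightarrow> real"
  assumes b: "b \<in> Basis" and fg: "integrable lborel f" "integrable lborel g"
    and weak: "weak_partial_lborel \<Omega> b f g"
    and U: "open U" and h: "h > 0" and shift: "\<And>x s. x \<in> U \<Longrightarrow> 0 \<le> s \<Longrightarrow> s \<le> h \<Longrightarrow> x + s *\<^sub>R b \<in> \<Omega>"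
  shows "AE x in lborel. x \<in> U \<longrightarrow> f (x + h *\<^sub>R b) - f x = dir_integral b h g x"
proof -
  define D where "D x = f (x + h *\<^sub>R b) - f x - dir_integral b h g x" for x
  note fh = integrable_lborel_translate[OF fg(1), of "h *\<^sub>R b"]
  have D: "integrable lborel D"
    unfolding D_def[abs_def]
    by (intro Bochner_Integration.integrable_diff fh fg integrable_dir_integral)
  have [measurable]: "f \<in> borel_measurable borel" "g \<in> borel_measurable borel" "D \<in> borel_measurable borel"
    using fg D by auto
  have "AE x in lebesgue_on U. D x = 0"
  proof (rule fundamental_lemma[OF U integrable_lborel_imp_locally_integrable[OF D]])
    fix \<phi> assume \<phi>: "\<phi> \<in> test_functions U"
    obtain C where C: "C \<ge> 0" "\<And>x. \<bar>\<phi> x\<bar> \<le> C" "\<And>x. \<bar>frechet_derivative \<phi> (at x) b\<bar> \<le> C"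
      by (rule test_functions_bounded[OF \<phi> b]) (rule that; assumption)
    define \<phi>' where "\<phi>' x = frechet_derivative \<phi> (at x) b" for x
    have \<phi>m[measurable]: "\<phi> \<in> borel_measurable borel" "\<phi>' \<in> borel_measurable borel"
      unfolding \<phi>'_def[abs_def]
      by (intro borel_measurable_continuous_onI test_functions_continuous[OF \<phi>]
          test_functions_continuous_partial[OF \<phi> b])+
    have outside: "\<phi> x = 0" if "x \<notin> U" for x
      by (rule test_functions_support[OF \<phi>]) (use that in blast)
    have int\<phi>: "integrable lborel (\<lambda>x. k x * \<phi> (x - a))" "integrable lborel (\<lambda>x. k x * \<phi>' (x - a))"
      if "integrable lborel k" for k a
      using C that by (auto intro!: integrable_mult_bounded[where C = C] simp: \<phi>'_def[symmetric])
    have "(LINT x|lborel. dir_integral b h g x * \<phi> x) =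
        (LINT x|lborel. LINT s|lborel. indicator {0..h} s * g (x + s *\<^sub>R b) * \<phi> x)"
      by (simp add: dir_integral_def)
    also have "\<dots> = (LINT s|lborel. LINT x|lborel. indicator {0..h} s * g (x + s *\<^sub>R b) * \<phi> x)"
    proof (rule integral_pair_swap(1))
      have "integrable (lborel \<Otimes>\<^sub>M lborel)
          (\<lambda>z. (case z of (s, x) \<Rightarrow> indicator {0..h} s * g (x + s *\<^sub>R b)) * \<phi> (snd z))"
        using C by (intro integrable_mult_bounded[where C = C]
            integrable_lborel_pair_product integrable_indicator_Icc fg) auto
      then show "integrable (lborel \<Otimes>\<^sub>M lborel)
          (\<lambda>(s, x). indicator {0..h} s * g (x + s *\<^sub>R b) * \<phi> x)"
        by (simp add: case_prod_unfold)
    qed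
    also have "\<dots> = (LINT s|lborel. LINT x|lborel. - (indicator {0..h} s * f x * \<phi>' (x - s *\<^sub>R b)))"
    proof (rule Bochner_Integration.integral_cong[OF refl])
      fix s :: real
      show "(LINT x|lborel. indicator {0..h} s * g (x + s *\<^sub>R b) * \<phi> x) =
          (LINT x|lborel. - (indicator {0..h} s * f x * \<phi>' (x - s *\<^sub>R b)))"
      proof (cases "s \<in> {0..h}")
        \<comment> \<open>Exactly for these s the hypothesis \<open>shift\<close> keeps the
          translated support inside \<Omega>.\<close>
        case True
        have t: "(\<lambda>x. \<phi> (x - s *\<^sub>R b)) \<in> test_functions \<Omega>"
          using True shift by (intro test_functions_translate[OF \<phi>]) auto
        have "(LINT x|lborel. g (x + s *\<^sub>R b) * \<phi> x) = (LINT x|lborel. g x * \<phi> (x - s *\<^sub>R b))"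
          using integral_lborel_translate[of "\<lambda>x. g x * \<phi> (x - s *\<^sub>R b)" "s *\<^sub>R b"] by simp
        also have "\<dots> = - (LINT x|lborel. f x * \<phi>' (x - s *\<^sub>R b))"
          using weak t unfolding weak_partial_lborel_def
          by (auto simp: frechet_derivative_translate[OF \<phi>] \<phi>'_def)
        finally show ?thesis using True by simp
      qed simp
    qed
    also have "\<dots> = - (LINT s|lborel. LINT x|lborel. indicator {0..h} s * f x * \<phi>' (x - s *\<^sub>R b))"
      by simp
    also have "(LINT s|lborel. LINT x|lborel. indicator {0..h} s * f x * \<phi>' (x - s *\<^sub>R b)) =
        (LINT x|lborel. LINT s|lborel. indicator {0..h} s * f x * \<phi>' (x - s *\<^sub>R b))"
    proof (rule integral_pair_swap(1)[symmetric])
      have "integrable (lborel \<Otimes>\<^sub>M lborel)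
          (\<lambda>z. (case z of (s, x) \<Rightarrow> indicator {0..h} s * f x) * \<phi>' (snd z - fst z *\<^sub>R b))"
        using C by (intro integrable_mult_bounded[where C = C]
            integrable_lborel_pair_product integrable_indicator_Icc fg) (auto simp: \<phi>'_def[symmetric])
      then show "integrable (lborel \<Otimes>\<^sub>M lborel)
          (\<lambda>(s, x). indicator {0..h} s * f x * \<phi>' (x - s *\<^sub>R b))"
        by (simp add: case_prod_unfold)
    qed
    also have "\<dots> = (LINT x|lborel. f x * (\<phi> x - \<phi> (x - h *\<^sub>R b)))"
    proof (rule Bochner_Integration.integral_cong[OF refl])
      fix x
      have c: "continuous_on {0..h} (\<lambda>s. \<phi>' (x - s *\<^sub>R b))"
        unfolding \<phi>'_def
        by (rule continuous_on_compose2[OF test_functions_continuous_partial[OF \<phi> b, of UNIV]])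
          (auto intro!: continuous_intros)
      have "(LINT s:{0..h}|lborel. \<phi>' (x - s *\<^sub>R b)) = integral {0..h} (\<lambda>s. \<phi>' (x - s *\<^sub>R b))"
        by (rule set_borel_integral_eq_integral[OF borel_integrable_atLeastAtMost'[OF c]])
      also have "\<dots> = \<phi> x - \<phi> (x - h *\<^sub>R b)"
        unfolding \<phi>'_def using test_functions_increment[OF \<phi>, where h = h and b = b and x = x] h by (simp add: integral_unique)
      finally have "(LINT s|lborel. f x * (indicator {0..h} s * \<phi>' (x - s *\<^sub>R b))) =
          f x * (\<phi> x - \<phi> (x - h *\<^sub>R b))"
        by (simp add: set_lebesgue_integral_def)
      then show "(LINT s|lborel. indicator {0..h} s * f x * \<phi>' (x - s *\<^sub>R b)) =
          f x * (\<phi> x - \<phi> (x - h *\<^sub>R b))"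
        by (simp add: mult_ac)
    qed
    also have "\<dots> = (LINT x|lborel. f x * \<phi> x) - (LINT x|lborel. f x * \<phi> (x - h *\<^sub>R b))"
      using int\<phi>(1)[OF fg(1), of 0] int\<phi>(1)[OF fg(1)] by (simp add: right_diff_distrib)
    also have "(LINT x|lborel. f x * \<phi> (x - h *\<^sub>R b)) = (LINT x|lborel. f (x + h *\<^sub>R b) * \<phi> x)"
      using integral_lborel_translate[of "\<lambda>x. f x * \<phi> (x - h *\<^sub>R b)" "h *\<^sub>R b"] by simp
    finally have "(LINT x|lborel. D x * \<phi> x) = 0"
      using int\<phi>(1)[OF fg(1), of 0] int\<phi>(1)[OF fh, of 0] int\<phi>(1)[OF integrable_dir_integral[OF fg(2), of b h], of 0]
      by (simp add: D_def left_diff_distrib)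
    then show "(LINT x|lebesgue_on U. D x * \<phi> x) = 0"
      using U outside by (subst integral_lebesgue_on_eq_lborel) (auto simp: borel_open)
  qed
  then have "AE x in lebesgue. x \<in> U \<longrightarrow> D x = 0"
    using U by (simp add: AE_restrict_space_iff borel_open sets_completionI_sets)
  then have "AE x in lborel. x \<in> U \<longrightarrow> D x = 0"
    by (simp add: AE_completion_iff)
  then show ?thesis by eventually_elim (simp add: D_def)
qed

lemma test_functions_increment_bound:
  fixes \<phi> :: "'a::euclidean_space \<Rightarrow> real"
  assumes "\<phi> \<in> test_functions \<Omega>" "\<And>x. \<bar>frechet_derivative \<phi> (at x) b\<bar> \<le> C"
  shows "\<bar>\<phi> (x - h *\<^sub>R b) - \<phi> x\<bar> \<le> C * \<bar>h\<bar>"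
  using field_differentiable_bound[of UNIV "\<lambda>s. \<phi> (x - s *\<^sub>R b)"
      "\<lambda>s. - frechet_derivative \<phi> (at (x - s *\<^sub>R b)) b" C h 0] test_functions_DERIV[OF assms(1)] assms(2)
  by simp

text \<open>The sequence may hit \<open>s\<close>, where the quotient reads 0/0; with the value
  \<open>D\<close> inserted there the quotient becomes a function continuous at
  \<open>s\<close>.\<close>

lemma difference_quotient_tendsto:
  fixes G :: "real \<Rightarrow> real"
  assumes "(G has_real_derivative D) (at s)" "y \<longlonglongrightarrow> s"
  shows "(\<lambda>k. if y k = s then D else (G (y k) - G s) / (y k - s)) \<longlonglongrightarrow> D"
proof -
  define d where "d y = (if y = s then D else (G y - G s) / (y - s))" for y
  have "((\<lambda>y. (G y - G s) / (y - s)) \<longlongrightarrow> D) (at s)"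
    using assms(1) by (simp add: has_field_derivative_iff)
  then have "(d \<longlongrightarrow> D) (at s)"
    by (rule Lim_transform_eventually) (auto simp: d_def eventually_at_filter)
  then have "isCont d s" by (simp add: isCont_def d_def)
  from isCont_tendsto_compose[OF this assms(2)] show ?thesis
    by (simp add: d_def)
qed

text \<open>The difference quotient of G(f) along b equals a q, with \<open>q\<close> the average of
  \<open>g\<close> over a short segment and \<open>a\<close> the difference quotient of
  \<open>G\<close> between two values of \<open>f\<close>, bounded by 1. Shifting the quotient onto
  the test function gives the left-hand side in the limit. On the other side \<open>q\<close> tends
  to \<open>g\<close> in L^1 and \<open>a\<close> tends to G'(f) almost everywhere along a
  subsequence.\<close>

lemma chain_rule_L1:
  fixes f g :: "'a::euclidean_space \<Rightarrow> real" and G G' :: "real \<Rightarrow> real"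
  assumes b: "b \<in> Basis" and \<Omega>: "open \<Omega>"
    and fg: "integrable lborel f" "integrable lborel g" and weak: "weak_partial_lborel \<Omega> b f g"
    and G: "\<And>s. (G has_real_derivative G' s) (at s)" "\<And>s. \<bar>G' s\<bar> \<le> 1" "G 0 = 0"
    and G'[measurable]: "G' \<in> borel_measurable borel" and \<phi>: "\<phi> \<in> test_functions \<Omega>"
  shows "(LINT x|lborel. G (f x) * frechet_derivative \<phi> (at x) b) = - (LINT x|lborel. G' (f x) * g x * \<phi> x)"
proof -
  have lip: "\<bar>G s - G t\<bar> \<le> \<bar>s - t\<bar>" for s t
    using field_differentiable_bound[of UNIV G G' 1 s t] G by auto
  have [measurable]: "G \<in> borel_measurable borel"
    using G(1) by (intro borel_measurable_continuous_onI) (blast intro: DERIV_isCont continuous_at_imp_continuous_on)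
  have [measurable]: "f \<in> borel_measurable borel" "g \<in> borel_measurable borel" using fg by auto
  obtain C where C: "C \<ge> 0" "\<And>x. \<bar>\<phi> x\<bar> \<le> C" "\<And>x. \<bar>frechet_derivative \<phi> (at x) b\<bar> \<le> C"
    by (rule test_functions_bounded[OF \<phi> b]) (rule that; assumption)
  define \<phi>' where "\<phi>' x = frechet_derivative \<phi> (at x) b" for x
  have [measurable]: "\<phi> \<in> borel_measurable borel" "\<phi>' \<in> borel_measurable borel"
    unfolding \<phi>'_def[abs_def]
    by (intro borel_measurable_continuous_onI test_functions_continuous[OF \<phi>]
        test_functions_continuous_partial[OF \<phi> b])+
  obtain K where K: "compact K" "K \<subseteq> \<Omega>" "\<And>x. x \<notin> K \<Longrightarrow> \<phi> x = 0"
    by (rule test_functions_support[OF \<phi>]) (rule that; assumption)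
  obtain e where e: "e > 0" "(\<Union>x\<in>K. ball x e) \<subseteq> \<Omega>"
    by (rule compact_subset_open_imp_ball_epsilon_subset[OF K(1) \<Omega> K(2)])
  \<comment> \<open>Half of the distance e is spent on \<open>U\<close>, the other half on the steps
    \<open>h k\<close>: segments of length at most e/2 starting in \<open>U\<close> stay in
    \<Omega>.\<close>
  define U where "U = (\<Union>x\<in>K. ball x (e / 2))"
  have "open U" by (auto simp: U_def)
  have \<phi>U: "\<phi> x = 0" if "x \<notin> U" for x
  proof -
    have "x \<notin> K"
    proof
      assume "x \<in> K"
      moreover have "x \<in> ball x (e / 2)" using e(1) by simp
      ultimately show False using that by (auto simp: U_def)
    qed
    then show ?thesis by (rule K(3))
  qed
  define h where "h k = e / 2 / real (Suc k)" for k
  have h: "h k > 0" "h k \<le> e / 2" for k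
    using e(1) by (simp_all add: h_def field_simps)
  have h0: "h \<longlonglongrightarrow> 0"
  proof -
    have "(\<lambda>k. e / 2 * inverse (real (Suc k))) \<longlonglongrightarrow> e / 2 * 0"
      by (intro tendsto_intros LIMSEQ_inverse_real_of_nat)
    moreover have "e / 2 * inverse (real (Suc k)) = h k" for k
      by (simp only: h_def divide_inverse)
    ultimately show ?thesis by (simp only: mult_zero_right)
  qed
  define q where "q k x = dir_integral b (h k) g x / h k" for k x
  have q: "integrable lborel (q k)" for k
    unfolding q_def[abs_def] by (intro integrable_divide integrable_dir_integral fg)
  have [measurable]: "q k \<in> borel_measurable borel" for k using q[of k] by auto
  have inc: "AE x in lborel. \<forall>k. x \<in> U \<longrightarrow> f (x + h k *\<^sub>R b) - f x = h k * q k x"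
  proof (subst AE_all_countable, rule allI)
    fix k
    have "AE x in lborel. x \<in> U \<longrightarrow> f (x + h k *\<^sub>R b) - f x = dir_integral b (h k) g x"
    proof (rule weak_partial_increment[OF b fg weak \<open>open U\<close> h(1)])
      fix x s assume "x \<in> U" "0 \<le> s" "s \<le> h k"
      then obtain y where y: "y \<in> K" "dist y x < e / 2" by (auto simp: U_def)
      have "dist y (x + s *\<^sub>R b) \<le> dist y x + dist x (x + s *\<^sub>R b)" by (rule dist_triangle)
      also have "dist x (x + s *\<^sub>R b) \<le> e / 2"
        using \<open>0 \<le> s\<close> \<open>s \<le> h k\<close> h(2)[of k] b by (simp add: dist_norm)
      finally show "x + s *\<^sub>R b \<in> \<Omega>" using y e(2) by (force simp: subset_iff)
    qed
    then show "AE x in lborel. x \<in> U \<longrightarrow> f (x + h k *\<^sub>R b) - f x = h k * q k x"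
      by eventually_elim (use h(1)[of k] in \<open>simp add: q_def\<close>)
  qed
  have L1: "(\<lambda>k. LINT x|lborel. \<bar>q k x - g x\<bar>) \<longlonglongrightarrow> 0"
    unfolding q_def by (rule dir_average_tendsto_L1[OF fg(2) h(1) h0])
  \<comment> \<open>Almost everywhere convergence of \<open>q\<close> also yields f(x + h b) = f(x)
    + h q(x) -> f(x), although \<open>f\<close> itself need not be continuous.\<close>
  obtain r where r: "strict_mono r" "AE x in lborel. (\<lambda>k. q (r k) x - g x) \<longlonglongrightarrow> 0"
    using tendsto_L1_AE_subseq[of lborel "\<lambda>k x. q k x - g x"] L1 q fg(2) by auto
  have r0: "filterlim r sequentially sequentially" using r(1) by (rule filterlim_subseq)
  \<comment> \<open>If the increment of \<open>f\<close> vanishes then so does \<open>q\<close>,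
    hence any value of \<open>a\<close> is consistent there; G'(f x) is the one compatible with the
    limit.\<close>
  define a where "a k x = (if f (x + h k *\<^sub>R b) = f x then G' (f x) else
      (G (f (x + h k *\<^sub>R b)) - G (f x)) / (f (x + h k *\<^sub>R b) - f x))" for k x
  have [measurable]: "a k \<in> borel_measurable borel" for k
    unfolding a_def[abs_def] by measurable
  have a1: "\<bar>a k x\<bar> \<le> 1" for k x
    using lip[of "f (x + h k *\<^sub>R b)" "f x"] G(2) by (auto simp: a_def abs_divide divide_le_eq_1)
  have aq: "(G (f (x + h k *\<^sub>R b)) - G (f x)) / h k = a k x * q k x"
    if "f (x + h k *\<^sub>R b) - f x = h k * q k x" for k x
    using that h(1)[of k] by (auto simp: a_def divide_simps)
  \<comment> \<open>\<open>J\<close> is evaluated twice, by moving the difference quotient onto the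
    test function and by letting \<open>a\<close> and \<open>q\<close> converge; comparing the two
    limits gives the claim.\<close>
  define J where "J k = (LINT x|lborel. a k x * q k x * \<phi> x)" for k

  have Gf: "integrable lborel (\<lambda>x. G (f x))"
    by (rule Bochner_Integration.integrable_bound[OF fg(1)]) (use lip[of _ 0] G(3) in auto)
  note Gfh = integrable_lborel_translate[OF Gf]
  have int\<phi>: "integrable lborel (\<lambda>x. k x * \<phi> (x - c))" if "integrable lborel k" for k c
    using C that by (auto intro!: integrable_mult_bounded[where C = C])
  have Jeq: "J k = (LINT x|lborel. G (f x) * ((\<phi> (x - h k *\<^sub>R b) - \<phi> x) / h k))" for k
  proof -
    have "J k = (LINT x|lborel. (G (f (x + h k *\<^sub>R b)) * \<phi> x - G (f x) * \<phi> x) / h k)"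
      unfolding J_def
    proof (rule integral_cong_AE)
      show "AE x in lborel. a k x * q k x * \<phi> x = (G (f (x + h k *\<^sub>R b)) * \<phi> x - G (f x) * \<phi> x) / h k"
        using inc
      proof eventually_elim
        case (elim x)
        show ?case
        proof (cases "x \<in> U")
          case True
          with elim aq[of x k] have "a k x * q k x * \<phi> x = (G (f (x + h k *\<^sub>R b)) - G (f x)) / h k * \<phi> x"
            by simp
          then show ?thesis by (simp add: left_diff_distrib)
        qed (simp add: \<phi>U)
      qed
    qed measurable
    also have "\<dots> = ((LINT x|lborel. G (f (x + h k *\<^sub>R b)) * \<phi> x) - (LINT x|lborel. G (f x) * \<phi> x)) / h k"
      using int\<phi>[OF Gf, of 0] int\<phi>[OF Gfh[of "h k *\<^sub>R b"], of 0] by simp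
    also have "(LINT x|lborel. G (f (x + h k *\<^sub>R b)) * \<phi> x) = (LINT x|lborel. G (f x) * \<phi> (x - h k *\<^sub>R b))"
      using integral_lborel_translate[of "\<lambda>x. G (f x) * \<phi> (x - h k *\<^sub>R b)" "h k *\<^sub>R b"] by simp
    also have "(\<dots> - (LINT x|lborel. G (f x) * \<phi> x)) / h k =
        (LINT x|lborel. (G (f x) * \<phi> (x - h k *\<^sub>R b) - G (f x) * \<phi> x) / h k)"
      using int\<phi>[OF Gf, of 0] int\<phi>[OF Gf, of "h k *\<^sub>R b"] by simp
    finally show ?thesis by (simp add: right_diff_distrib)
  qed
  have lim: "(\<lambda>k. LINT x|lborel. G (f x) * ((\<phi> (x - h k *\<^sub>R b) - \<phi> x) / h k)) \<longlonglongrightarrow>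
      (LINT x|lborel. G (f x) * - \<phi>' x)"
  proof (rule integral_dominated_convergence[where w = "\<lambda>x. C * \<bar>f x\<bar>"])
    show "AE x in lborel. (\<lambda>k. G (f x) * ((\<phi> (x - h k *\<^sub>R b) - \<phi> x) / h k)) \<longlonglongrightarrow> G (f x) * - \<phi>' x"
    proof (intro always_eventually allI tendsto_mult tendsto_const)
      fix x
      have "h k \<noteq> 0" for k using h(1)[of k] by simp
      with difference_quotient_tendsto[OF test_functions_DERIV[OF \<phi>, of x b 0] h0]
      show "(\<lambda>k. (\<phi> (x - h k *\<^sub>R b) - \<phi> x) / h k) \<longlonglongrightarrow> - \<phi>' x"
        by (simp add: \<phi>'_def)
    qed
    show "AE x in lborel. norm (G (f x) * ((\<phi> (x - h k *\<^sub>R b) - \<phi> x) / h k)) \<le> C * \<bar>f x\<bar>" for k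
    proof (intro always_eventually allI)
      fix x
      have "\<bar>\<phi> (x - h k *\<^sub>R b) - \<phi> x\<bar> / h k \<le> C"
        using test_functions_increment_bound[OF \<phi> C(3), of x "h k"] h(1)[of k] by (simp add: divide_le_eq)
      moreover have "\<bar>G (f x)\<bar> \<le> \<bar>f x\<bar>" using lip[of "f x" 0] G(3) by simp
      ultimately have "\<bar>G (f x)\<bar> * (\<bar>\<phi> (x - h k *\<^sub>R b) - \<phi> x\<bar> / h k) \<le> \<bar>f x\<bar> * C"
        using h(1)[of k] by (intro mult_mono) auto
      then show "norm (G (f x) * ((\<phi> (x - h k *\<^sub>R b) - \<phi> x) / h k)) \<le> C * \<bar>f x\<bar>"
        using h(1)[of k] by (simp add: abs_mult abs_divide mult.commute)
    qed
  qed (use fg in auto)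
  from lim have "J \<longlonglongrightarrow> (LINT x|lborel. G (f x) * - \<phi>' x)"
    unfolding Jeq[symmetric] .
  then have J1: "(\<lambda>k. J (r k)) \<longlonglongrightarrow> (LINT x|lborel. G (f x) * - \<phi>' x)"
    using r0 by (rule filterlim_compose)

  have ia: "integrable lborel (\<lambda>x. a k x * p x * \<phi> x)" if "integrable lborel p" for p k
  proof -
    have "integrable lborel (\<lambda>x. p x * a k x)"
      by (rule integrable_mult_bounded[OF that _ a1]) simp
    from int\<phi>[OF this, of 0] show ?thesis by (simp add: mult_ac)
  qed
  have i1: "integrable lborel (\<lambda>x. a k x * (q k x - g x) * \<phi> x)" for k
    by (intro ia Bochner_Integration.integrable_diff q fg)
  have i2: "integrable lborel (\<lambda>x. a k x * g x * \<phi> x)" for k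
    by (intro ia fg)
  have "(\<lambda>k. LINT x|lborel. a (r k) x * g x * \<phi> x) \<longlonglongrightarrow> (LINT x|lborel. G' (f x) * g x * \<phi> x)"
  proof (rule integral_dominated_convergence[where w = "\<lambda>x. C * \<bar>g x\<bar>"])
    show "AE x in lborel. (\<lambda>k. a (r k) x * g x * \<phi> x) \<longlonglongrightarrow> G' (f x) * g x * \<phi> x"
      using inc r(2)
    proof eventually_elim
      case (elim x)
      show ?case
      proof (cases "x \<in> U")
        case True
        have "(\<lambda>k. q (r k) x - g x + g x) \<longlonglongrightarrow> 0 + g x"
          using elim by (intro tendsto_intros)
        then have "(\<lambda>k. f x + h (r k) * q (r k) x) \<longlonglongrightarrow> f x + 0 * g x"
          using filterlim_compose[OF h0 r0] by (intro tendsto_intros) auto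
        moreover have "f x + h (r k) * q (r k) x = f (x + h (r k) *\<^sub>R b)" for k
          using elim(1)[rule_format, OF True, of "r k"] by simp
        ultimately have "(\<lambda>k. f (x + h (r k) *\<^sub>R b)) \<longlonglongrightarrow> f x" by simp
        from difference_quotient_tendsto[OF G(1) this] show ?thesis
          unfolding a_def by (intro tendsto_intros)
      qed (simp add: \<phi>U)
    qed
    show "AE x in lborel. norm (a (r k) x * g x * \<phi> x) \<le> C * \<bar>g x\<bar>" for k
    proof (intro always_eventually allI)
      fix x
      have "\<bar>a (r k) x\<bar> * \<bar>g x\<bar> * \<bar>\<phi> x\<bar> \<le> 1 * \<bar>g x\<bar> * C"
        using a1 C by (intro mult_mono) auto
      then show "norm (a (r k) x * g x * \<phi> x) \<le> C * \<bar>g x\<bar>" by (simp add: abs_mult mult.commute)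
    qed
  qed (use fg in auto)
  moreover have "(\<lambda>k. LINT x|lborel. a (r k) x * (q (r k) x - g x) * \<phi> x) \<longlonglongrightarrow> 0"
  proof (rule Lim_null_comparison)
    \<comment> \<open>Since \<open>a\<close> and \<phi> are bounded, replacing \<open>q\<close> by
      \<open>g\<close> costs at most a multiple of their L^1 distance.\<close>
    have "\<bar>LINT x|lborel. a k x * (q k x - g x) * \<phi> x\<bar> \<le> C * (LINT x|lborel. \<bar>q k x - g x\<bar>)" for k
    proof -
      have "\<bar>LINT x|lborel. a k x * (q k x - g x) * \<phi> x\<bar> \<le> (LINT x|lborel. \<bar>a k x * (q k x - g x) * \<phi> x\<bar>)"
        by (rule integral_abs_bound)
      also have "\<dots> \<le> (LINT x|lborel. C * \<bar>q k x - g x\<bar>)"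
      proof (rule integral_mono)
        fix x
        have "\<bar>a k x\<bar> * \<bar>q k x - g x\<bar> * \<bar>\<phi> x\<bar> \<le> 1 * \<bar>q k x - g x\<bar> * C"
          using a1 C by (intro mult_mono) auto
        then show "\<bar>a k x * (q k x - g x) * \<phi> x\<bar> \<le> C * \<bar>q k x - g x\<bar>" by (simp add: abs_mult mult.commute)
      qed (use i1 q fg in auto)
      finally show ?thesis by simp
    qed
    then show "\<forall>\<^sub>F k in sequentially. norm (LINT x|lborel. a (r k) x * (q (r k) x - g x) * \<phi> x) \<le>
        C * (LINT x|lborel. \<bar>q (r k) x - g x\<bar>)"
      by simp
    have "(\<lambda>k. C * (LINT x|lborel. \<bar>q (r k) x - g x\<bar>)) \<longlonglongrightarrow> C * 0"
      by (intro tendsto_intros filterlim_compose[OF L1 r0])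
    then show "(\<lambda>k. C * (LINT x|lborel. \<bar>q (r k) x - g x\<bar>)) \<longlonglongrightarrow> 0" by simp
  qed
  ultimately have "(\<lambda>k. (LINT x|lborel. a (r k) x * (q (r k) x - g x) * \<phi> x) + (LINT x|lborel. a (r k) x * g x * \<phi> x))
      \<longlonglongrightarrow> 0 + (LINT x|lborel. G' (f x) * g x * \<phi> x)"
    by (intro tendsto_add)
  moreover have "J k = (LINT x|lborel. a k x * (q k x - g x) * \<phi> x) + (LINT x|lborel. a k x * g x * \<phi> x)" for k
    using i1[of k] i2[of k] unfolding J_def
    by (subst Bochner_Integration.integral_add[symmetric]) (auto simp: algebra_simps)
  ultimately have "(\<lambda>k. J (r k)) \<longlonglongrightarrow> (LINT x|lborel. G' (f x) * g x * \<phi> x)"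
    by (simp only: add_0_left)
  from LIMSEQ_unique[OF J1 this] show ?thesis
    by (simp add: \<phi>'_def)
qed

section \<open>Non-smooth functions of a weakly differentiable function\<close>

definition locally_integrable_lborel :: "('a::euclidean_space \<Rightarrow> real) \<Rightarrow> bool" where
  "locally_integrable_lborel f \<longleftrightarrow> f \<in> borel_measurable borel \<and>
     (\<forall>R. integrable lborel (\<lambda>x. indicator (ball 0 R) x * f x))"

lemma test_functions_ball:
  fixes \<Omega> :: "'a::euclidean_space set"
  assumes "\<phi> \<in> test_functions \<Omega>"
  obtains R where "\<phi> \<in> test_functions (\<Omega> \<inter> ball 0 R)"
    "\<And>x. x \<notin> ball 0 R \<Longrightarrow> \<phi> x = 0" "\<And>x b. x \<notin> ball 0 R \<Longrightarrow> frechet_derivative \<phi> (at x) b = 0"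
proof -
  have "bounded (closure {x. \<phi> x \<noteq> 0})"
    using assms by (intro compact_imp_bounded) (simp only: test_functions_def mem_Collect_eq)
  then obtain R where R: "closure {x. \<phi> x \<noteq> 0} \<subseteq> ball 0 R"
    using bounded_subset_ballD by blast
  have t: "\<phi> \<in> test_functions (\<Omega> \<inter> ball 0 R)"
    using assms R by (simp only: test_functions_def mem_Collect_eq) blast
  obtain K where K: "compact K" "K \<subseteq> \<Omega> \<inter> ball 0 R" "\<And>x. x \<notin> K \<Longrightarrow> \<phi> x = 0"
    "\<And>x b. x \<notin> K \<Longrightarrow> frechet_derivative \<phi> (at x) b = 0"
    by (rule test_functions_support[OF t]) (rule that; assumption)
  show ?thesis
  proof (rule that[OF t])
    show "\<phi> x = 0" if "x \<notin> ball 0 R" for x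
      using that K(2) by (intro K(3)) blast
    show "frechet_derivative \<phi> (at x) b = 0" if "x \<notin> ball 0 R" for x b
      using that K(2) by (intro K(4)) blast
  qed
qed

lemma locally_integrable_lborel_imp:
  assumes "locally_integrable_lborel f"
  shows "locally_integrable_on f \<Omega>"
  unfolding locally_integrable_on_def
proof (intro allI impI)
  fix K :: "'a set" assume K: "compact K \<and> K \<subseteq> \<Omega>"
  then obtain R where R: "K \<subseteq> ball 0 R"
    using compact_imp_bounded bounded_subset_ballD by blast
  have "integrable lborel (\<lambda>x. indicator (ball 0 R) x * f x)"
    using assms by (simp add: locally_integrable_lborel_def)
  then have "integrable (lebesgue_on K) (\<lambda>x. indicator (ball 0 R) x * f x)"
    using integrable_lborel_imp_locally_integrable[of _ \<Omega>] K
    by (auto simp: locally_integrable_on_def)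
  then show "integrable (lebesgue_on K) f"
    by (rule Bochner_Integration.integrable_cong[THEN iffD1, rotated 2])
      (use R in \<open>auto simp: indicator_def\<close>)
qed

lemma locally_integrable_lborel_mult:
  assumes "locally_integrable_lborel f" "\<psi> \<in> borel_measurable borel" "\<And>x. \<bar>\<psi> x\<bar> \<le> 1"
  shows "locally_integrable_lborel (\<lambda>x. \<psi> x * f x)"
  unfolding locally_integrable_lborel_def
proof (intro conjI allI)
  fix R
  have "integrable lborel (\<lambda>x. indicator (ball 0 R) x * f x * \<psi> x)"
    by (rule integrable_mult_bounded[OF _ _ assms(3)])
      (use assms(1,2) in \<open>simp_all add: locally_integrable_lborel_def\<close>)
  then show "integrable lborel (\<lambda>x. indicator (ball 0 R) x * (\<psi> x * f x))"
    by (simp add: mult_ac)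
qed (use assms in \<open>auto simp: locally_integrable_lborel_def\<close>)

text \<open>Each test function lives in a ball. Cutting \<open>f\<close> and \<open>g\<close> off
  outside that ball gives integrable functions, still related by a weak derivative inside it, to
  which the smooth chain rule applies. Since |G n (s)| \<le> |s| and |G' n| \<le> 1, dominated
  convergence lets n tend to infinity. The limit \<gamma> is determined pointwise only, which is
  what allows sgn and the indicator of a point.\<close>

lemma chain_rule_limit:
  fixes f g :: "'a::euclidean_space \<Rightarrow> real" and G G' :: "nat \<Rightarrow> real \<Rightarrow> real"
  assumes b: "b \<in> Basis" and \<Omega>: "open \<Omega>"
    and fg: "locally_integrable_lborel f" "locally_integrable_lborel g"
    and weak: "weak_partial_lborel \<Omega> b f g"
    and G: "\<And>n s. (G n has_real_derivative G' n s) (at s)" "\<And>n s. \<bar>G' n s\<bar> \<le> 1" "\<And>n. G n 0 = 0"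
    and G'[measurable]: "\<And>n. G' n \<in> borel_measurable borel"
    and lim: "\<And>s. (\<lambda>n. G n s) \<longlonglongrightarrow> \<Gamma> s" "\<And>s. (\<lambda>n. G' n s) \<longlonglongrightarrow> \<gamma> s"
  shows "weak_partial_lborel \<Omega> b (\<lambda>x. \<Gamma> (f x)) (\<lambda>x. \<gamma> (f x) * g x)"
  unfolding weak_partial_lborel_def
proof
  fix \<phi> assume \<phi>: "\<phi> \<in> test_functions \<Omega>"
  obtain R where R: "\<phi> \<in> test_functions (\<Omega> \<inter> ball 0 R)" "\<And>x. x \<notin> ball 0 R \<Longrightarrow> \<phi> x = 0"
    "\<And>x b. x \<notin> ball 0 R \<Longrightarrow> frechet_derivative \<phi> (at x) b = 0"
    by (rule test_functions_ball[OF \<phi>]) (rule that; assumption)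
  obtain C where C: "C \<ge> 0" "\<And>x. \<bar>\<phi> x\<bar> \<le> C" "\<And>x. \<bar>frechet_derivative \<phi> (at x) b\<bar> \<le> C"
    by (rule test_functions_bounded[OF \<phi> b]) (rule that; assumption)
  define \<phi>' where "\<phi>' x = frechet_derivative \<phi> (at x) b" for x
  have [measurable]: "\<phi> \<in> borel_measurable borel" "\<phi>' \<in> borel_measurable borel"
    unfolding \<phi>'_def[abs_def]
    by (intro borel_measurable_continuous_onI test_functions_continuous[OF \<phi>]
        test_functions_continuous_partial[OF \<phi> b])+
  define f1 where "f1 x = indicator (ball 0 R) x * f x" for x
  define g1 where "g1 x = indicator (ball 0 R) x * g x" for x
  have fg1: "integrable lborel f1" "integrable lborel g1"
    using fg by (auto simp: f1_def[abs_def] g1_def[abs_def] locally_integrable_lborel_def)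
  then have [measurable]: "f1 \<in> borel_measurable borel" "g1 \<in> borel_measurable borel" by auto
  have [measurable]: "G n \<in> borel_measurable borel" for n
    by (intro borel_measurable_continuous_onI continuous_at_imp_continuous_on ballI DERIV_isCont[OF G(1)])
  have [measurable]: "\<Gamma> \<in> borel_measurable borel"
    by (rule borel_measurable_LIMSEQ_real[OF lim(1)]) measurable
  have [measurable]: "\<gamma> \<in> borel_measurable borel"
    by (rule borel_measurable_LIMSEQ_real[OF lim(2)]) measurable
  have weak1: "weak_partial_lborel (\<Omega> \<inter> ball 0 R) b f1 g1"
    unfolding weak_partial_lborel_def
  proof
    fix \<psi> assume \<psi>: "\<psi> \<in> test_functions (\<Omega> \<inter> ball 0 R)"
    obtain K where K: "compact K" "K \<subseteq> \<Omega> \<inter> ball 0 R" "\<And>x. x \<notin> K \<Longrightarrow> \<psi> x = 0"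
      "\<And>x b. x \<notin> K \<Longrightarrow> frechet_derivative \<psi> (at x) b = 0"
      by (rule test_functions_support[OF \<psi>]) (rule that; assumption)
    have eqs: "f1 x * frechet_derivative \<psi> (at x) b = f x * frechet_derivative \<psi> (at x) b"
      "g1 x * \<psi> x = g x * \<psi> x" for x
      using subsetD[OF K(2), of x] K(3)[of x] K(4)[of x b]
      by (cases "x \<in> K"; simp add: f1_def g1_def)+
    show "(LINT x|lborel. f1 x * frechet_derivative \<psi> (at x) b) = - (LINT x|lborel. g1 x * \<psi> x)"
      unfolding eqs using weak test_functions_mono[OF _ \<psi>, of \<Omega>] by (simp add: weak_partial_lborel_def)
  qed
  have eq: "(LINT x|lborel. G n (f1 x) * \<phi>' x) = - (LINT x|lborel. G' n (f1 x) * g1 x * \<phi> x)" for n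
    unfolding \<phi>'_def
    by (rule chain_rule_L1[OF b _ fg1 weak1 G(1,2,3) G' R(1)]) (use \<Omega> in auto)
  have "(\<lambda>n. LINT x|lborel. G n (f1 x) * \<phi>' x) \<longlonglongrightarrow> (LINT x|lborel. \<Gamma> (f1 x) * \<phi>' x)"
  proof (rule integral_dominated_convergence[where w = "\<lambda>x. C * \<bar>f1 x\<bar>"])
    show "AE x in lborel. norm (G n (f1 x) * \<phi>' x) \<le> C * \<bar>f1 x\<bar>" for n
    proof (intro always_eventually allI)
      fix x
      have "\<bar>G n (f1 x)\<bar> \<le> \<bar>f1 x\<bar>"
        using field_differentiable_bound[of UNIV "G n" "G' n" 1 "f1 x" 0] G by auto
      then have "\<bar>G n (f1 x)\<bar> * \<bar>\<phi>' x\<bar> \<le> \<bar>f1 x\<bar> * C"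
        using C by (intro mult_mono) (auto simp: \<phi>'_def)
      then show "norm (G n (f1 x) * \<phi>' x) \<le> C * \<bar>f1 x\<bar>" by (simp add: abs_mult mult.commute)
    qed
  qed (use fg1 lim in \<open>auto intro!: tendsto_intros\<close>)
  moreover have "(\<lambda>n. LINT x|lborel. G' n (f1 x) * g1 x * \<phi> x) \<longlonglongrightarrow> (LINT x|lborel. \<gamma> (f1 x) * g1 x * \<phi> x)"
  proof (rule integral_dominated_convergence[where w = "\<lambda>x. C * \<bar>g1 x\<bar>"])
    show "AE x in lborel. norm (G' n (f1 x) * g1 x * \<phi> x) \<le> C * \<bar>g1 x\<bar>" for n
    proof (intro always_eventually allI)
      fix x
      have "\<bar>G' n (f1 x)\<bar> * \<bar>g1 x\<bar> * \<bar>\<phi> x\<bar> \<le> 1 * \<bar>g1 x\<bar> * C"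
        using C G(2) by (intro mult_mono) auto
      then show "norm (G' n (f1 x) * g1 x * \<phi> x) \<le> C * \<bar>g1 x\<bar>" by (simp add: abs_mult mult.commute)
    qed
  qed (use fg1 lim in \<open>auto intro!: tendsto_intros\<close>)
  ultimately have "(LINT x|lborel. \<Gamma> (f1 x) * \<phi>' x) = - (LINT x|lborel. \<gamma> (f1 x) * g1 x * \<phi> x)"
    unfolding eq by (intro LIMSEQ_unique[OF _ tendsto_minus])
  \<comment> \<open>The cut-off alters \<open>f\<close> and \<open>g\<close> only where the test
    function and its partial derivative vanish.\<close>
  moreover have eqs: "\<Gamma> (f1 x) * \<phi>' x = \<Gamma> (f x) * \<phi>' x" "\<gamma> (f1 x) * g1 x * \<phi> x = \<gamma> (f x) * g x * \<phi> x" for x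
    using R(2)[of x] R(3)[of x b] by (auto simp: f1_def g1_def \<phi>'_def indicator_def)
  ultimately show "(LINT x|lborel. \<Gamma> (f x) * frechet_derivative \<phi> (at x) b) =
      - (LINT x|lborel. \<gamma> (f x) * g x * \<phi> x)"
    unfolding eqs by (simp only: \<phi>'_def)
qed

text \<open>The regularisation is sqrt(s^2 + e^2) - e, shifted so that it vanishes at 0. Its
  derivative s / sqrt(s^2 + e^2) tends to sgn s everywhere, with the value 0 at s = 0 for every
  e.\<close>

lemma weak_partial_abs:
  fixes f g :: "'a::euclidean_space \<Rightarrow> real"
  assumes b: "b \<in> Basis" and \<Omega>: "open \<Omega>"
    and fg: "locally_integrable_lborel f" "locally_integrable_lborel g"
    and weak: "weak_partial_lborel \<Omega> b f g"
  shows "weak_partial_lborel \<Omega> b (\<lambda>x. \<bar>f x\<bar>) (\<lambda>x. sgn (f x) * g x)"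
proof -
  define e where "e n = inverse (real (Suc n))" for n
  have e: "e n > 0" for n by (simp add: e_def)
  have e0: "e \<longlonglongrightarrow> 0" unfolding e_def[abs_def] by (rule LIMSEQ_inverse_real_of_nat)
  have pos: "s\<^sup>2 + (e n)\<^sup>2 > 0" for s n using e[of n] by (simp add: add_nonneg_pos)
  have root: "(\<lambda>n. sqrt (s\<^sup>2 + (e n)\<^sup>2)) \<longlonglongrightarrow> \<bar>s\<bar>" for s
  proof -
    have "(\<lambda>n. sqrt (s\<^sup>2 + (e n)\<^sup>2)) \<longlonglongrightarrow> sqrt (s\<^sup>2 + 0\<^sup>2)"
      by (intro tendsto_intros e0)
    then show ?thesis by simp
  qed
  show ?thesis
  proof (rule chain_rule_limit[OF b \<Omega> fg weak])
    fix n s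
    show "((\<lambda>s. sqrt (s\<^sup>2 + (e n)\<^sup>2) - e n) has_real_derivative s / sqrt (s\<^sup>2 + (e n)\<^sup>2)) (at s)"
      using pos[of s n] by (auto intro!: derivative_eq_intros simp: divide_simps)
    have "\<bar>s\<bar> \<le> sqrt (s\<^sup>2 + (e n)\<^sup>2)" by (rule real_le_rsqrt) simp
    then show "\<bar>s / sqrt (s\<^sup>2 + (e n)\<^sup>2)\<bar> \<le> 1"
      using pos[of s n] by (simp add: abs_divide divide_le_eq_1)
    show "sqrt (0\<^sup>2 + (e n)\<^sup>2) - e n = 0" using e[of n] by simp
    show "(\<lambda>s. s / sqrt (s\<^sup>2 + (e n)\<^sup>2)) \<in> borel_measurable borel" by measurable
  next
    fix s
    show "(\<lambda>n. sqrt (s\<^sup>2 + (e n)\<^sup>2) - e n) \<longlonglongrightarrow> \<bar>s\<bar>"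
      using tendsto_diff[OF root e0, of s] by simp
    show "(\<lambda>n. s / sqrt (s\<^sup>2 + (e n)\<^sup>2)) \<longlonglongrightarrow> sgn s"
    proof (cases "s = 0")
      case False
      then have "(\<lambda>n. s / sqrt (s\<^sup>2 + (e n)\<^sup>2)) \<longlonglongrightarrow> s / \<bar>s\<bar>"
        by (intro tendsto_intros root) auto
      then show ?thesis using False by (simp add: sgn_if abs_if split: if_splits)
    qed simp
  qed
qed

text \<open>With \<open>G\<^sub>n(s) = arctan (n s) / n\<close> in the chain rule, \<open>G\<^sub>n\<close> tends to \<open>0\<close> and its derivative to
  the indicator of \<open>0\<close>.\<close>

lemma weak_partial_eq_0_on_zero_set:
  fixes f g :: "'a::euclidean_space \<Rightarrow> real"
  assumes b: "b \<in> Basis" and \<Omega>: "open \<Omega>"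
    and fg: "locally_integrable_lborel f" "locally_integrable_lborel g"
    and weak: "weak_partial_lborel \<Omega> b f g"
  shows "AE x in lebesgue_on \<Omega>. f x = 0 \<longrightarrow> g x = 0"
proof -
  define e where "e n = inverse (real (Suc n))" for n
  have e: "e n > 0" for n by (simp add: e_def)
  have e0: "e \<longlonglongrightarrow> 0" unfolding e_def[abs_def] by (rule LIMSEQ_inverse_real_of_nat)
  have [measurable]: "f \<in> borel_measurable borel" "g \<in> borel_measurable borel"
    using fg by (auto simp: locally_integrable_lborel_def)
  define z where "z x = of_bool (f x = 0) * g x" for x
  have weak0: "weak_partial_lborel \<Omega> b (\<lambda>x. 0) z"
    unfolding z_def
  proof (rule chain_rule_limit[OF b \<Omega> fg weak, where \<gamma> = "\<lambda>s. of_bool (s = 0)" and \<Gamma> = "\<lambda>_. 0"])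
    fix n s
    show "((\<lambda>s. e n * arctan (s / e n)) has_real_derivative inverse (1 + (s / e n)\<^sup>2)) (at s)"
      using e[of n] by (auto intro!: derivative_eq_intros simp: divide_simps)
    show "\<bar>inverse (1 + (s / e n)\<^sup>2)\<bar> \<le> 1"
      by (simp add: inverse_le_1_iff)
    show "e n * arctan (0 / e n) = 0" by simp
    show "(\<lambda>s. inverse (1 + (s / e n)\<^sup>2)) \<in> borel_measurable borel" by measurable
  next
    fix s :: real
    show "(\<lambda>n. e n * arctan (s / e n)) \<longlonglongrightarrow> 0"
    proof (rule Lim_null_comparison)
      show "\<forall>\<^sub>F n in sequentially. norm (e n * arctan (s / e n)) \<le> e n * 2"
      proof (intro always_eventually allI)
        fix n
        have "\<bar>arctan (s / e n)\<bar> \<le> 2"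
          using arctan_lbound[of "s / e n"] arctan_ubound[of "s / e n"] pi_less_4 by (simp add: abs_if)
        then show "norm (e n * arctan (s / e n)) \<le> e n * 2"
          using e[of n] by (simp add: abs_mult)
      qed
      show "(\<lambda>n. e n * 2) \<longlonglongrightarrow> 0" using tendsto_mult_left_zero[OF e0] by simp
    qed
    show "(\<lambda>n. inverse (1 + (s / e n)\<^sup>2)) \<longlonglongrightarrow> of_bool (s = 0)"
    proof (cases "s = 0")
      case False
      have "(\<lambda>n. (e n)\<^sup>2 / ((e n)\<^sup>2 + s\<^sup>2)) \<longlonglongrightarrow> 0\<^sup>2 / (0\<^sup>2 + s\<^sup>2)"
        using False by (intro tendsto_intros e0) auto
      moreover have "(e n)\<^sup>2 / ((e n)\<^sup>2 + s\<^sup>2) = inverse (1 + (s / e n)\<^sup>2)" for n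
        using e[of n] by (simp add: power_divide inverse_eq_divide add_divide_distrib[symmetric] divide_simps)
      ultimately show ?thesis using False by simp
    qed simp
  qed
  have z: "locally_integrable_lborel z"
    unfolding z_def[abs_def] by (intro locally_integrable_lborel_mult fg) auto
  have [measurable]: "z \<in> borel_measurable borel" using z by (simp add: locally_integrable_lborel_def)
  \<comment> \<open>The zero function now has \<open>z\<close> as a weak derivative, so
    \<open>z\<close> is orthogonal to all test functions.\<close>
  have "AE x in lebesgue_on \<Omega>. z x = 0"
  proof (rule fundamental_lemma[OF \<Omega> locally_integrable_lborel_imp[OF z]])
    fix \<phi> assume \<phi>: "\<phi> \<in> test_functions \<Omega>"
    have [measurable]: "\<phi> \<in> borel_measurable borel"
      by (rule borel_measurable_continuous_onI[OF test_functions_continuous[OF \<phi>]])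
    have "(LINT x|lborel. z x * \<phi> x) = 0"
      using weak0 \<phi> by (auto simp: weak_partial_lborel_def)
    moreover have "\<phi> x = 0" if "x \<notin> \<Omega>" for x
      by (rule test_functions_support[OF \<phi>]) (use that in blast)
    ultimately show "(LINT x|lebesgue_on \<Omega>. z x * \<phi> x) = 0"
      using \<Omega> by (subst integral_lebesgue_on_eq_lborel) (auto simp: borel_open)
  qed
  then show ?thesis by eventually_elim (auto simp: z_def)
qed

subsection \<open>Square integrable functions\<close>

text \<open>Completeness of Lebesgue measure: changing values on a null set preserves measurability.
  This makes it possible to change representatives freely.\<close>

lemma borel_measurable_lebesgue_on_AE:
  fixes f g :: "'a::euclidean_space \<Rightarrow> real"
  assumes "S \<in> sets lebesgue" "f \<in> borel_measurable (lebesgue_on S)" "AE x in lebesgue_on S. f x = g x"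
  shows "g \<in> borel_measurable (lebesgue_on S)"
proof -
  have "(\<lambda>x. if x \<in> S then f x else 0) \<in> borel_measurable lebesgue"
    using assms by (simp add: borel_measurable_if)
  moreover have "AE x in lebesgue. x \<in> S \<longrightarrow> f x = g x"
    using assms by (simp add: AE_restrict_space_iff)
  then have "AE x in lebesgue. (if x \<in> S then f x else 0) = (if x \<in> S then g x else 0)"
    by eventually_elim simp
  ultimately have "(\<lambda>x. if x \<in> S then g x else 0) \<in> borel_measurable lebesgue"
    by (rule borel_measurable_AE)
  then show ?thesis by (rule borel_measurable_if_D)
qed

lemma integral_lebesgue_on_AE:
  fixes f g :: "'a::euclidean_space \<Rightarrow> real"
  assumes "S \<in> sets lebesgue" "f \<in> borel_measurable (lebesgue_on S)" "AE x in lebesgue_on S. f x = g x"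
  shows "(LINT x|lebesgue_on S. f x) = (LINT x|lebesgue_on S. g x)"
    and "integrable (lebesgue_on S) f \<longleftrightarrow> integrable (lebesgue_on S) g"
  using assms borel_measurable_lebesgue_on_AE[OF assms]
  by (simp_all only: integral_cong_AE integrable_cong_AE)

lemma integrable_lebesgue_on_subset:
  fixes f :: "'a::euclidean_space \<Rightarrow> real"
  assumes "integrable (lebesgue_on S) f" "S \<in> sets lebesgue" "K \<in> sets lebesgue" "K \<subseteq> S"
  shows "integrable (lebesgue_on K) f"
proof -
  have "set_integrable lebesgue S f"
    using assms by (simp add: set_integrable_def integrable_restrict_space)
  then have "set_integrable lebesgue K f"
    by (rule set_integrable_subset[OF _ assms(3,4)])
  then show ?thesis
    using assms by (simp add: set_integrable_def integrable_restrict_space)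
qed

lemma abs_mult_le_squares: "\<bar>x * y\<bar> \<le> x\<^sup>2 + (y::real)\<^sup>2"
proof -
  have "2 * (\<bar>x\<bar> * \<bar>y\<bar>) \<le> x\<^sup>2 + y\<^sup>2"
    using zero_le_power2[of "\<bar>x\<bar> - \<bar>y\<bar>"] by (simp add: power2_diff)
  moreover have "0 \<le> \<bar>x\<bar> * \<bar>y\<bar>" by simp
  ultimately show ?thesis unfolding abs_mult by linarith
qed

lemma abs_le_1_plus_square: "\<bar>x\<bar> \<le> 1 + (x::real)\<^sup>2"
  using abs_mult_le_squares[of 1 x] by simp

lemma L2_integrable_mult:
  assumes "f \<in> L2 \<Omega>" "g \<in> L2 \<Omega>"
  shows "integrable (lebesgue_on \<Omega>) (\<lambda>x. f x * g x)"
proof (rule Bochner_Integration.integrable_bound)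
  show "integrable (lebesgue_on \<Omega>) (\<lambda>x. (f x)\<^sup>2 + (g x)\<^sup>2)"
    using assms by (auto simp: L2_def)
  show "AE x in lebesgue_on \<Omega>. norm (f x * g x) \<le> norm ((f x)\<^sup>2 + (g x)\<^sup>2)"
    using abs_mult_le_squares[of "f x" "g x" for x] by simp
qed (use assms in \<open>auto simp: L2_def\<close>)

lemma L2_lincomb:
  assumes "f \<in> L2 \<Omega>" "g \<in> L2 \<Omega>"
  shows "(\<lambda>x. c * f x + d * g x) \<in> L2 \<Omega>"
proof -
  have "integrable (lebesgue_on \<Omega>) (\<lambda>x. c\<^sup>2 * (f x)\<^sup>2 + 2 * c * d * (f x * g x) + d\<^sup>2 * (g x)\<^sup>2)"
    using assms L2_integrable_mult[OF assms] by (auto simp: L2_def)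
  also have "(\<lambda>x. c\<^sup>2 * (f x)\<^sup>2 + 2 * c * d * (f x * g x) + d\<^sup>2 * (g x)\<^sup>2) = (\<lambda>x. (c * f x + d * g x)\<^sup>2)"
    by (simp add: power2_eq_square algebra_simps)
  finally show ?thesis using assms by (auto simp: L2_def)
qed

lemma L2_bound:
  assumes "f \<in> L2 \<Omega>" "g \<in> borel_measurable (lebesgue_on \<Omega>)" "\<And>x. \<bar>g x\<bar> \<le> \<bar>f x\<bar>"
  shows "g \<in> L2 \<Omega>"
proof -
  have "integrable (lebesgue_on \<Omega>) (\<lambda>x. (g x)\<^sup>2)"
    by (rule Bochner_Integration.integrable_bound[of _ "\<lambda>x. (f x)\<^sup>2"])
      (use assms in \<open>auto simp: L2_def abs_le_square_iff\<close>)
  with assms show ?thesis by (simp add: L2_def)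
qed

lemma L2_norm_nonneg: "0 \<le> L2_norm \<Omega> f"
  by (simp add: L2_norm_def L2_inner_def)

lemma L2_norm_sq: "(L2_norm \<Omega> f)\<^sup>2 = (LINT x|lebesgue_on \<Omega>. (f x)\<^sup>2)"
  by (simp add: L2_norm_def L2_inner_def power2_eq_square)

lemma L2_norm_sq_mono:
  assumes "f \<in> L2 \<Omega>" "g \<in> L2 \<Omega>" "\<And>x. \<bar>f x\<bar> \<le> \<bar>g x\<bar>"
  shows "(L2_norm \<Omega> f)\<^sup>2 \<le> (L2_norm \<Omega> g)\<^sup>2"
  unfolding L2_norm_sq using assms by (intro integral_mono) (auto simp: L2_def abs_le_square_iff)

text \<open>Nonnegativity of the quadratic form in (s, t) given by the integral of (s f - t g)^2.
  The degenerate case is treated separately because \<open>L2_norm\<close> is only a seminorm on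
  functions.\<close>

lemma L2_Cauchy_Schwarz:
  assumes "f \<in> L2 \<Omega>" "g \<in> L2 \<Omega>"
  shows "\<bar>L2_inner \<Omega> f g\<bar> \<le> L2_norm \<Omega> f * L2_norm \<Omega> g"
proof -
  define a where "a = (L2_norm \<Omega> f)\<^sup>2"
  define c where "c = (L2_norm \<Omega> g)\<^sup>2"
  define p where "p = L2_inner \<Omega> f g"
  have quad: "0 \<le> s\<^sup>2 * a - 2 * s * t * p + t\<^sup>2 * c" for s t
  proof -
    have "0 \<le> (LINT x|lebesgue_on \<Omega>. (s * f x - t * g x)\<^sup>2)" by simp
    also have "(\<lambda>x. (s * f x - t * g x)\<^sup>2) = (\<lambda>x. s\<^sup>2 * (f x)\<^sup>2 - 2 * s * t * (f x * g x) + t\<^sup>2 * (g x)\<^sup>2)"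
      by (simp add: power2_eq_square algebra_simps)
    also have "(LINT x|lebesgue_on \<Omega>. s\<^sup>2 * (f x)\<^sup>2 - 2 * s * t * (f x * g x) + t\<^sup>2 * (g x)\<^sup>2) =
        s\<^sup>2 * a - 2 * s * t * p + t\<^sup>2 * c"
      using assms L2_integrable_mult[OF assms] by (simp add: a_def c_def p_def L2_norm_sq L2_inner_def L2_def)
    finally show ?thesis .
  qed
  have ac: "0 \<le> a" "0 \<le> c" by (simp_all add: a_def c_def)
  have "p\<^sup>2 \<le> a * c"
  proof (cases "c = 0")
    case False
    \<comment> \<open>The form at s = c, t = p.\<close>
    have "0 \<le> c * (a * c - p\<^sup>2)"
      using quad[of c p] by (simp add: power2_eq_square algebra_simps)
    then show ?thesis using False ac by (simp add: zero_le_mult_iff)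
  next
    case True
    \<comment> \<open>With c = 0 the form is linear in t; at s = 1, t = (a + 1) / (2 p) it would
      equal -1.\<close>
    have "p = 0"
    proof (rule ccontr)
      assume "p \<noteq> 0"
      then show False
        using quad[of 1 "(a + 1) / (2 * p)"] True by (simp add: field_simps)
    qed
    then show ?thesis using ac by simp
  qed
  then have "sqrt (p\<^sup>2) \<le> sqrt (a * c)" by (rule real_sqrt_le_mono)
  then show ?thesis
    by (simp add: a_def c_def p_def real_sqrt_mult L2_norm_nonneg)
qed

lemma L2_norm_AE_cong:
  assumes "\<Omega> \<in> sets lebesgue" "f \<in> L2 \<Omega>" "AE x in lebesgue_on \<Omega>. f x = g x"
  shows "g \<in> L2 \<Omega>" "L2_norm \<Omega> f = L2_norm \<Omega> g"
proof -
  have m: "(\<lambda>x. (f x)\<^sup>2) \<in> borel_measurable (lebesgue_on \<Omega>)" using assms by (auto simp: L2_def)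
  have e: "AE x in lebesgue_on \<Omega>. (f x)\<^sup>2 = (g x)\<^sup>2" using assms(3) by eventually_elim simp
  show "g \<in> L2 \<Omega>"
    using assms borel_measurable_lebesgue_on_AE[OF assms(1) _ assms(3)] integral_lebesgue_on_AE(2)[OF assms(1) m e]
    by (auto simp: L2_def)
  have "(L2_norm \<Omega> f)\<^sup>2 = (L2_norm \<Omega> g)\<^sup>2"
    using integral_lebesgue_on_AE(1)[OF assms(1) m e] by (simp add: L2_norm_sq)
  then show "L2_norm \<Omega> f = L2_norm \<Omega> g"
    by (simp add: L2_norm_nonneg)
qed

lemma L2_imp_locally_integrable:
  assumes "\<Omega> \<in> sets lebesgue" "f \<in> L2 \<Omega>"
  shows "locally_integrable_on f \<Omega>"
  unfolding locally_integrable_on_def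
proof (intro allI impI)
  fix K assume K: "compact K \<and> K \<subseteq> \<Omega>"
  then have Km: "K \<in> lmeasurable" by (simp add: lmeasurable_compact)
  show "integrable (lebesgue_on K) f"
  proof (rule Bochner_Integration.integrable_bound)
    have "integrable (lebesgue_on K) (\<lambda>x. (f x)\<^sup>2)"
      by (rule integrable_lebesgue_on_subset[OF _ assms(1)])
        (use assms(2) K Km in \<open>simp_all add: L2_def fmeasurableD\<close>)
    moreover have "integrable (lebesgue_on K) (\<lambda>x. 1 :: real)"
      using Km by (simp add: integrable_restrict_space fmeasurableD lmeasurable_iff_integrable)
    ultimately show "integrable (lebesgue_on K) (\<lambda>x. 1 + (f x)\<^sup>2)" by auto
    show "f \<in> borel_measurable (lebesgue_on K)"
      using assms K by (auto simp: L2_def intro: measurable_restrict_mono)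
  qed (use abs_le_1_plus_square in auto)
qed

subsection \<open>Weak partial derivatives\<close>

lemma integrable_times_supported:
  fixes g p :: "'a::euclidean_space \<Rightarrow> real"
  assumes "\<Omega> \<in> sets lebesgue" "locally_integrable_on g \<Omega>" "compact K" "K \<subseteq> \<Omega>"
    and p: "continuous_on UNIV p" "\<And>x. x \<notin> K \<Longrightarrow> p x = 0" "\<And>x. \<bar>p x\<bar> \<le> C"
  shows "integrable (lebesgue_on \<Omega>) (\<lambda>x. g x * p x)"
proof -
  have K: "K \<in> sets lebesgue" using assms(3) by (simp add: fmeasurableD lmeasurable_compact)
  have "integrable (lebesgue_on K) (\<lambda>x. g x * p x)"
  proof (rule integrable_mult_bounded[OF _ _ p(3)])
    show "integrable (lebesgue_on K) g"
      using assms by (simp add: locally_integrable_on_def)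
    show "p \<in> borel_measurable (lebesgue_on K)"
      using K continuous_on_subset[OF p(1)] by (intro continuous_imp_measurable_on_sets_lebesgue) auto
  qed
  then have "integrable lebesgue (\<lambda>x. indicator K x *\<^sub>R (g x * p x))"
    using K by (simp add: integrable_restrict_space)
  also have "(\<lambda>x. indicator K x *\<^sub>R (g x * p x)) = (\<lambda>x. indicator \<Omega> x *\<^sub>R (g x * p x))"
    using p(2) assms(4) by (auto simp: indicator_def fun_eq_iff)
  finally show ?thesis using assms(1) by (simp add: integrable_restrict_space)
qed

lemma integrable_times_test:
  assumes "\<Omega> \<in> sets lebesgue" "locally_integrable_on g \<Omega>" "\<phi> \<in> test_functions \<Omega>" "b \<in> Basis"
  shows "integrable (lebesgue_on \<Omega>) (\<lambda>x. g x * \<phi> x)"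
    and "integrable (lebesgue_on \<Omega>) (\<lambda>x. g x * frechet_derivative \<phi> (at x) b)"
proof -
  obtain K where K: "compact K" "K \<subseteq> \<Omega>" "\<And>x. x \<notin> K \<Longrightarrow> \<phi> x = 0"
    "\<And>x b. x \<notin> K \<Longrightarrow> frechet_derivative \<phi> (at x) b = 0"
    by (rule test_functions_support[OF assms(3)]) (rule that; assumption)
  obtain C where C: "C \<ge> 0" "\<And>x. \<bar>\<phi> x\<bar> \<le> C" "\<And>x. \<bar>frechet_derivative \<phi> (at x) b\<bar> \<le> C"
    by (rule test_functions_bounded[OF assms(3,4)]) (rule that; assumption)
  show "integrable (lebesgue_on \<Omega>) (\<lambda>x. g x * \<phi> x)"
    by (rule integrable_times_supported[OF assms(1,2) K(1,2) test_functions_continuous[OF assms(3)] K(3) C(2)])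
  show "integrable (lebesgue_on \<Omega>) (\<lambda>x. g x * frechet_derivative \<phi> (at x) b)"
    by (rule integrable_times_supported[OF assms(1,2) K(1,2)
          test_functions_continuous_partial[OF assms(3,4)] K(4) C(3)])
qed

lemma has_weak_partial_lincomb:
  assumes "\<Omega> \<in> sets lebesgue" "b \<in> Basis" "has_weak_partial \<Omega> b f g" "has_weak_partial \<Omega> b f' g'"
  shows "has_weak_partial \<Omega> b (\<lambda>x. c * f x + d * f' x) (\<lambda>x. c * g x + d * g' x)"
proof -
  have li: "locally_integrable_on f \<Omega>" "locally_integrable_on g \<Omega>"
    "locally_integrable_on f' \<Omega>" "locally_integrable_on g' \<Omega>"
    using assms by (auto simp: has_weak_partial_def)
  have comb: "locally_integrable_on (\<lambda>x. c * p x + d * q x) \<Omega>"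
    if "locally_integrable_on p \<Omega>" "locally_integrable_on q \<Omega>" for p q
    using that by (auto simp: locally_integrable_on_def)
  have "(LINT x|lebesgue_on \<Omega>. (c * f x + d * f' x) * frechet_derivative \<phi> (at x) b) =
      - (LINT x|lebesgue_on \<Omega>. (c * g x + d * g' x) * \<phi> x)" if "\<phi> \<in> test_functions \<Omega>" for \<phi>
  proof -
    note I = integrable_times_test[OF assms(1) _ that assms(2)]
    have "(LINT x|lebesgue_on \<Omega>. f x * frechet_derivative \<phi> (at x) b) = - (LINT x|lebesgue_on \<Omega>. g x * \<phi> x)"
      "(LINT x|lebesgue_on \<Omega>. f' x * frechet_derivative \<phi> (at x) b) = - (LINT x|lebesgue_on \<Omega>. g' x * \<phi> x)"
      using assms that by (auto simp: has_weak_partial_def)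
    then show ?thesis
      using I(2)[OF li(1)] I(2)[OF li(3)] I(1)[OF li(2)] I(1)[OF li(4)]
      by (simp add: distrib_right mult.assoc)
  qed
  with comb li show ?thesis by (simp add: has_weak_partial_def)
qed

lemma has_weak_partial_unique:
  assumes "open \<Omega>" "b \<in> Basis" "has_weak_partial \<Omega> b f g" "has_weak_partial \<Omega> b f g'"
  shows "AE x in lebesgue_on \<Omega>. g x = g' x"
proof -
  have \<Omega>: "\<Omega> \<in> sets lebesgue" using assms(1) by (simp add: borel_open sets_completionI_sets)
  have weak: "has_weak_partial \<Omega> b (\<lambda>x. 1 * f x + (-1) * f x) (\<lambda>x. 1 * g x + (-1) * g' x)"
    by (rule has_weak_partial_lincomb[OF \<Omega> assms(2,3,4)])
  have "AE x in lebesgue_on \<Omega>. 1 * g x + (-1) * g' x = 0"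
  proof (rule fundamental_lemma[OF assms(1)])
    show "locally_integrable_on (\<lambda>x. 1 * g x + (-1) * g' x) \<Omega>"
      using weak by (simp add: has_weak_partial_def)
    fix \<phi> assume "\<phi> \<in> test_functions \<Omega>"
    with weak have "(LINT x|lebesgue_on \<Omega>. (1 * f x + (-1) * f x) * frechet_derivative \<phi> (at x) b) =
        - (LINT x|lebesgue_on \<Omega>. (1 * g x + (-1) * g' x) * \<phi> x)"
      unfolding has_weak_partial_def by blast
    then show "(LINT x|lebesgue_on \<Omega>. (1 * g x + (-1) * g' x) * \<phi> x) = 0" by simp
  qed
  then show ?thesis by eventually_elim simp
qed

lemma has_weak_partial_AE_cong:
  assumes \<Omega>: "\<Omega> \<in> sets lebesgue" and b: "b \<in> Basis" and weak: "has_weak_partial \<Omega> b f g"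
    and f: "f \<in> L2 \<Omega>" "AE x in lebesgue_on \<Omega>. f x = f' x"
    and g: "g \<in> L2 \<Omega>" "AE x in lebesgue_on \<Omega>. g x = g' x"
  shows "has_weak_partial \<Omega> b f' g'"
  unfolding has_weak_partial_def
proof (intro conjI ballI)
  show "locally_integrable_on f' \<Omega>" "locally_integrable_on g' \<Omega>"
    using L2_imp_locally_integrable[OF \<Omega>] L2_norm_AE_cong(1)[OF \<Omega>] f g by blast+
  fix \<phi> assume \<phi>: "\<phi> \<in> test_functions \<Omega>"
  note I = integrable_times_test[OF \<Omega> L2_imp_locally_integrable[OF \<Omega>] \<phi> b]
  have "(LINT x|lebesgue_on \<Omega>. f x * frechet_derivative \<phi> (at x) b) =
      (LINT x|lebesgue_on \<Omega>. f' x * frechet_derivative \<phi> (at x) b)"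
    by (rule integral_lebesgue_on_AE[OF \<Omega> borel_measurable_integrable[OF I(2)[OF f(1)]]])
      (use f(2) in \<open>eventually_elim, simp\<close>)
  moreover have "(LINT x|lebesgue_on \<Omega>. g x * \<phi> x) = (LINT x|lebesgue_on \<Omega>. g' x * \<phi> x)"
    by (rule integral_lebesgue_on_AE[OF \<Omega> borel_measurable_integrable[OF I(1)[OF g(1)]]])
      (use g(2) in \<open>eventually_elim, simp\<close>)
  ultimately show "(LINT x|lebesgue_on \<Omega>. f' x * frechet_derivative \<phi> (at x) b) =
      - (LINT x|lebesgue_on \<Omega>. g' x * \<phi> x)"
    using weak \<phi> by (simp add: has_weak_partial_def)
qed

text \<open>A Lebesgue measurable function agrees almost everywhere with a Borel function; extended
  by zero, its integrals over \<Omega> become integrals over the whole space.\<close>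

lemma lebesgue_on_borel_version:
  fixes f :: "'a::euclidean_space \<Rightarrow> real"
  assumes "\<Omega> \<in> sets borel" "f \<in> borel_measurable (lebesgue_on \<Omega>)"
  obtains f' where "f' \<in> borel_measurable borel" "\<And>x. x \<notin> \<Omega> \<Longrightarrow> f' x = 0"
    "AE x in lebesgue_on \<Omega>. f x = f' x"
proof -
  have \<Omega>: "\<Omega> \<in> sets lebesgue" using assms(1) by (simp add: sets_completionI_sets)
  have "(\<lambda>x. if x \<in> \<Omega> then f x else 0) \<in> borel_measurable lebesgue"
    by (rule borel_measurable_if_I[OF assms(2) \<Omega>])
  from completion_ex_borel_measurable_real[OF this]
  obtain g where g: "g \<in> borel_measurable lborel" "AE x in lborel. (if x \<in> \<Omega> then f x else 0) = g x" by blast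
  have "AE x in lebesgue. (if x \<in> \<Omega> then f x else 0) = g x"
    using g(2) by (rule AE_completion)
  then have "AE x in lebesgue. x \<in> \<Omega> \<longrightarrow> f x = indicator \<Omega> x * g x"
    by eventually_elim (auto split: if_splits)
  then have "AE x in lebesgue_on \<Omega>. f x = indicator \<Omega> x * g x"
    using \<Omega> by (simp add: AE_restrict_space_iff)
  with that[of "\<lambda>x. indicator \<Omega> x * g x"] g(1) assms(1) show ?thesis by simp
qed

lemma L2_borel_version:
  assumes "open \<Omega>" "f \<in> L2 \<Omega>"
  obtains f' where "f' \<in> borel_measurable borel" "\<And>x. x \<notin> \<Omega> \<Longrightarrow> f' x = 0"
    "AE x in lebesgue_on \<Omega>. f x = f' x" "locally_integrable_lborel f'" "f' \<in> L2 \<Omega>"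
proof -
  have \<Omega>b: "\<Omega> \<in> sets borel" and \<Omega>: "\<Omega> \<in> sets lebesgue"
    using assms(1) by (simp_all add: borel_open sets_completionI_sets)
  obtain f' where f': "f' \<in> borel_measurable borel" "\<And>x. x \<notin> \<Omega> \<Longrightarrow> f' x = 0"
    "AE x in lebesgue_on \<Omega>. f x = f' x"
    using assms(2) by (auto simp: L2_def intro: lebesgue_on_borel_version[OF \<Omega>b])
  have L2: "f' \<in> L2 \<Omega>" by (rule L2_norm_AE_cong[OF \<Omega> assms(2) f'(3)])
  have sq: "integrable lborel (\<lambda>x. (f' x)\<^sup>2)"
    using L2 f' by (subst integral_lebesgue_on_eq_lborel(2)[OF \<Omega>b, symmetric]) (auto simp: L2_def)
  have "integrable lborel (\<lambda>x. indicator (ball 0 R) x * f' x)" for R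
  proof (rule Bochner_Integration.integrable_bound)
    have "integrable lborel (indicator (ball (0::'a) R) :: 'a \<Rightarrow> real)"
      using emeasure_bounded_finite[of "ball (0::'a) R"] by (intro integrable_real_indicator) auto
    with sq show "integrable lborel (\<lambda>x. indicator (ball 0 R) x + (f' x)\<^sup>2)" by auto
    have "\<bar>indicator (ball 0 R) x * f' x\<bar> \<le> indicator (ball 0 R) x + (f' x)\<^sup>2" for x
      using abs_le_1_plus_square[of "f' x"] by (simp add: indicator_def)
    then show "AE x in lborel. norm (indicator (ball 0 R) x * f' x) \<le> norm (indicator (ball 0 R) x + (f' x)\<^sup>2)"
      by (simp add: abs_of_nonneg)
    show "(\<lambda>x. indicator (ball 0 R) x * f' x) \<in> borel_measurable lborel"
      using f'(1) by (intro borel_measurable_times borel_measurable_indicator) simp_all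
  qed
  then have "locally_integrable_lborel f'"
    using f'(1) by (simp add: locally_integrable_lborel_def)
  with f' L2 that show ?thesis by blast
qed

lemma has_weak_partial_iff_lborel:
  assumes "open \<Omega>" "b \<in> Basis"
    and f: "f \<in> borel_measurable borel" "\<And>x. x \<notin> \<Omega> \<Longrightarrow> f x = 0" "f \<in> L2 \<Omega>"
    and g: "g \<in> borel_measurable borel" "\<And>x. x \<notin> \<Omega> \<Longrightarrow> g x = 0" "g \<in> L2 \<Omega>"
  shows "has_weak_partial \<Omega> b f g \<longleftrightarrow> weak_partial_lborel \<Omega> b f g"
proof -
  have \<Omega>b: "\<Omega> \<in> sets borel" and \<Omega>: "\<Omega> \<in> sets lebesgue"
    using assms(1) by (simp_all add: borel_open sets_completionI_sets)
  have "(LINT x|lebesgue_on \<Omega>. f x * frechet_derivative \<phi> (at x) b) = (LINT x|lborel. f x * frechet_derivative \<phi> (at x) b)"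
    "(LINT x|lebesgue_on \<Omega>. g x * \<phi> x) = (LINT x|lborel. g x * \<phi> x)" if "\<phi> \<in> test_functions \<Omega>" for \<phi>
    using f g borel_measurable_continuous_onI[OF test_functions_continuous[OF that]]
      borel_measurable_continuous_onI[OF test_functions_continuous_partial[OF that assms(2)]]
    by (auto intro!: integral_lebesgue_on_eq_lborel(1)[OF \<Omega>b])
  with L2_imp_locally_integrable[OF \<Omega>] f(3) g(3) show ?thesis
    by (simp add: has_weak_partial_def weak_partial_lborel_def)
qed

text \<open>With v+ = (v + |v|) / 2 the weak derivative is (g + sgn(v) g) / 2: it equals
  \<open>g\<close> where v > 0 and 0 where v < 0. Where v = 0 it is g / 2, which vanishes almost
  everywhere by the second assertion. That assertion is kept because the continuity of the positive
  part rests on it as well.\<close>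

proposition has_weak_partial_pos_part:
  assumes \<Omega>: "open \<Omega>" and b: "b \<in> Basis"
    and v: "v \<in> L2 \<Omega>" and g: "g \<in> L2 \<Omega>" and weak: "has_weak_partial \<Omega> b v g"
  shows "has_weak_partial \<Omega> b (pos_part v) (\<lambda>x. of_bool (v x > 0) * g x)"
    and "AE x in lebesgue_on \<Omega>. v x = 0 \<longrightarrow> g x = 0"
proof -
  have \<Omega>l: "\<Omega> \<in> sets lebesgue" using \<Omega> by (simp add: borel_open sets_completionI_sets)
  obtain v' where v': "v' \<in> borel_measurable borel" "\<And>x. x \<notin> \<Omega> \<Longrightarrow> v' x = 0"
    "AE x in lebesgue_on \<Omega>. v x = v' x" "locally_integrable_lborel v'" "v' \<in> L2 \<Omega>"
    by (rule L2_borel_version[OF \<Omega> v]) (rule that; assumption)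
  obtain g' where g': "g' \<in> borel_measurable borel" "\<And>x. x \<notin> \<Omega> \<Longrightarrow> g' x = 0"
    "AE x in lebesgue_on \<Omega>. g x = g' x" "locally_integrable_lborel g'" "g' \<in> L2 \<Omega>"
    by (rule L2_borel_version[OF \<Omega> g]) (rule that; assumption)
  note [measurable] = v'(1) g'(1)
  have w': "has_weak_partial \<Omega> b v' g'"
    by (rule has_weak_partial_AE_cong[OF \<Omega>l b weak v v'(3) g g'(3)])
  then have w: "weak_partial_lborel \<Omega> b v' g'"
    by (simp add: has_weak_partial_iff_lborel[OF \<Omega> b v'(1,2,5) g'(1,2,5)])
  have z: "AE x in lebesgue_on \<Omega>. v' x = 0 \<longrightarrow> g' x = 0"
    by (rule weak_partial_eq_0_on_zero_set[OF b \<Omega> v'(4) g'(4) w])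
  show "AE x in lebesgue_on \<Omega>. v x = 0 \<longrightarrow> g x = 0"
    using z v'(3) g'(3) by eventually_elim simp
  have abs: "(\<lambda>x. \<bar>v' x\<bar>) \<in> L2 \<Omega>"
    by (rule L2_bound[OF v'(5)]) (use v'(5) in \<open>auto simp: L2_def\<close>)
  have sgn: "(\<lambda>x. sgn (v' x) * g' x) \<in> L2 \<Omega>"
    by (rule L2_bound[OF g'(5)]) (use v'(5) g'(5) in \<open>auto simp: L2_def abs_mult sgn_if\<close>)
  have "has_weak_partial \<Omega> b (\<lambda>x. \<bar>v' x\<bar>) (\<lambda>x. sgn (v' x) * g' x)"
    by (rule has_weak_partial_iff_lborel[OF \<Omega> b _ _ abs _ _ sgn, THEN iffD2,
          OF _ _ _ _ weak_partial_abs[OF b \<Omega> v'(4) g'(4) w]]) (auto simp: v'(2) g'(2))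
  from has_weak_partial_lincomb[OF \<Omega>l b w' this, of "1 / 2" "1 / 2"]
  have "has_weak_partial \<Omega> b (\<lambda>x. 1 / 2 * v' x + 1 / 2 * \<bar>v' x\<bar>) (\<lambda>x. 1 / 2 * g' x + 1 / 2 * (sgn (v' x) * g' x))" .
  moreover have p: "(\<lambda>x. 1 / 2 * v' x + 1 / 2 * \<bar>v' x\<bar>) = pos_part v'"
    by (auto simp: pos_part_def fun_eq_iff max_def)
  ultimately have wp: "has_weak_partial \<Omega> b (pos_part v') (\<lambda>x. 1 / 2 * g' x + 1 / 2 * (sgn (v' x) * g' x))"
    by (simp only:)
  have p2: "pos_part v' \<in> L2 \<Omega>" "(\<lambda>x. 1 / 2 * g' x + 1 / 2 * (sgn (v' x) * g' x)) \<in> L2 \<Omega>"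
    using L2_lincomb[OF v'(5) abs, of "1 / 2" "1 / 2"] L2_lincomb[OF g'(5) sgn]
    unfolding p .
  show "has_weak_partial \<Omega> b (pos_part v) (\<lambda>x. of_bool (v x > 0) * g x)"
  proof (rule has_weak_partial_AE_cong[OF \<Omega>l b wp p2(1) _ p2(2)])
    show "AE x in lebesgue_on \<Omega>. pos_part v' x = pos_part v x"
      using v'(3) by eventually_elim (simp add: pos_part_def)
    show "AE x in lebesgue_on \<Omega>. 1 / 2 * g' x + 1 / 2 * (sgn (v' x) * g' x) = of_bool (v x > 0) * g x"
      using v'(3) g'(3) z by eventually_elim (auto simp: sgn_if)
  qed
qed

subsection \<open>The space \<open>H\<^sup>1\<close> and its dual\<close>

lemma open_sets_lebesgue: "open S \<Longrightarrow> S \<in> sets lebesgue"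
  by (simp add: borel_open sets_completionI_sets)

text \<open>The choice in \<open>weak_partial\<close> promises a weak derivative but not a square
  integrable one; uniqueness transfers this property from the derivative supplied by
  \<open>H1\<close>.\<close>

lemma H1_weak_partial:
  assumes \<Omega>: "open \<Omega>" and v: "v \<in> H1 \<Omega>" and b: "b \<in> Basis"
  shows "has_weak_partial \<Omega> b v (weak_partial \<Omega> b v)" "weak_partial \<Omega> b v \<in> L2 \<Omega>"
proof -
  obtain g where g: "g \<in> L2 \<Omega>" "has_weak_partial \<Omega> b v g"
    using v b by (auto simp: H1_def)
  show w: "has_weak_partial \<Omega> b v (weak_partial \<Omega> b v)"
    unfolding weak_partial_def by (rule someI[of "has_weak_partial \<Omega> b v", OF g(2)])
  show "weak_partial \<Omega> b v \<in> L2 \<Omega>"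
    by (rule L2_norm_AE_cong(1)[OF open_sets_lebesgue[OF \<Omega>] g(1) has_weak_partial_unique[OF \<Omega> b g(2) w]])
qed

lemma H1_L2: "v \<in> H1 \<Omega> \<Longrightarrow> v \<in> L2 \<Omega>"
  by (simp add: H1_def)

lemma H1_intro:
  assumes "v \<in> L2 \<Omega>" "\<And>b. b \<in> Basis \<Longrightarrow> g b \<in> L2 \<Omega>" "\<And>b. b \<in> Basis \<Longrightarrow> has_weak_partial \<Omega> b v (g b)"
  shows "v \<in> H1 \<Omega>"
  using assms by (auto simp: H1_def)

lemma H1_norm_nonneg: "0 \<le> H1_norm \<Omega> v"
  by (simp add: H1_norm_def sum_nonneg)

lemma H1_norm_sq: "(H1_norm \<Omega> v)\<^sup>2 = (L2_norm \<Omega> v)\<^sup>2 + (\<Sum>b\<in>Basis. (L2_norm \<Omega> (weak_partial \<Omega> b v))\<^sup>2)"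
  by (simp add: H1_norm_def sum_nonneg)

text \<open>Frees the norm from the choice in \<open>weak_partial\<close>: any square integrable
  weak derivatives may be used to compute it.\<close>

lemma H1_norm_sq_eq:
  assumes \<Omega>: "open \<Omega>" and g: "\<And>b. b \<in> Basis \<Longrightarrow> g b \<in> L2 \<Omega>"
    "\<And>b. b \<in> Basis \<Longrightarrow> has_weak_partial \<Omega> b v (g b)" and v: "v \<in> L2 \<Omega>"
  shows "(H1_norm \<Omega> v)\<^sup>2 = (L2_norm \<Omega> v)\<^sup>2 + (\<Sum>b\<in>Basis. (L2_norm \<Omega> (g b))\<^sup>2)"
proof -
  have "L2_norm \<Omega> (weak_partial \<Omega> b v) = L2_norm \<Omega> (g b)" if b: "b \<in> Basis" for b
    by (rule L2_norm_AE_cong(2)[OF open_sets_lebesgue[OF \<Omega>] _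
          has_weak_partial_unique[OF \<Omega> b _ g(2)[OF b]]])
      (use H1_weak_partial[OF \<Omega> H1_intro[OF v g] b] in simp_all)
  then show ?thesis by (simp add: H1_norm_sq)
qed

lemma H1_lincomb:
  assumes \<Omega>: "open \<Omega>" and v: "v \<in> H1 \<Omega>" and w: "w \<in> H1 \<Omega>"
  shows "(\<lambda>x. c * v x + d * w x) \<in> H1 \<Omega>"
    and "(H1_norm \<Omega> (\<lambda>x. c * v x + d * w x))\<^sup>2 = (L2_norm \<Omega> (\<lambda>x. c * v x + d * w x))\<^sup>2 +
      (\<Sum>b\<in>Basis. (L2_norm \<Omega> (\<lambda>x. c * weak_partial \<Omega> b v x + d * weak_partial \<Omega> b w x))\<^sup>2)"
proof -
  have L2: "(\<lambda>x. c * weak_partial \<Omega> b v x + d * weak_partial \<Omega> b w x) \<in> L2 \<Omega>" if "b \<in> Basis" for b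
    by (rule L2_lincomb[OF H1_weak_partial(2)[OF \<Omega> v that] H1_weak_partial(2)[OF \<Omega> w that]])
  have wp: "has_weak_partial \<Omega> b (\<lambda>x. c * v x + d * w x) (\<lambda>x. c * weak_partial \<Omega> b v x + d * weak_partial \<Omega> b w x)"
    if "b \<in> Basis" for b
    by (rule has_weak_partial_lincomb[OF open_sets_lebesgue[OF \<Omega>] that
          H1_weak_partial(1)[OF \<Omega> v that] H1_weak_partial(1)[OF \<Omega> w that]])
  have vw: "(\<lambda>x. c * v x + d * w x) \<in> L2 \<Omega>"
    by (rule L2_lincomb[OF H1_L2[OF v] H1_L2[OF w]])
  show "(\<lambda>x. c * v x + d * w x) \<in> H1 \<Omega>"
    by (rule H1_intro[OF vw L2 wp])
  show "(H1_norm \<Omega> (\<lambda>x. c * v x + d * w x))\<^sup>2 = (L2_norm \<Omega> (\<lambda>x. c * v x + d * w x))\<^sup>2 +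
      (\<Sum>b\<in>Basis. (L2_norm \<Omega> (\<lambda>x. c * weak_partial \<Omega> b v x + d * weak_partial \<Omega> b w x))\<^sup>2)"
    by (rule H1_norm_sq_eq[OF \<Omega> L2 wp vw])
qed

lemma L2_norm_scale: "(L2_norm \<Omega> (\<lambda>x. c * f x))\<^sup>2 = c\<^sup>2 * (L2_norm \<Omega> f)\<^sup>2"
  by (simp add: L2_norm_sq power_mult_distrib)

lemma H1_scale:
  assumes "open \<Omega>" "v \<in> H1 \<Omega>"
  shows "(\<lambda>x. c * v x) \<in> H1 \<Omega>" "H1_norm \<Omega> (\<lambda>x. c * v x) = \<bar>c\<bar> * H1_norm \<Omega> v"
proof -
  show "(\<lambda>x. c * v x) \<in> H1 \<Omega>"
    using H1_lincomb(1)[OF assms assms(2), of c 0] by simp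
  have "(H1_norm \<Omega> (\<lambda>x. c * v x))\<^sup>2 = (\<bar>c\<bar> * H1_norm \<Omega> v)\<^sup>2"
    using H1_lincomb(2)[OF assms assms(2), of c 0]
    by (simp add: L2_norm_scale H1_norm_sq power_mult_distrib distrib_left sum_distrib_left)
  then show "H1_norm \<Omega> (\<lambda>x. c * v x) = \<bar>c\<bar> * H1_norm \<Omega> v"
    by (simp add: H1_norm_nonneg)
qed

section \<open>The positive part as a map on H^1\<close>

lemma pos_part_H1:
  assumes \<Omega>: "open \<Omega>" and v: "v \<in> H1 \<Omega>"
  shows "pos_part v \<in> H1 \<Omega>" "H1_norm \<Omega> (pos_part v) \<le> H1_norm \<Omega> v"
    and "\<And>b. b \<in> Basis \<Longrightarrow> AE x in lebesgue_on \<Omega>. weak_partial \<Omega> b (pos_part v) x = of_bool (v x > 0) * weak_partial \<Omega> b v x"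
proof -
  have vm[measurable]: "v \<in> borel_measurable (lebesgue_on \<Omega>)" using H1_L2[OF v] by (simp add: L2_def)
  have p: "pos_part v \<in> L2 \<Omega>"
    by (rule L2_bound[OF H1_L2[OF v]]) (use vm in \<open>auto simp: pos_part_def[abs_def] max_def\<close>)
  have wp: "has_weak_partial \<Omega> b (pos_part v) (\<lambda>x. of_bool (v x > 0) * weak_partial \<Omega> b v x)" if "b \<in> Basis" for b
    by (rule has_weak_partial_pos_part(1)[OF \<Omega> that H1_L2[OF v] H1_weak_partial(2)[OF \<Omega> v that]
          H1_weak_partial(1)[OF \<Omega> v that]])
  have L2: "(\<lambda>x. of_bool (v x > 0) * weak_partial \<Omega> b v x) \<in> L2 \<Omega>" if "b \<in> Basis" for b
  proof -
    note w = H1_weak_partial(2)[OF \<Omega> v that]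
    have [measurable]: "weak_partial \<Omega> b v \<in> borel_measurable (lebesgue_on \<Omega>)" using w by (simp add: L2_def)
    show ?thesis
      by (rule L2_bound[OF w]) auto
  qed
  show H1: "pos_part v \<in> H1 \<Omega>" by (rule H1_intro[OF p L2 wp])
  show "AE x in lebesgue_on \<Omega>. weak_partial \<Omega> b (pos_part v) x = of_bool (v x > 0) * weak_partial \<Omega> b v x"
    if "b \<in> Basis" for b
    by (rule has_weak_partial_unique[OF \<Omega> that H1_weak_partial(1)[OF \<Omega> H1 that] wp[OF that]])
  have "(H1_norm \<Omega> (pos_part v))\<^sup>2 = (L2_norm \<Omega> (pos_part v))\<^sup>2 +
      (\<Sum>b\<in>Basis. (L2_norm \<Omega> (\<lambda>x. of_bool (v x > 0) * weak_partial \<Omega> b v x))\<^sup>2)"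
    by (rule H1_norm_sq_eq[OF \<Omega> L2 wp p])
  also have "\<dots> \<le> (L2_norm \<Omega> v)\<^sup>2 + (\<Sum>b\<in>Basis. (L2_norm \<Omega> (weak_partial \<Omega> b v))\<^sup>2)"
  proof (intro add_mono sum_mono)
    show "(L2_norm \<Omega> (pos_part v))\<^sup>2 \<le> (L2_norm \<Omega> v)\<^sup>2"
      by (rule L2_norm_sq_mono[OF p H1_L2[OF v]]) (simp add: pos_part_def max_def)
    show "(L2_norm \<Omega> (\<lambda>x. of_bool (v x > 0) * weak_partial \<Omega> b v x))\<^sup>2 \<le> (L2_norm \<Omega> (weak_partial \<Omega> b v))\<^sup>2"
      if "b \<in> Basis" for b
      by (rule L2_norm_sq_mono[OF L2[OF that] H1_weak_partial(2)[OF \<Omega> v that]]) auto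
  qed
  also have "\<dots> = (H1_norm \<Omega> v)\<^sup>2" by (rule H1_norm_sq[symmetric])
  finally have "(H1_norm \<Omega> (pos_part v))\<^sup>2 \<le> (H1_norm \<Omega> v)\<^sup>2" .
  then show "H1_norm \<Omega> (pos_part v) \<le> H1_norm \<Omega> v"
    by (rule power2_le_imp_le[OF _ H1_norm_nonneg])
qed

text \<open>Convergence in L^2 gives almost everywhere convergence only along subsequences. If every
  subsequence has a further one tending to 0, a sequence staying away from 0 infinitely often is
  contradictory.\<close>

lemma tendsto_0_subseqI:
  fixes a :: "nat \<Rightarrow> real"
  assumes "\<And>r. strict_mono (r :: nat \<Rightarrow> nat) \<Longrightarrow> \<exists>s. strict_mono (s :: nat \<Rightarrow> nat) \<and> (\<lambda>k. a (r (s k))) \<longlonglongrightarrow> 0"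
  shows "a \<longlonglongrightarrow> 0"
proof (rule ccontr)
  assume "\<not> a \<longlonglongrightarrow> 0"
  then obtain e where e: "e > 0" "\<And>N. \<exists>n\<ge>N. e \<le> \<bar>a n\<bar>"
    unfolding LIMSEQ_def by (auto simp: not_less)
  then have "infinite {n. e \<le> \<bar>a n\<bar>}"
    by (auto simp: infinite_nat_iff_unbounded_le)
  then obtain r where r: "strict_mono (r :: nat \<Rightarrow> nat)" "\<And>n. r n \<in> {n. e \<le> \<bar>a n\<bar>}"
    using infinite_enumerate by blast
  obtain s where s: "(\<lambda>k. a (r (s k))) \<longlonglongrightarrow> 0"
    using assms[OF r(1)] by blast
  from LIMSEQ_D[OF s e(1)] obtain k where "\<bar>a (r (s k))\<bar> < e" by auto
  with r(2)[of "s k"] show False by simp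
qed

lemma L2_norm_tendsto_AE_subseq:
  assumes L2: "\<And>k. f k \<in> L2 \<Omega>" and lim: "(\<lambda>k. (L2_norm \<Omega> (f k))\<^sup>2) \<longlonglongrightarrow> 0"
  obtains s where "strict_mono (s :: nat \<Rightarrow> nat)" "AE x in lebesgue_on \<Omega>. (\<lambda>k. f (s k) x) \<longlonglongrightarrow> 0"
proof -
  have "\<exists>s. strict_mono (s :: nat \<Rightarrow> nat) \<and> (AE x in lebesgue_on \<Omega>. (\<lambda>k. (f (s k) x)\<^sup>2) \<longlonglongrightarrow> 0)"
  proof (rule tendsto_L1_AE_subseq)
    show "integrable (lebesgue_on \<Omega>) (\<lambda>x. (f k x)\<^sup>2)" for k using L2[of k] by (simp add: L2_def)
    show "(\<lambda>k. LINT x|lebesgue_on \<Omega>. norm ((f k x)\<^sup>2)) \<longlonglongrightarrow> 0"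
      using lim by (simp add: L2_norm_sq)
  qed
  then obtain s where s: "strict_mono (s :: nat \<Rightarrow> nat)" "AE x in lebesgue_on \<Omega>. (\<lambda>k. (f (s k) x)\<^sup>2) \<longlonglongrightarrow> 0"
    by blast
  have "AE x in lebesgue_on \<Omega>. (\<lambda>k. f (s k) x) \<longlonglongrightarrow> 0"
    using s(2)
  proof eventually_elim
    case (elim x)
    have "(\<lambda>k. sqrt ((f (s k) x)\<^sup>2)) \<longlonglongrightarrow> sqrt 0" by (intro tendsto_intros elim)
    then show ?case by (simp add: tendsto_rabs_zero_iff)
  qed
  with s(1) that show ?thesis by blast
qed

lemma of_bool_pos_tendsto:
  fixes y :: "nat \<Rightarrow> real"
  assumes "y \<longlonglongrightarrow> s" "s \<noteq> 0"
  shows "\<forall>\<^sub>F k in sequentially. (y k > 0) = (s > 0)"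
proof (cases "s > 0")
  case True
  from order_tendstoD(1)[OF assms(1) True] show ?thesis by eventually_elim (simp add: True)
next
  case False
  with assms(2) have "s < 0" by simp
  from order_tendstoD(2)[OF assms(1) this] show ?thesis by eventually_elim (use False in auto)
qed

text \<open>Along a subsequence converging almost everywhere, the gradients \<open>1\<^bsub>v\<^sub>k > 0\<^esub> \<nabla>v\<^sub>k\<close> converge in \<open>L\<^sup>2\<close>
  by dominated convergence; on \<open>{v = 0}\<close>, where the indicators need not converge, \<open>\<nabla>v\<close> vanishes.\<close>

proposition pos_part_H1_continuous:
  fixes \<Omega> :: "'a::euclidean_space set"
  assumes \<Omega>: "open \<Omega>" and v: "v \<in> H1 \<Omega>" and vk: "\<And>k. w k \<in> H1 \<Omega>"
    and lim: "(\<lambda>k. H1_norm \<Omega> (\<lambda>x. w k x - v x)) \<longlonglongrightarrow> 0"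
  shows "(\<lambda>k. H1_norm \<Omega> (\<lambda>x. pos_part (w k) x - pos_part v x)) \<longlonglongrightarrow> 0"
proof (rule tendsto_0_subseqI)
  fix r :: "nat \<Rightarrow> nat" assume r: "strict_mono r"
  define d where "d k x = w k x - v x" for k x
  have sq: "(H1_norm \<Omega> (d k))\<^sup>2 = (L2_norm \<Omega> (d k))\<^sup>2 +
      (\<Sum>b\<in>Basis. (L2_norm \<Omega> (\<lambda>x. weak_partial \<Omega> b (w k) x - weak_partial \<Omega> b v x))\<^sup>2)" for k
    using H1_lincomb(2)[OF \<Omega> vk[of k] v, of 1 "-1"] by (simp add: d_def[abs_def])
  have sqp: "(H1_norm \<Omega> (\<lambda>x. pos_part (w k) x - pos_part v x))\<^sup>2 = (L2_norm \<Omega> (\<lambda>x. pos_part (w k) x - pos_part v x))\<^sup>2 +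
      (\<Sum>b\<in>Basis. (L2_norm \<Omega> (\<lambda>x. weak_partial \<Omega> b (pos_part (w k)) x - weak_partial \<Omega> b (pos_part v) x))\<^sup>2)" for k
    using H1_lincomb(2)[OF \<Omega> pos_part_H1(1)[OF \<Omega> vk[of k]] pos_part_H1(1)[OF \<Omega> v], of 1 "-1"] by simp
  have diff: "(\<lambda>x. f x - g x) \<in> L2 \<Omega>" if "f \<in> L2 \<Omega>" "g \<in> L2 \<Omega>" for f g
    using L2_lincomb[OF that, of 1 "-1"] by simp
  have dL2: "d k \<in> L2 \<Omega>" for k
    unfolding d_def[abs_def] by (rule diff[OF H1_L2[OF vk] H1_L2[OF v]])
  have lim2: "(\<lambda>k. (H1_norm \<Omega> (d k))\<^sup>2) \<longlonglongrightarrow> 0"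
    using tendsto_power[OF lim, of 2] by (simp add: d_def[abs_def])
  have limL2: "(\<lambda>k. (L2_norm \<Omega> (d k))\<^sup>2) \<longlonglongrightarrow> 0"
    by (rule Lim_null_comparison[OF _ lim2]) (simp add: sq sum_nonneg)
  have limb: "(\<lambda>k. (L2_norm \<Omega> (\<lambda>x. weak_partial \<Omega> b (w k) x - weak_partial \<Omega> b v x))\<^sup>2) \<longlonglongrightarrow> 0" if "b \<in> Basis" for b
  proof (rule Lim_null_comparison[OF _ lim2])
    have "(L2_norm \<Omega> (\<lambda>x. weak_partial \<Omega> b (w k) x - weak_partial \<Omega> b v x))\<^sup>2 \<le>
        (\<Sum>b\<in>Basis. (L2_norm \<Omega> (\<lambda>x. weak_partial \<Omega> b (w k) x - weak_partial \<Omega> b v x))\<^sup>2)" for k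
      by (rule member_le_sum[OF that]) auto
    then show "\<forall>\<^sub>F k in sequentially. norm ((L2_norm \<Omega> (\<lambda>x. weak_partial \<Omega> b (w k) x - weak_partial \<Omega> b v x))\<^sup>2) \<le>
        (H1_norm \<Omega> (d k))\<^sup>2"
      by (auto simp: sq intro!: always_eventually add_increasing)
  qed
  obtain s where s: "strict_mono s" "AE x in lebesgue_on \<Omega>. (\<lambda>k. d (r (s k)) x) \<longlonglongrightarrow> 0"
  proof (rule L2_norm_tendsto_AE_subseq[where f = "\<lambda>k. d (r k)" and \<Omega> = \<Omega>])
    show "d (r k) \<in> L2 \<Omega>" for k by (rule dL2)
    show "(\<lambda>k. (L2_norm \<Omega> (d (r k)))\<^sup>2) \<longlonglongrightarrow> 0"
      by (rule filterlim_compose[OF limL2 filterlim_subseq[OF r]])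
  qed
  define q where "q k = r (s k)" for k
  have q: "filterlim q sequentially sequentially"
    unfolding q_def by (rule filterlim_compose[OF filterlim_subseq[OF r] filterlim_subseq[OF s(1)]])
  have "(\<lambda>k. (L2_norm \<Omega> (\<lambda>x. pos_part (w (q k)) x - pos_part v x))\<^sup>2) \<longlonglongrightarrow> 0"
  proof (rule Lim_null_comparison)
    show "(\<lambda>k. (L2_norm \<Omega> (d (q k)))\<^sup>2) \<longlonglongrightarrow> 0"
      by (rule filterlim_compose[OF limL2 q])
    show "\<forall>\<^sub>F k in sequentially. norm ((L2_norm \<Omega> (\<lambda>x. pos_part (w (q k)) x - pos_part v x))\<^sup>2) \<le> (L2_norm \<Omega> (d (q k)))\<^sup>2"
    proof (intro always_eventually allI)
      fix k
      have "(L2_norm \<Omega> (\<lambda>x. pos_part (w (q k)) x - pos_part v x))\<^sup>2 \<le> (L2_norm \<Omega> (d (q k)))\<^sup>2"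
        by (rule L2_norm_sq_mono[OF diff[OF H1_L2[OF pos_part_H1(1)[OF \<Omega> vk]] H1_L2[OF pos_part_H1(1)[OF \<Omega> v]]] dL2])
          (simp add: pos_part_def d_def max_def)
      then show "norm ((L2_norm \<Omega> (\<lambda>x. pos_part (w (q k)) x - pos_part v x))\<^sup>2) \<le> (L2_norm \<Omega> (d (q k)))\<^sup>2" by simp
    qed
  qed
  moreover have "(\<lambda>k. (L2_norm \<Omega> (\<lambda>x. weak_partial \<Omega> b (pos_part (w (q k))) x - weak_partial \<Omega> b (pos_part v) x))\<^sup>2) \<longlonglongrightarrow> 0"
    if b: "b \<in> Basis" for b
  proof -
    \<comment> \<open>The difference of the two gradients is split as 1[w > 0] (grad w - grad v) +
      \<eta> grad v. The first term is controlled by the convergence of \<open>w\<close>, the second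
      by dominated convergence.\<close>
    define \<eta> where "\<eta> k x = of_bool (w (q k) x > 0) - (of_bool (v x > 0) :: real)" for k x
    define g where "g = weak_partial \<Omega> b v"
    define e where "e k x = weak_partial \<Omega> b (w (q k)) x - g x" for k x
    have g: "g \<in> L2 \<Omega>" unfolding g_def by (rule H1_weak_partial(2)[OF \<Omega> v b])
    have e: "e k \<in> L2 \<Omega>" for k
      unfolding e_def[abs_def] by (rule diff[OF H1_weak_partial(2)[OF \<Omega> vk b] g])
    have [measurable]: "w k \<in> borel_measurable (lebesgue_on \<Omega>)" "v \<in> borel_measurable (lebesgue_on \<Omega>)"
      "g \<in> borel_measurable (lebesgue_on \<Omega>)" for k
      using H1_L2[OF vk[of k]] H1_L2[OF v] g by (auto simp: L2_def)
    have \<eta>m[measurable]: "\<eta> k \<in> borel_measurable (lebesgue_on \<Omega>)" for k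
      unfolding \<eta>_def[abs_def] by measurable
    have \<eta>1: "\<bar>\<eta> k x\<bar> \<le> 1" for k x by (auto simp: \<eta>_def)
    have \<eta>g: "integrable (lebesgue_on \<Omega>) (\<lambda>x. (\<eta> k x * g x)\<^sup>2)" for k
    proof -
      have "(\<lambda>x. \<eta> k x * g x) \<in> L2 \<Omega>"
        by (rule L2_bound[OF g]) (use \<eta>1 in \<open>auto simp: abs_mult intro!: mult_left_le_one_le\<close>)
      then show ?thesis by (simp add: L2_def)
    qed
    have "(\<lambda>k. LINT x|lebesgue_on \<Omega>. (\<eta> k x * g x)\<^sup>2) \<longlonglongrightarrow> (LINT x|lebesgue_on \<Omega>. 0)"
    proof (rule integral_dominated_convergence[where w = "\<lambda>x. (g x)\<^sup>2"])
      show "AE x in lebesgue_on \<Omega>. (\<lambda>k. (\<eta> k x * g x)\<^sup>2) \<longlonglongrightarrow> 0"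
        using s(2) has_weak_partial_pos_part(2)[OF \<Omega> b H1_L2[OF v] g H1_weak_partial(1)[OF \<Omega> v b, folded g_def]]
      proof eventually_elim
        case (elim x)
        show ?case
        proof (cases "v x = 0")
          case False
          have "(\<lambda>k. d (q k) x + v x) \<longlonglongrightarrow> 0 + v x" using elim(1) unfolding q_def by (intro tendsto_intros)
          then have "(\<lambda>k. w (q k) x) \<longlonglongrightarrow> v x" by (simp add: d_def)
          from of_bool_pos_tendsto[OF this False]
          have "\<forall>\<^sub>F k in sequentially. (\<eta> k x * g x)\<^sup>2 = 0"
            by eventually_elim (simp add: \<eta>_def)
          then show ?thesis by (rule tendsto_eventually)
        qed (use elim in simp)
      qed
      show "AE x in lebesgue_on \<Omega>. norm ((\<eta> k x * g x)\<^sup>2) \<le> (g x)\<^sup>2" for k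
        using \<eta>1 by (auto simp: power_mult_distrib abs_square_le_1 intro!: mult_left_le_one_le)
    qed (use g in \<open>auto simp: L2_def\<close>)
    then have lim0: "(\<lambda>k. 2 * (L2_norm \<Omega> (e k))\<^sup>2 + 2 * (LINT x|lebesgue_on \<Omega>. (\<eta> k x * g x)\<^sup>2)) \<longlonglongrightarrow> 2 * 0 + 2 * 0"
      using filterlim_compose[OF limb[OF b] q] unfolding e_def[abs_def] g_def[symmetric]
      by (intro tendsto_intros) simp_all
    have bound: "(L2_norm \<Omega> (\<lambda>x. weak_partial \<Omega> b (pos_part (w (q k))) x - weak_partial \<Omega> b (pos_part v) x))\<^sup>2 \<le>
        2 * (L2_norm \<Omega> (e k))\<^sup>2 + 2 * (LINT x|lebesgue_on \<Omega>. (\<eta> k x * g x)\<^sup>2)" for k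
    proof -
      have "(LINT x|lebesgue_on \<Omega>. (weak_partial \<Omega> b (pos_part (w (q k))) x - weak_partial \<Omega> b (pos_part v) x)\<^sup>2) \<le>
          (LINT x|lebesgue_on \<Omega>. 2 * (e k x)\<^sup>2 + 2 * (\<eta> k x * g x)\<^sup>2)"
      proof (rule integral_mono_AE)
        show "AE x in lebesgue_on \<Omega>. (weak_partial \<Omega> b (pos_part (w (q k))) x - weak_partial \<Omega> b (pos_part v) x)\<^sup>2 \<le>
            2 * (e k x)\<^sup>2 + 2 * (\<eta> k x * g x)\<^sup>2"
          using pos_part_H1(3)[OF \<Omega> vk[of "q k"] b] pos_part_H1(3)[OF \<Omega> v b]
        proof eventually_elim
          case (elim x)
          define a where "a = of_bool (w (q k) x > 0) * e k x"
          define c where "c = \<eta> k x * g x"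
          have "weak_partial \<Omega> b (pos_part (w (q k))) x - weak_partial \<Omega> b (pos_part v) x = a + c"
            unfolding elim a_def c_def \<eta>_def e_def g_def by (simp add: algebra_simps)
          moreover have "(a + c)\<^sup>2 \<le> 2 * a\<^sup>2 + 2 * c\<^sup>2"
            using zero_le_power2[of "a - c"] by (simp add: power2_eq_square algebra_simps)
          moreover have "a\<^sup>2 \<le> (e k x)\<^sup>2" by (simp add: a_def)
          ultimately show ?case by (simp add: c_def)
        qed
        show "integrable (lebesgue_on \<Omega>) (\<lambda>x. (weak_partial \<Omega> b (pos_part (w (q k))) x - weak_partial \<Omega> b (pos_part v) x)\<^sup>2)"
          using diff[OF H1_weak_partial(2)[OF \<Omega> pos_part_H1(1)[OF \<Omega> vk[of "q k"]] b] H1_weak_partial(2)[OF \<Omega> pos_part_H1(1)[OF \<Omega> v] b]]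
          by (simp add: L2_def)
        show "integrable (lebesgue_on \<Omega>) (\<lambda>x. 2 * (e k x)\<^sup>2 + 2 * (\<eta> k x * g x)\<^sup>2)"
          using e[of k] \<eta>g[of k] by (simp add: L2_def)
      qed
      also have "\<dots> = 2 * (L2_norm \<Omega> (e k))\<^sup>2 + 2 * (LINT x|lebesgue_on \<Omega>. (\<eta> k x * g x)\<^sup>2)"
        using e[of k] \<eta>g[of k] by (simp add: L2_def L2_norm_sq)
      finally show ?thesis by (simp only: L2_norm_sq)
    qed
    show ?thesis
    proof (rule Lim_null_comparison)
      show "\<forall>\<^sub>F k in sequentially. norm ((L2_norm \<Omega> (\<lambda>x. weak_partial \<Omega> b (pos_part (w (q k))) x - weak_partial \<Omega> b (pos_part v) x))\<^sup>2) \<le>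
          2 * (L2_norm \<Omega> (e k))\<^sup>2 + 2 * (LINT x|lebesgue_on \<Omega>. (\<eta> k x * g x)\<^sup>2)"
        using bound by (intro always_eventually allI) simp
    qed (use lim0 in simp)
  qed
  ultimately have "(\<lambda>k. (H1_norm \<Omega> (\<lambda>x. pos_part (w (q k)) x - pos_part v x))\<^sup>2) \<longlonglongrightarrow> 0 + (\<Sum>b\<in>(Basis::'a set). 0)"
    unfolding sqp by (intro tendsto_add tendsto_sum)
  then have "(\<lambda>k. sqrt ((H1_norm \<Omega> (\<lambda>x. pos_part (w (q k)) x - pos_part v x))\<^sup>2)) \<longlonglongrightarrow> sqrt 0"
    by (intro tendsto_intros) simp
  then have "(\<lambda>k. H1_norm \<Omega> (\<lambda>x. pos_part (w (q k)) x - pos_part v x)) \<longlonglongrightarrow> 0"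
    by (simp add: H1_norm_nonneg)
  with s(1) show "\<exists>s. strict_mono s \<and> (\<lambda>k. H1_norm \<Omega> (\<lambda>x. pos_part (w (r (s k))) x - pos_part v x)) \<longlonglongrightarrow> 0"
    unfolding q_def by blast
qed

section \<open>Bounded functionals on H^1\<close>

lemma H1_zero: "open \<Omega> \<Longrightarrow> (\<lambda>_. 0) \<in> H1 \<Omega>" "open \<Omega> \<Longrightarrow> H1_norm \<Omega> (\<lambda>_. 0) = 0"
proof -
  assume \<Omega>: "open \<Omega>"
  have z: "(\<lambda>_. 0) \<in> L2 \<Omega>" by (simp add: L2_def)
  have "has_weak_partial \<Omega> b (\<lambda>_. 0) (\<lambda>_. 0)" for b
    by (simp add: has_weak_partial_def locally_integrable_on_def)
  with z show H: "(\<lambda>_. 0) \<in> H1 \<Omega>" by (auto intro: H1_intro)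
  show "H1_norm \<Omega> (\<lambda>_. 0) = 0"
    using H1_scale(2)[OF \<Omega> H, of 0] by simp
qed

lemma H1_dual_boundE:
  assumes "l \<in> H1_dual \<Omega>"
  obtains C where "\<And>v. v \<in> H1 \<Omega> \<Longrightarrow> \<bar>l v\<bar> \<le> C * H1_norm \<Omega> v"
proof -
  have "\<exists>C. \<forall>v\<in>H1 \<Omega>. \<bar>l v\<bar> \<le> C * H1_norm \<Omega> v"
    using assms by (simp add: H1_dual_def)
  then obtain C where "\<forall>v\<in>H1 \<Omega>. \<bar>l v\<bar> \<le> C * H1_norm \<Omega> v" ..
  then show ?thesis by (intro that[of C]) simp
qed

text \<open>The constant that comes with membership in the dual bounds the set of values, so the
  real supremum defining \<open>H1_dual_norm\<close> is a genuine least upper bound.\<close>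

lemma H1_dual_unit_bound:
  assumes l: "l \<in> H1_dual \<Omega>" and v: "v \<in> H1 \<Omega>" "H1_norm \<Omega> v \<le> 1"
  shows "\<bar>l v\<bar> \<le> H1_dual_norm \<Omega> l"
proof -
  obtain C where C: "\<And>v. v \<in> H1 \<Omega> \<Longrightarrow> \<bar>l v\<bar> \<le> C * H1_norm \<Omega> v"
    by (rule H1_dual_boundE[OF l]) (rule that)
  have bdd: "bdd_above ((\<lambda>v. \<bar>l v\<bar>) ` {v \<in> H1 \<Omega>. H1_norm \<Omega> v \<le> 1})"
  proof (rule bdd_aboveI2[where M = "\<bar>C\<bar>"])
    fix z assume z: "z \<in> {v \<in> H1 \<Omega>. H1_norm \<Omega> v \<le> 1}"
    have "C * H1_norm \<Omega> z \<le> \<bar>C\<bar> * 1"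
      using z H1_norm_nonneg[of \<Omega> z] by (intro mult_mono) auto
    with C[of z] z show "\<bar>l z\<bar> \<le> \<bar>C\<bar>" by simp
  qed
  show ?thesis
    unfolding H1_dual_norm_def by (rule cSUP_upper[OF _ bdd]) (use v in simp)
qed

lemma H1_dual_bound:
  assumes \<Omega>: "open \<Omega>" and l: "l \<in> H1_dual \<Omega>" and v: "v \<in> H1 \<Omega>"
  shows "\<bar>l v\<bar> \<le> H1_dual_norm \<Omega> l * H1_norm \<Omega> v"
proof -
  obtain C where C: "\<And>v. v \<in> H1 \<Omega> \<Longrightarrow> \<bar>l v\<bar> \<le> C * H1_norm \<Omega> v"
    by (rule H1_dual_boundE[OF l]) (rule that)
  show ?thesis
  proof (cases "H1_norm \<Omega> v = 0")
    \<comment> \<open>Such a \<open>v\<close> cannot be normalised; the constant \<open>C\<close>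
      forces \<open>l v\<close> = 0 instead.\<close>
    case True
    with C[OF v] show ?thesis by simp
  next
    case False
    define w where "w x = 1 / H1_norm \<Omega> v * v x" for x
    have pos: "H1_norm \<Omega> v > 0" using False H1_norm_nonneg[of \<Omega> v] by simp
    have w: "w \<in> H1 \<Omega>" "H1_norm \<Omega> w = 1"
      using H1_scale[OF \<Omega> v, of "1 / H1_norm \<Omega> v"] pos by (simp_all add: w_def[abs_def])
    have "\<bar>l w\<bar> \<le> H1_dual_norm \<Omega> l"
      by (rule H1_dual_unit_bound[OF l]) (use w in simp_all)
    moreover have scale: "l (\<lambda>x. c * v x) = c * l v" for c
      using l v by (simp add: H1_dual_def)
    have "l w = 1 / H1_norm \<Omega> v * l v"
      unfolding w_def[abs_def] by (rule scale)
    ultimately show ?thesis using pos by (simp add: abs_mult abs_divide divide_le_eq)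
  qed
qed

lemma H1_dual_norm_leI:
  assumes "open \<Omega>" "\<And>v. v \<in> H1 \<Omega> \<Longrightarrow> H1_norm \<Omega> v \<le> 1 \<Longrightarrow> \<bar>l v\<bar> \<le> B"
  shows "H1_dual_norm \<Omega> l \<le> B"
  unfolding H1_dual_norm_def
  by (rule cSUP_least) (use assms H1_zero[OF assms(1)] in \<open>auto intro!: exI[of _ "\<lambda>_. 0"]\<close>)

lemma H1_dual_norm_nonneg:
  assumes "open \<Omega>" "l \<in> H1_dual \<Omega>"
  shows "0 \<le> H1_dual_norm \<Omega> l"
  using H1_dual_unit_bound[OF assms(2) H1_zero(1)[OF assms(1)]] H1_zero(2)[OF assms(1)] by simp

lemma H1_dual_lincomb:
  assumes l: "l \<in> H1_dual \<Omega>" and m: "m \<in> H1_dual \<Omega>"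
  shows "(\<lambda>v. a * l v + m v) \<in> H1_dual \<Omega>"
proof -
  obtain C where C: "\<And>v. v \<in> H1 \<Omega> \<Longrightarrow> \<bar>l v\<bar> \<le> C * H1_norm \<Omega> v"
    by (rule H1_dual_boundE[OF l]) (rule that)
  obtain D where D: "\<And>v. v \<in> H1 \<Omega> \<Longrightarrow> \<bar>m v\<bar> \<le> D * H1_norm \<Omega> v"
    by (rule H1_dual_boundE[OF m]) (rule that)
  have "\<bar>a * l v + m v\<bar> \<le> (\<bar>a\<bar> * C + D) * H1_norm \<Omega> v" if "v \<in> H1 \<Omega>" for v
  proof -
    have "\<bar>a\<bar> * \<bar>l v\<bar> \<le> \<bar>a\<bar> * (C * H1_norm \<Omega> v)"
      by (intro mult_left_mono C that) simp
    then show ?thesis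
      using D[OF that] abs_triangle_ineq[of "a * l v" "m v"] by (simp add: abs_mult distrib_right mult.assoc)
  qed
  then have "\<exists>C. \<forall>v\<in>H1 \<Omega>. \<bar>a * l v + m v\<bar> \<le> C * H1_norm \<Omega> v" by blast
  with l m show ?thesis by (simp add: H1_dual_def distrib_left mult.left_commute)
qed

lemma H1_dual_zero: "(\<lambda>_. 0) \<in> H1_dual \<Omega>"
  by (auto simp: H1_dual_def intro!: exI[of _ 0])

lemma H1_dual_sum:
  "(\<And>c. c \<in> C \<Longrightarrow> l c \<in> H1_dual \<Omega>) \<Longrightarrow> (\<lambda>v. \<Sum>c\<in>C. a c * l c v) \<in> H1_dual \<Omega>"
  by (induction C rule: infinite_finite_induct) (simp_all add: H1_dual_zero H1_dual_lincomb)

lemma H1_dual_diff: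
  assumes "l \<in> H1_dual \<Omega>" "m \<in> H1_dual \<Omega>"
  shows "(\<lambda>v. l v - m v) \<in> H1_dual \<Omega>"
proof -
  have "(\<lambda>v. (-1) * m v + l v) \<in> H1_dual \<Omega>" by (rule H1_dual_lincomb[OF assms(2,1)])
  then show ?thesis by simp
qed

lemma H1_dual_norm_triangle:
  assumes \<Omega>: "open \<Omega>" and l: "l \<in> H1_dual \<Omega>" and m: "m \<in> H1_dual \<Omega>"
  shows "H1_dual_norm \<Omega> l \<le> H1_dual_norm \<Omega> m + H1_dual_norm \<Omega> (\<lambda>v. l v - m v)"
    and "H1_dual_norm \<Omega> (\<lambda>v. l v - m v) \<le> H1_dual_norm \<Omega> l + H1_dual_norm \<Omega> m"
    and "H1_dual_norm \<Omega> (\<lambda>v. l v - m v) = H1_dual_norm \<Omega> (\<lambda>v. m v - l v)"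
proof -
  note lm = H1_dual_diff[OF l m]
  note unit = H1_dual_unit_bound
  show "H1_dual_norm \<Omega> l \<le> H1_dual_norm \<Omega> m + H1_dual_norm \<Omega> (\<lambda>v. l v - m v)"
  proof (rule H1_dual_norm_leI[OF \<Omega>])
    fix v assume v: "v \<in> H1 \<Omega>" "H1_norm \<Omega> v \<le> 1"
    from unit[OF m v] unit[OF lm v]
    show "\<bar>l v\<bar> \<le> H1_dual_norm \<Omega> m + H1_dual_norm \<Omega> (\<lambda>v. l v - m v)" by linarith
  qed
  show "H1_dual_norm \<Omega> (\<lambda>v. l v - m v) \<le> H1_dual_norm \<Omega> l + H1_dual_norm \<Omega> m"
  proof (rule H1_dual_norm_leI[OF \<Omega>])
    fix v assume v: "v \<in> H1 \<Omega>" "H1_norm \<Omega> v \<le> 1"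
    from unit[OF m v] unit[OF l v]
    show "\<bar>l v - m v\<bar> \<le> H1_dual_norm \<Omega> l + H1_dual_norm \<Omega> m" by linarith
  qed
  show "H1_dual_norm \<Omega> (\<lambda>v. l v - m v) = H1_dual_norm \<Omega> (\<lambda>v. m v - l v)"
    unfolding H1_dual_norm_def by (simp add: abs_minus_commute)
qed

subsection \<open>Bochner measurability\<close>

lemma borel_measurable_AE_limit:
  fixes f :: "'a::euclidean_space \<Rightarrow> real"
  assumes "S \<in> sets lebesgue" "\<And>j::nat. g j \<in> borel_measurable (lebesgue_on S)"
    and "AE t in lebesgue_on S. (\<lambda>j. g j t) \<longlonglongrightarrow> f t"
  shows "f \<in> borel_measurable (lebesgue_on S)"
proof (rule borel_measurable_lebesgue_on_AE[OF assms(1)])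
  show "(\<lambda>t. lim (\<lambda>j. g j t)) \<in> borel_measurable (lebesgue_on S)"
    using assms(2) by (rule borel_measurable_lim_metric)
  show "AE t in lebesgue_on S. lim (\<lambda>j. g j t) = f t"
    using assms(3) by eventually_elim (rule limI)
qed

lemma simple_in_dual_measurable:
  assumes "simple_function M s"
  shows "(\<lambda>t. F (s t)) \<in> borel_measurable M"
  using simple_function_compose1[OF assms, of F]
  by (simp add: borel_measurable_simple_function)

text \<open>Between two simple functions the distance takes finitely many values and is measurable
  as a simple function. The reverse triangle inequality carries this over to the limit
  \<open>f\<close>.\<close>

lemma dual_distance_measurable:
  fixes S :: "real set"
  assumes \<Omega>: "open \<Omega>" and S: "S \<in> sets lebesgue"
    and f: "strongly_measurable_in (lebesgue_on S) (H1_dual \<Omega>) (H1_dual_norm \<Omega>) f"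
    and c: "simple_in (lebesgue_on S) (H1_dual \<Omega>) c"
  shows "(\<lambda>t. H1_dual_norm \<Omega> (\<lambda>v. f t v - c t v)) \<in> borel_measurable (lebesgue_on S)"
proof -
  obtain s where fX: "AE t in lebesgue_on S. f t \<in> H1_dual \<Omega>"
    and s: "\<And>k::nat. simple_in (lebesgue_on S) (H1_dual \<Omega>) (s k)"
    and lim: "AE t in lebesgue_on S. (\<lambda>k. H1_dual_norm \<Omega> (\<lambda>v. f t v - s k t v)) \<longlonglongrightarrow> 0"
    using f by (auto simp: strongly_measurable_in_def)
  have mem: "s k t \<in> H1_dual \<Omega>" "c t \<in> H1_dual \<Omega>" if "t \<in> S" for k t
    using s[of k] c that by (auto simp: simple_in_def)
  show ?thesis
  proof (rule borel_measurable_AE_limit[OF S])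
    show "(\<lambda>t. H1_dual_norm \<Omega> (\<lambda>v. s j t v - c t v)) \<in> borel_measurable (lebesgue_on S)" for j
      using simple_function_compose2[of "lebesgue_on S" "s j" c "\<lambda>a b. H1_dual_norm \<Omega> (\<lambda>v. a v - b v)"] s[of j] c
      by (intro borel_measurable_simple_function) (simp add: simple_in_def)
    have "AE t in lebesgue_on S. t \<in> S" using AE_space[of "lebesgue_on S"] by simp
    with fX lim
    show "AE t in lebesgue_on S. (\<lambda>j. H1_dual_norm \<Omega> (\<lambda>v. s j t v - c t v)) \<longlonglongrightarrow> H1_dual_norm \<Omega> (\<lambda>v. f t v - c t v)"
    proof eventually_elim
      case (elim t)
      have "norm (H1_dual_norm \<Omega> (\<lambda>v. s j t v - c t v) - H1_dual_norm \<Omega> (\<lambda>v. f t v - c t v)) \<le>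
          H1_dual_norm \<Omega> (\<lambda>v. f t v - s j t v)" for j
      proof -
        note fc = H1_dual_diff[OF elim(1) mem(2)[OF elim(3)]]
          and sc = H1_dual_diff[OF mem(1)[OF elim(3), of j] mem(2)[OF elim(3)]]
        show ?thesis
          using H1_dual_norm_triangle(1)[OF \<Omega> fc sc] H1_dual_norm_triangle(1)[OF \<Omega> sc fc]
            H1_dual_norm_triangle(3)[OF \<Omega> elim(1) mem(1)[OF elim(3), of j]]
          by (simp add: abs_le_iff)
      qed
      then have "(\<lambda>j. H1_dual_norm \<Omega> (\<lambda>v. s j t v - c t v) - H1_dual_norm \<Omega> (\<lambda>v. f t v - c t v)) \<longlonglongrightarrow> 0"
        by (intro Lim_null_comparison[OF _ elim(2)] always_eventually allI)
      then show ?case by (rule LIM_zero_cancel)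
    qed
  qed
qed

text \<open>The truncation of \<open>s\<^sub>k\<close> to the set where its norm is at most twice that of \<open>f\<close> makes dominated
  convergence applicable.\<close>

proposition dual_simple_approximation:
  fixes S :: "real set"
  assumes \<Omega>: "open \<Omega>" and S: "S \<in> sets lebesgue"
    and f: "f \<in> L2_in (lebesgue_on S) (H1_dual \<Omega>) (H1_dual_norm \<Omega>)" and e: "e > 0"
  obtains c where "simple_in (lebesgue_on S) (H1_dual \<Omega>) c"
    "integrable (lebesgue_on S) (\<lambda>t. (H1_dual_norm \<Omega> (\<lambda>v. f t v - c t v))\<^sup>2)"
    "(LINT t|lebesgue_on S. (H1_dual_norm \<Omega> (\<lambda>v. f t v - c t v))\<^sup>2) < e"
proof -
  \<comment> \<open>Integrability of the squared norm makes the square measurable; the root recovers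
    the norm itself, wherever that is nonnegative.\<close>
  define n where "n t = sqrt ((H1_dual_norm \<Omega> (f t))\<^sup>2)" for t
  have sm: "strongly_measurable_in (lebesgue_on S) (H1_dual \<Omega>) (H1_dual_norm \<Omega>) f"
    and int: "integrable (lebesgue_on S) (\<lambda>t. (H1_dual_norm \<Omega> (f t))\<^sup>2)"
    using f by (auto simp: L2_in_def)
  have n[measurable]: "n \<in> borel_measurable (lebesgue_on S)"
    unfolding n_def[abs_def] using int by measurable
  obtain s where fX: "AE t in lebesgue_on S. f t \<in> H1_dual \<Omega>"
    and s: "\<And>k::nat. simple_in (lebesgue_on S) (H1_dual \<Omega>) (s k)"
    and lim: "AE t in lebesgue_on S. (\<lambda>k. H1_dual_norm \<Omega> (\<lambda>v. f t v - s k t v)) \<longlonglongrightarrow> 0"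
    using sm by (auto simp: strongly_measurable_in_def)
  define c where "c k t = (if H1_dual_norm \<Omega> (s k t) \<le> 2 * n t then s k t else (\<lambda>_. 0))" for k t
  have c: "simple_in (lebesgue_on S) (H1_dual \<Omega>) (c k)" for k
  proof -
    have sk: "simple_function (lebesgue_on S) (s k)" using s[of k] by (simp add: simple_in_def)
    note [measurable] = simple_in_dual_measurable[OF sk, of "H1_dual_norm \<Omega>"]
    have "simple_function (lebesgue_on S) (c k)"
      unfolding c_def[abs_def] by (rule simple_function_If[OF sk simple_function_const]) measurable
    moreover have "c k ` space (lebesgue_on S) \<subseteq> H1_dual \<Omega>"
      using s[of k] H1_dual_zero by (auto simp: simple_in_def c_def)
    ultimately show ?thesis by (simp add: simple_in_def)
  qed
  have [measurable]: "(\<lambda>t. H1_dual_norm \<Omega> (\<lambda>v. f t v - c k t v)) \<in> borel_measurable (lebesgue_on S)" for k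
    by (rule dual_distance_measurable[OF \<Omega> S sm c])
  have S_AE: "AE t in lebesgue_on S. t \<in> S" using AE_space[of "lebesgue_on S"] by simp
  \<comment> \<open>The truncated function has norm at most 2 |f|, so the distance is at most 3 |f|,
    and 9 is the square of this factor.\<close>
  have bound: "AE t in lebesgue_on S. norm ((H1_dual_norm \<Omega> (\<lambda>v. f t v - c k t v))\<^sup>2) \<le> 9 * (H1_dual_norm \<Omega> (f t))\<^sup>2" for k
    using fX S_AE
  proof eventually_elim
    case (elim t)
    have ck: "c k t \<in> H1_dual \<Omega>" using c[of k] elim(2) by (auto simp: simple_in_def)
    have nf: "n t = H1_dual_norm \<Omega> (f t)" using H1_dual_norm_nonneg[OF \<Omega> elim(1)] by (simp add: n_def)
    have "H1_dual_norm \<Omega> (\<lambda>_. 0) \<le> 0" by (rule H1_dual_norm_leI[OF \<Omega>]) simp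
    then have "H1_dual_norm \<Omega> (c k t) \<le> 2 * n t"
      using H1_dual_norm_nonneg[OF \<Omega> elim(1)] nf by (auto simp: c_def)
    then have "H1_dual_norm \<Omega> (\<lambda>v. f t v - c k t v) \<le> 3 * H1_dual_norm \<Omega> (f t)"
      using H1_dual_norm_triangle(2)[OF \<Omega> elim(1) ck] nf by simp
    then have "(H1_dual_norm \<Omega> (\<lambda>v. f t v - c k t v))\<^sup>2 \<le> (3 * H1_dual_norm \<Omega> (f t))\<^sup>2"
      using H1_dual_norm_nonneg[OF \<Omega> H1_dual_diff[OF elim(1) ck]] by (intro power_mono)
    then show ?case by (simp add: power_mult_distrib)
  qed
  have "(\<lambda>k. LINT t|lebesgue_on S. (H1_dual_norm \<Omega> (\<lambda>v. f t v - c k t v))\<^sup>2) \<longlonglongrightarrow> (LINT t|lebesgue_on S. 0)"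
  proof (rule integral_dominated_convergence[OF _ _ _ _ bound])
    show "AE t in lebesgue_on S. (\<lambda>k. (H1_dual_norm \<Omega> (\<lambda>v. f t v - c k t v))\<^sup>2) \<longlonglongrightarrow> 0"
      using fX S_AE lim
    proof eventually_elim
      case (elim t)
      have nf: "n t = H1_dual_norm \<Omega> (f t)" using H1_dual_norm_nonneg[OF \<Omega> elim(1)] by (simp add: n_def)
      have sk: "s k t \<in> H1_dual \<Omega>" for k using s[of k] elim(2) by (auto simp: simple_in_def)
      have "(\<lambda>k. H1_dual_norm \<Omega> (\<lambda>v. f t v - c k t v)) \<longlonglongrightarrow> 0"
      \<comment> \<open>Where \<open>f\<close> has norm 0 the truncation may stay active for all k,
        but then it replaces \<open>s k\<close> by zero, whose distance to \<open>f\<close> is 0.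
        Elsewhere the distance eventually drops below |f|, so that \<open>s k\<close> has norm at
        most 2 |f| and is kept.\<close>
      proof (cases "H1_dual_norm \<Omega> (f t) = 0")
        case True
        have "H1_dual_norm \<Omega> (\<lambda>v. f t v - c k t v) \<le> H1_dual_norm \<Omega> (\<lambda>v. f t v - s k t v)" for k
          using True H1_dual_norm_nonneg[OF \<Omega> H1_dual_diff[OF elim(1) sk[of k]]] by (simp add: c_def)
        moreover have "0 \<le> H1_dual_norm \<Omega> (\<lambda>v. f t v - c k t v)" for k
          using c[of k] elim(2) by (intro H1_dual_norm_nonneg[OF \<Omega> H1_dual_diff[OF elim(1)]]) (auto simp: simple_in_def)
        ultimately show ?thesis
          by (intro Lim_null_comparison[OF _ elim(3)] always_eventually allI) simp
      next
        case False
        then have "H1_dual_norm \<Omega> (f t) > 0" using H1_dual_norm_nonneg[OF \<Omega> elim(1)] by simp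
        from order_tendstoD(2)[OF elim(3) this]
        have "\<forall>\<^sub>F k in sequentially. H1_dual_norm \<Omega> (\<lambda>v. f t v - s k t v) = H1_dual_norm \<Omega> (\<lambda>v. f t v - c k t v)"
        proof eventually_elim
          case (elim k)
          then have "H1_dual_norm \<Omega> (s k t) \<le> 2 * n t"
            using H1_dual_norm_triangle(1)[OF \<Omega> sk[of k] \<open>f t \<in> H1_dual \<Omega>\<close>]
              H1_dual_norm_triangle(3)[OF \<Omega> sk[of k] \<open>f t \<in> H1_dual \<Omega>\<close>] nf by simp
          then show ?case by (simp add: c_def)
        qed
        with elim(3) show ?thesis by (rule Lim_transform_eventually)
      qed
      from tendsto_power[OF this, of 2] show ?case by simp
    qed
  qed (use int in auto)
  then have "(\<lambda>k. LINT t|lebesgue_on S. (H1_dual_norm \<Omega> (\<lambda>v. f t v - c k t v))\<^sup>2) \<longlonglongrightarrow> 0" by simp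
  from eventually_happens[OF order_tendstoD(2)[OF this e]]
  obtain k where k: "(LINT t|lebesgue_on S. (H1_dual_norm \<Omega> (\<lambda>v. f t v - c k t v))\<^sup>2) < e" by auto
  have "integrable (lebesgue_on S) (\<lambda>t. (H1_dual_norm \<Omega> (\<lambda>v. f t v - c k t v))\<^sup>2)"
    by (rule Bochner_Integration.integrable_bound[of _ "\<lambda>t. 9 * (H1_dual_norm \<Omega> (f t))\<^sup>2"])
      (use int bound[of k] in auto)
  with c k that show ?thesis by blast
qed

text \<open>For a simple functional-valued function the pairing is a finite sum of indicators times
  c(w(t)), so measurability of \<open>w\<close> is needed only after applying a fixed functional.
  Convergence in the dual norm gives convergence of the pairing at almost every t.\<close>

lemma strongly_measurable_dual_apply:
  fixes S :: "real set"
  assumes \<Omega>: "open \<Omega>" and S: "S \<in> sets lebesgue"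
    and f: "strongly_measurable_in (lebesgue_on S) (H1_dual \<Omega>) (H1_dual_norm \<Omega>) f"
    and w: "AE t in lebesgue_on S. w t \<in> H1 \<Omega>"
    and wm: "\<And>c. c \<in> H1_dual \<Omega> \<Longrightarrow> (\<lambda>t. c (w t)) \<in> borel_measurable (lebesgue_on S)"
  shows "(\<lambda>t. f t (w t)) \<in> borel_measurable (lebesgue_on S)"
proof -
  obtain s where fX: "AE t in lebesgue_on S. f t \<in> H1_dual \<Omega>"
    and s: "\<And>k::nat. simple_in (lebesgue_on S) (H1_dual \<Omega>) (s k)"
    and lim: "AE t in lebesgue_on S. (\<lambda>k. H1_dual_norm \<Omega> (\<lambda>v. f t v - s k t v)) \<longlonglongrightarrow> 0"
    using f by (auto simp: strongly_measurable_in_def)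
  have S_AE: "AE t in lebesgue_on S. t \<in> S" using AE_space[of "lebesgue_on S"] by simp
  have mem: "s k t \<in> H1_dual \<Omega>" if "t \<in> S" for k t
    using s[of k] that by (auto simp: simple_in_def)
  show ?thesis
  proof (rule borel_measurable_AE_limit[OF S])
    show "(\<lambda>t. s k t (w t)) \<in> borel_measurable (lebesgue_on S)" for k
    proof -
      have sf: "simple_function (lebesgue_on S) (s k)" using s[of k] by (simp add: simple_in_def)
      have fin: "finite (s k ` S)" using simple_functionD(1)[OF sf] by simp
      have "(\<lambda>t. \<Sum>c\<in>s k ` S. indicator {t \<in> S. s k t = c} t * c (w t)) \<in> borel_measurable (lebesgue_on S)"
      proof (intro borel_measurable_sum borel_measurable_times borel_measurable_indicator)
        show "{t \<in> S. s k t = c} \<in> sets (lebesgue_on S)" for c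
          using simple_functionD(2)[OF sf, of "{c}"] by (simp add: vimage_def Int_def conj_commute)
        show "(\<lambda>t. c (w t)) \<in> borel_measurable (lebesgue_on S)" if "c \<in> s k ` S" for c
          using that mem by (intro wm) auto
      qed
      then show ?thesis
      proof (rule measurable_cong[THEN iffD1, rotated])
        fix t assume t: "t \<in> space (lebesgue_on S)"
        have "(\<Sum>c\<in>s k ` S. indicator {t \<in> S. s k t = c} t * c (w t)) = (\<Sum>c\<in>s k ` S. if c = s k t then c (w t) else 0)"
          using t by (intro sum.cong) auto
        then show "(\<Sum>c\<in>s k ` S. indicator {t \<in> S. s k t = c} t * c (w t)) = s k t (w t)"
          using fin t by simp
      qed
    qed
    show "AE t in lebesgue_on S. (\<lambda>k. s k t (w t)) \<longlonglongrightarrow> f t (w t)"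
      using fX lim S_AE w
    proof eventually_elim
      case (elim t)
      have "(\<lambda>k. s k t (w t) - f t (w t)) \<longlonglongrightarrow> 0"
      proof (rule Lim_null_comparison)
        show "(\<lambda>k. H1_dual_norm \<Omega> (\<lambda>v. f t v - s k t v) * H1_norm \<Omega> (w t)) \<longlonglongrightarrow> 0"
          by (rule tendsto_mult_left_zero[OF elim(2)])
        show "\<forall>\<^sub>F k in sequentially. norm (s k t (w t) - f t (w t)) \<le> H1_dual_norm \<Omega> (\<lambda>v. f t v - s k t v) * H1_norm \<Omega> (w t)"
          using H1_dual_bound[OF \<Omega> H1_dual_diff[OF elim(1) mem[OF elim(3)]] elim(4)]
          by (intro always_eventually allI) (simp add: abs_minus_commute)
      qed
      then show ?case by (rule LIM_zero_cancel)
    qed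
  qed
qed

text \<open>Evaluation at a fixed \<open>v\<close> is linear and bounded, so it commutes with the
  vector-valued integral: exactly for simple functions, then by passing to the limit on both sides.
  This reduces the weak time derivative in the dual to scalar weak derivatives.\<close>

lemma has_integral_in_dual_evaluate:
  fixes S :: "real set"
  assumes \<Omega>: "open \<Omega>" and S: "S \<in> lmeasurable" and v: "v \<in> H1 \<Omega>"
    and y: "has_integral_in (lebesgue_on S) (H1_dual \<Omega>) (H1_dual_norm \<Omega>) F y"
  shows "integrable (lebesgue_on S) (\<lambda>t. F t v)" "(LINT t|lebesgue_on S. F t v) = y v"
proof -
  have Sl: "S \<in> sets lebesgue" using S by (simp add: fmeasurableD)
  obtain s where FX: "AE t in lebesgue_on S. F t \<in> H1_dual \<Omega>" and yX: "y \<in> H1_dual \<Omega>"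
    and sm: "strongly_measurable_in (lebesgue_on S) (H1_dual \<Omega>) (H1_dual_norm \<Omega>) F"
    and s: "\<And>k::nat. simple_in (lebesgue_on S) (H1_dual \<Omega>) (s k)"
    and L1: "(\<lambda>k. \<integral>\<^sup>+ t. ennreal (H1_dual_norm \<Omega> (\<lambda>v. F t v - s k t v)) \<partial>lebesgue_on S) \<longlonglongrightarrow> 0"
    and conv: "(\<lambda>k. H1_dual_norm \<Omega> (\<lambda>v. simple_integral_in (lebesgue_on S) (s k) v - y v)) \<longlonglongrightarrow> 0"
    using y by (auto simp: has_integral_in_def strongly_measurable_in_def)
  have S_AE: "AE t in lebesgue_on S. t \<in> S" using AE_space[of "lebesgue_on S"] by simp
  have mem: "s k t \<in> H1_dual \<Omega>" if "t \<in> S" for k t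
    using s[of k] that by (auto simp: simple_in_def)
  have fin: "finite_measure (lebesgue_on S)"
    using S by (simp add: finite_measure_lebesgue_on)
  have Fv: "(\<lambda>t. F t v) \<in> borel_measurable (lebesgue_on S)"
    by (rule strongly_measurable_dual_apply[OF \<Omega> Sl sm]) (use v in simp_all)
  have sv: "integrable (lebesgue_on S) (\<lambda>t. s k t v)" "(LINT t|lebesgue_on S. s k t v) = simple_integral_in (lebesgue_on S) (s k) v" for k
  proof -
    have sf: "simple_function (lebesgue_on S) (s k)" using s[of k] by (simp add: simple_in_def)
    have f: "finite (s k ` S)" using simple_functionD(1)[OF sf] by simp
    have meas: "{t \<in> S. s k t = c} \<in> sets (lebesgue_on S)" for c
    proof -
      have "s k -` {c} \<inter> space (lebesgue_on S) \<in> sets (lebesgue_on S)"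
        by (rule simple_functionD(2)[OF sf])
      moreover have "s k -` {c} \<inter> space (lebesgue_on S) = {t \<in> S. s k t = c}" by auto
      ultimately show ?thesis by simp
    qed
    have i: "integrable (lebesgue_on S) (\<lambda>t. indicator {t \<in> S. s k t = c} t * c v)" for c
      using meas[of c] finite_measure.emeasure_finite[OF fin, of "{t \<in> S. s k t = c}"]
      by (intro integrable_mult_left integrable_real_indicator) (auto simp: less_top[symmetric])
    have eq: "s k t v = (\<Sum>c\<in>s k ` S. indicator {t \<in> S. s k t = c} t * c v)" if "t \<in> S" for t
    proof -
      have "(\<Sum>c\<in>s k ` S. indicator {t \<in> S. s k t = c} t * c v) = (\<Sum>c\<in>s k ` S. if c = s k t then c v else 0)"
        using that by (intro sum.cong) auto
      then show ?thesis using f that by simp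
    qed
    have "integrable (lebesgue_on S) (\<lambda>t. \<Sum>c\<in>s k ` S. indicator {t \<in> S. s k t = c} t * c v)"
      by (intro Bochner_Integration.integrable_sum i)
    then show "integrable (lebesgue_on S) (\<lambda>t. s k t v)"
      by (rule Bochner_Integration.integrable_cong[THEN iffD1, rotated 2]) (auto simp: eq)
    have "(LINT t|lebesgue_on S. s k t v) = (LINT t|lebesgue_on S. (\<Sum>c\<in>s k ` S. indicator {t \<in> S. s k t = c} t * c v))"
      by (rule Bochner_Integration.integral_cong) (auto simp: eq)
    also have "\<dots> = (\<Sum>c\<in>s k ` S. (LINT t|lebesgue_on S. indicator {t \<in> S. s k t = c} t * c v))"
      by (intro Bochner_Integration.integral_sum i)
    also have "\<dots> = simple_integral_in (lebesgue_on S) (s k) v"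
      by (auto simp: simple_integral_in_def Int_def intro!: sum.cong arg_cong[where f = "measure _"])
    finally show "(LINT t|lebesgue_on S. s k t v) = simple_integral_in (lebesgue_on S) (s k) v" .
  qed
  define \<delta> where "\<delta> k = (\<integral>\<^sup>+ t. ennreal \<bar>F t v - s k t v\<bar> \<partial>lebesgue_on S)" for k
  have \<delta>le: "\<delta> k \<le> ennreal (H1_norm \<Omega> v) * (\<integral>\<^sup>+ t. ennreal (H1_dual_norm \<Omega> (\<lambda>v. F t v - s k t v)) \<partial>lebesgue_on S)" for k
  proof -
    have "\<delta> k \<le> (\<integral>\<^sup>+ t. ennreal (H1_norm \<Omega> v) * ennreal (H1_dual_norm \<Omega> (\<lambda>v. F t v - s k t v)) \<partial>lebesgue_on S)"
      unfolding \<delta>_def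
    proof (rule nn_integral_mono_AE)
      show "AE t in lebesgue_on S. ennreal \<bar>F t v - s k t v\<bar> \<le>
          ennreal (H1_norm \<Omega> v) * ennreal (H1_dual_norm \<Omega> (\<lambda>v. F t v - s k t v))"
        using FX S_AE
      proof eventually_elim
        case (elim t)
        show ?case
          using H1_dual_bound[OF \<Omega> H1_dual_diff[OF elim(1) mem[OF elim(2), of k]] v] H1_norm_nonneg[of \<Omega> v]
          by (subst ennreal_mult'[symmetric]) (auto simp: mult.commute intro!: ennreal_leI)
      qed
    qed
    also have "\<dots> = ennreal (H1_norm \<Omega> v) * (\<integral>\<^sup>+ t. ennreal (H1_dual_norm \<Omega> (\<lambda>v. F t v - s k t v)) \<partial>lebesgue_on S)"
      using dual_distance_measurable[OF \<Omega> Sl sm s[of k]] by (intro nn_integral_cmult) measurable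
    finally show ?thesis .
  qed
  have "(\<lambda>k. ennreal (H1_norm \<Omega> v) * (\<integral>\<^sup>+ t. ennreal (H1_dual_norm \<Omega> (\<lambda>v. F t v - s k t v)) \<partial>lebesgue_on S))
      \<longlonglongrightarrow> ennreal (H1_norm \<Omega> v) * 0"
    by (rule ennreal_tendsto_cmult[OF _ L1]) simp
  then have "\<delta> \<longlonglongrightarrow> 0"
    by (intro tendsto_sandwich[OF _ _ tendsto_const[of 0] _, of \<delta>]) (auto intro!: always_eventually \<delta>le)
  then have \<delta>0: "\<delta> \<longlonglongrightarrow> 0" .
  then have "\<forall>\<^sub>F k in sequentially. \<delta> k < 1" by (rule order_tendstoD(2)) simp
  then obtain k0 where k0: "\<delta> k0 < 1" using eventually_happens by fastforce
  \<comment> \<open>One approximant at finite L^1 distance suffices for integrability: the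
    difference is integrable, and so is the simple function added back.\<close>
  have "integrable (lebesgue_on S) (\<lambda>t. F t v - s k0 t v)"
    using Fv borel_measurable_integrable[OF sv(1)[of k0]] k0 order_less_trans[OF k0 ennreal_one_less_top]
    by (intro integrableI_bounded) (auto simp: \<delta>_def)
  from Bochner_Integration.integrable_add[OF this sv(1)[of k0]]
  show intF: "integrable (lebesgue_on S) (\<lambda>t. F t v)" by simp
  have "(\<lambda>k. simple_integral_in (lebesgue_on S) (s k) v) \<longlonglongrightarrow> (LINT t|lebesgue_on S. F t v)"
  proof -
    have "(\<lambda>k. LINT t|lebesgue_on S. s k t v) \<longlonglongrightarrow> (LINT t|lebesgue_on S. F t v)"
    proof (rule tendsto_L1_int[OF sv(1) intF])
      have "(\<integral>\<^sup>+ t. ennreal (norm (s k t v - F t v)) \<partial>lebesgue_on S) = \<delta> k" for k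
        by (simp add: \<delta>_def abs_minus_commute)
      then show "(\<lambda>k. \<integral>\<^sup>+ t. ennreal (norm (s k t v - F t v)) \<partial>lebesgue_on S) \<longlonglongrightarrow> 0"
        using \<delta>0 by (simp only:)
    qed
    then show ?thesis by (simp only: sv(2))
  qed
  moreover have "(\<lambda>k. simple_integral_in (lebesgue_on S) (s k) v) \<longlonglongrightarrow> y v"
  proof (rule LIM_zero_cancel, rule Lim_null_comparison)
    have X: "(\<lambda>v. simple_integral_in (lebesgue_on S) (s k) v) \<in> H1_dual \<Omega>" for k
      unfolding simple_integral_in_def by (rule H1_dual_sum) (use s[of k] in \<open>auto simp: simple_in_def\<close>)
    show "\<forall>\<^sub>F k in sequentially. norm (simple_integral_in (lebesgue_on S) (s k) v - y v) \<le>
        H1_dual_norm \<Omega> (\<lambda>v. simple_integral_in (lebesgue_on S) (s k) v - y v) * H1_norm \<Omega> v"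
      using H1_dual_bound[OF \<Omega> H1_dual_diff[OF X yX] v] by (intro always_eventually allI) simp
    show "(\<lambda>k. H1_dual_norm \<Omega> (\<lambda>v. simple_integral_in (lebesgue_on S) (s k) v - y v) * H1_norm \<Omega> v) \<longlonglongrightarrow> 0"
      by (rule tendsto_mult_left_zero[OF conv])
  qed
  ultimately show "(LINT t|lebesgue_on S. F t v) = y v" by (rule LIMSEQ_unique)
qed

subsection \<open>Averages over short intervals\<close>

text \<open>With \<open>\<delta> = 0\<close> or \<open>\<delta> = 1\<close>, the interval \<open>{t - \<delta> * h..t - \<delta> * h + h}\<close> lies to the right or to the left of \<open>t\<close>.\<close>

lemma integrable_lebesgue_imp_interval:
  fixes g :: "real \<Rightarrow> real"
  assumes "integrable lebesgue g"
  shows "g integrable_on {a..b}" "integrable (lebesgue_on {a..b}) g"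
proof -
  have "set_integrable lebesgue UNIV g" using assms by (simp add: set_integrable_def)
  then have ai: "g absolutely_integrable_on {a..b}"
    by (rule set_integrable_subset) auto
  show "g integrable_on {a..b}" using ai by (rule set_lebesgue_integral_eq_integral(1))
  show "integrable (lebesgue_on {a..b}) g" using ai by (rule absolutely_integrable_imp_integrable) simp
qed

lemma integral_translate_interval:
  fixes f :: "real \<Rightarrow> real"
  assumes "f integrable_on {a + c..b + c}"
  shows "integral {a..b} (\<lambda>t. f (t + c)) = integral {a + c..b + c} f"
  using has_integral_affinity'[of f "integral {a + c..b + c} f" "a + c" "b + c" 1 c] assms
  by (auto simp: integral_unique integrable_integral)

text \<open>The integrals over [a+h,b+h] and [a,b] share their common part and leave only the two
  end pieces of length h, whether or not h exceeds b - a.\<close>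

lemma integral_increments:
  fixes R :: "real \<Rightarrow> real"
  assumes "continuous_on {a..b + h} R" "a \<le> b" "0 \<le> h"
  shows "integral {a..b} (\<lambda>t. R (t + h) - R t) = integral {b..b + h} R - integral {a..a + h} R"
proof -
  have c1: "continuous_on {a + h..b + h} R" and c2: "continuous_on {a..b} R"
    using assms by (auto intro: continuous_on_subset)
  have c3: "continuous_on {a..b} (\<lambda>t. R (t + h))"
    by (rule continuous_on_compose2[OF c1]) (auto intro!: continuous_intros)
  have int: "R integrable_on {a..b + h}" using assms(1) by (rule integrable_continuous_real)
  have "integral {a..b} (\<lambda>t. R (t + h) - R t) = integral {a..b} (\<lambda>t. R (t + h)) - integral {a..b} R"
    by (intro integral_diff integrable_continuous_real c2 c3)
  also have "integral {a..b} (\<lambda>t. R (t + h)) = integral {a + h..b + h} R"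
    by (intro integral_translate_interval integrable_continuous_real c1)
  finally have "integral {a..b} (\<lambda>t. R (t + h) - R t) = integral {a + h..b + h} R - integral {a..b} R" .
  moreover have "integral {a..a + h} R + integral {a + h..b + h} R = integral {a..b + h} R"
    by (rule Henstock_Kurzweil_Integration.integral_combine[OF _ _ int]) (use assms in auto)
  moreover have "integral {a..b} R + integral {b..b + h} R = integral {a..b + h} R"
    by (rule Henstock_Kurzweil_Integration.integral_combine[OF _ _ int]) (use assms in auto)
  ultimately show ?thesis by linarith
qed

text \<open>Cubes with the point as lower corner are intervals to the right of t, which settles
  \<delta> = 0. For \<delta> = 1 the same result is applied to the reflected function x ->
  \<phi>(-x), since reflection preserves Lebesgue measure.\<close>

lemma average_tendsto_AE:
  fixes \<phi> :: "real \<Rightarrow> real"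
  assumes \<phi>: "integrable lebesgue \<phi>" and h: "\<And>n. h n > 0" "h \<longlonglongrightarrow> 0" and \<delta>: "\<delta> = 0 \<or> \<delta> = 1"
  shows "AE t in lebesgue. (\<lambda>n. integral {t - \<delta> * h n..t - \<delta> * h n + h n} \<phi> / h n) \<longlonglongrightarrow> \<phi> t"
proof -
  have forward: "AE t in lebesgue. (\<lambda>n. integral {t..t + h n} g / h n) \<longlonglongrightarrow> g t"
    if "\<And>a b. g integrable_on {a..b}" for g :: "real \<Rightarrow> real"
  proof -
    have "g integrable_on cbox a b" for a b using that by simp
    then obtain N where N: "negligible N" and lim: "\<And>x e. \<lbrakk>x \<notin> N; 0 < e\<rbrakk> \<Longrightarrow>
        \<exists>d>0. \<forall>h. 0 < h \<and> h < d \<longrightarrow>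
          norm (integral (cbox x (x + h *\<^sub>R One)) g /\<^sub>R h ^ DIM(real) - g x) < e"
      by (rule integrable_ccontinuous_explicit) blast
    have "(\<lambda>n. integral {t..t + h n} g / h n) \<longlonglongrightarrow> g t" if "t \<notin> N" for t
    proof (rule LIMSEQ_I)
      fix e :: real assume "e > 0"
      with lim[OF that] obtain d where d: "d > 0"
        "\<And>h. 0 < h \<Longrightarrow> h < d \<Longrightarrow> norm (integral (cbox t (t + h *\<^sub>R One)) g /\<^sub>R h ^ DIM(real) - g t) < e"
        by blast
      obtain n0 where n0: "\<And>n. n \<ge> n0 \<Longrightarrow> h n < d"
        using order_tendstoD(2)[OF h(2) d(1)] by (auto simp: eventually_sequentially)
      show "\<exists>no. \<forall>n\<ge>no. norm (integral {t..t + h n} g / h n - g t) < e"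
      proof (intro exI allI impI)
        fix n assume "n \<ge> n0"
        from d(2)[OF h(1) n0[OF this]] show "norm (integral {t..t + h n} g / h n - g t) < e"
          by (simp add: divide_inverse mult.commute)
      qed
    qed
    then show ?thesis
      using N by (intro AE_I'[of N]) (auto simp: negligible_iff_null_sets)
  qed
  from \<delta> show ?thesis
  proof
    assume "\<delta> = 0"
    with forward[of \<phi>] integrable_lebesgue_imp_interval(1)[OF \<phi>] show ?thesis by simp
  next
    assume d: "\<delta> = 1"
    have refl: "(\<lambda>x. \<phi> (- x)) integrable_on {a..b}" for a b
      using integrable_lebesgue_imp_interval(1)[OF \<phi>, of "-b" "-a"]
      by (simp add: Henstock_Kurzweil_Integration.integrable_reflect_real[of \<phi> "-a" "-b", simplified])
    have "AE t in lborel. (\<lambda>n. integral {t..t + h n} (\<lambda>x. \<phi> (- x)) / h n) \<longlonglongrightarrow> \<phi> (- t)"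
      using forward[OF refl] by (simp add: AE_completion_iff)
    then have "AE t in distr lborel borel uminus. (\<lambda>n. integral {t..t + h n} (\<lambda>x. \<phi> (- x)) / h n) \<longlonglongrightarrow> \<phi> (- t)"
      by (simp only: lborel_distr_uminus)
    then have "AE t in lborel. (\<lambda>n. integral {- t..- t + h n} (\<lambda>x. \<phi> (- x)) / h n) \<longlonglongrightarrow> \<phi> (- (- t))"
      by (rule AE_distrD[rotated]) simp
    then have "AE t in lborel. (\<lambda>n. integral {t - \<delta> * h n..t - \<delta> * h n + h n} \<phi> / h n) \<longlonglongrightarrow> \<phi> t"
    proof eventually_elim
      case (elim t)
      have "integral {- t..- t + r} (\<lambda>x. \<phi> (- x)) = integral {t - r..t} \<phi>" for r
        using Henstock_Kurzweil_Integration.integral_reflect_real[of t "t - r" \<phi>] by (simp add: add.commute)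
      with elim show ?case by (simp add: d)
    qed
    then show ?thesis by (simp add: AE_completion_iff)
  qed
qed

text \<open>The limits at the prescribed points a and b are needed, where an almost everywhere
  statement does not help; continuity takes its place.\<close>

lemma average_tendsto_continuous:
  fixes f :: "real \<Rightarrow> real"
  assumes f: "continuous_on {0..T} f" and x: "0 < x" "x < T"
    and h: "\<And>n. h n > 0" "h \<longlonglongrightarrow> 0" and \<delta>: "\<delta> = 0 \<or> \<delta> = 1"
  shows "(\<lambda>n. integral {x - \<delta> * h n..x - \<delta> * h n + h n} f / h n) \<longlonglongrightarrow> f x"
proof (rule LIMSEQ_I)
  fix e :: real assume "e > 0"
  obtain d where d: "d > 0" "\<And>y. y \<in> {0..T} \<Longrightarrow> dist y x < d \<Longrightarrow> dist (f y) (f x) < e / 2"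
    using f x \<open>e > 0\<close> unfolding continuous_on_iff by (metis atLeastAtMost_iff half_gt_zero less_imp_le)
  define m where "m = min d (min x (T - x))"
  have "m > 0" using d x by (simp add: m_def)
  from order_tendstoD(2)[OF h(2) this]
  obtain n0 where n0: "\<And>n. n \<ge> n0 \<Longrightarrow> h n < m" by (auto simp: eventually_sequentially)
  show "\<exists>no. \<forall>n\<ge>no. norm (integral {x - \<delta> * h n..x - \<delta> * h n + h n} f / h n - f x) < e"
  proof (intro exI allI impI)
    fix n assume "n \<ge> n0"
    let ?J = "{x - \<delta> * h n..x - \<delta> * h n + h n}"
    have near: "y \<in> {0..T} \<and> dist y x < d" if "y \<in> ?J" for y
      using that \<delta> n0[OF \<open>n \<ge> n0\<close>] h(1)[of n] by (auto simp: m_def dist_real_def abs_if)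
    have int: "f integrable_on ?J"
      using near by (intro integrable_continuous_real continuous_on_subset[OF f]) blast
    have c: "((\<lambda>y. f x) has_integral h n *\<^sub>R f x) ?J"
      using has_integral_const_real[of "f x" "x - \<delta> * h n" "x - \<delta> * h n + h n"] h(1)[of n] by simp
    have hi: "((\<lambda>y. f y - f x) has_integral integral ?J f - h n *\<^sub>R f x) ?J"
      by (intro has_integral_diff integrable_integral int c)
    have "norm (integral ?J f - h n *\<^sub>R f x) \<le> e / 2 * measure lborel ?J"
    proof (rule has_integral_bound_real[OF _ finite.emptyI hi])
      fix y assume "y \<in> ?J - {}"
      with near[of y] d(2)[of y] show "norm (f y - f x) \<le> e / 2"
        unfolding dist_real_def by simp
    qed (use \<open>e > 0\<close> in simp)
    then have "\<bar>integral ?J f - h n * f x\<bar> \<le> e / 2 * h n" using h(1)[of n] by simp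
    moreover have "integral ?J f / h n - f x = (integral ?J f - h n * f x) / h n"
      using h(1)[of n] by (simp add: diff_divide_distrib)
    ultimately have "\<bar>integral ?J f / h n - f x\<bar> \<le> e / 2"
      using h(1)[of n] by (simp add: abs_divide divide_le_eq)
    then show "norm (integral ?J f / h n - f x) < e" using \<open>e > 0\<close> by simp
  qed
qed

text \<open>Integrated over [a,b], the difference quotients telescope to the average of
  \<open>Q\<close> near b minus its average near a. The smallness conditions keep these averages
  within [0,T] for either value of \<delta>.\<close>

lemma increments_average_tendsto:
  fixes Q :: "real \<Rightarrow> real"
  assumes Q: "continuous_on {0..T} Q" and ab: "0 < a" "a < b" "b < T"
    and h: "\<And>n. h n > 0" "h \<longlonglongrightarrow> 0" and \<delta>: "\<delta> = 0 \<or> \<delta> = 1"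
    and small: "\<And>n. h n < a" "\<And>n. h n < T - b"
  shows "(\<lambda>n. integral {a..b} (\<lambda>t. (Q (t - \<delta> * h n + h n) - Q (t - \<delta> * h n)) / h n)) \<longlonglongrightarrow> Q b - Q a"
proof -
  have eq: "integral {a..b} (\<lambda>t. (Q (t - \<delta> * h n + h n) - Q (t - \<delta> * h n)) / h n) =
      integral {b - \<delta> * h n..b - \<delta> * h n + h n} Q / h n - integral {a - \<delta> * h n..a - \<delta> * h n + h n} Q / h n" for n
  proof -
    define R where "R t = Q (t + - (\<delta> * h n))" for t
    have cR: "continuous_on {a..b + h n} R"
      unfolding R_def using \<delta> small[of n] h(1)[of n] ab
      by (intro continuous_on_compose2[OF Q]) (auto intro!: continuous_intros)
    have shift: "integral {x..x + h n} R = integral {x - \<delta> * h n..x - \<delta> * h n + h n} Q" if "x = a \<or> x = b" for x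
    proof -
      have "Q integrable_on {x + - (\<delta> * h n)..x + h n + - (\<delta> * h n)}"
        using \<delta> small[of n] h(1)[of n] ab that by (intro integrable_continuous_real continuous_on_subset[OF Q]) auto
      from integral_translate_interval[OF this] show ?thesis
        by (simp add: R_def[abs_def] algebra_simps)
    qed
    have "integral {a..b} (\<lambda>t. (R (t + h n) - R t) / h n) = integral {a..b} (\<lambda>t. R (t + h n) - R t) / h n"
      by simp
    also have "integral {a..b} (\<lambda>t. R (t + h n) - R t) = integral {b..b + h n} R - integral {a..a + h n} R"
      using ab h(1)[of n] by (intro integral_increments cR) auto
    finally show ?thesis
      by (simp add: shift diff_divide_distrib) (simp add: R_def algebra_simps)
  qed
  show ?thesis
    unfolding eq by (intro tendsto_diff average_tendsto_continuous[OF Q _ _ h \<delta>]) (use ab in auto)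
qed

text \<open>The averages of \<phi> are bounded by 1 and converge almost everywhere, so |W|
  dominates. This is the passage to the diagonal for a single product \<phi>(r) W(t).\<close>

lemma weighted_average_tendsto:
  fixes \<phi> W :: "real \<Rightarrow> real"
  assumes \<phi>: "integrable lebesgue \<phi>" "\<And>r. \<bar>\<phi> r\<bar> \<le> 1" and W: "integrable lebesgue W"
    and h: "\<And>n. h n > 0" "h \<longlonglongrightarrow> 0" and \<delta>: "\<delta> = 0 \<or> \<delta> = 1" and ab: "a \<le> b"
  shows "\<And>n. integrable (lebesgue_on {a..b}) (\<lambda>t. W t * (integral {t - \<delta> * h n..t - \<delta> * h n + h n} \<phi> / h n))"
    and "integrable (lebesgue_on {a..b}) (\<lambda>t. W t * \<phi> t)"
    and "(\<lambda>n. LINT t|lebesgue_on {a..b}. W t * (integral {t - \<delta> * h n..t - \<delta> * h n + h n} \<phi> / h n))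
      \<longlonglongrightarrow> (LINT t|lebesgue_on {a..b}. W t * \<phi> t)"
proof -
  define m where "m n t = integral {t - \<delta> * h n..t - \<delta> * h n + h n} \<phi> / h n" for n t
  note Wi = integrable_lebesgue_imp_interval(2)[OF W, of a b]
  note \<phi>i = integrable_lebesgue_imp_interval(1)[OF \<phi>(1)]
  have m1: "\<bar>m n t\<bar> \<le> 1" for n t
  proof -
    have "norm (integral {t - \<delta> * h n..t - \<delta> * h n + h n} \<phi>) \<le> 1 * measure lborel {t - \<delta> * h n..t - \<delta> * h n + h n}"
      by (rule has_integral_bound_real[OF _ finite.emptyI integrable_integral[OF \<phi>i]]) (use \<phi>(2) in auto)
    then show ?thesis using h(1)[of n] by (simp add: m_def abs_divide)
  qed
  have m_meas: "m n \<in> borel_measurable (lebesgue_on {a..b})" for n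
  proof -
    \<comment> \<open>Measurability in t comes from writing averages as increments of a continuous
      primitive; starting it at a - h leaves room for the averages to the left of a.\<close>
    define A where "A = a - h n"
    define P where "P t = integral {A..t} \<phi>" for t
    have cP: "continuous_on {A..b + h n} P"
      unfolding P_def by (rule indefinite_integral_continuous_1[OF \<phi>i])
    have "m n t = (P (t - \<delta> * h n + h n) - P (t - \<delta> * h n)) / h n" if "t \<in> {a..b}" for t
    proof -
      have "P (t - \<delta> * h n) + integral {t - \<delta> * h n..t - \<delta> * h n + h n} \<phi> = P (t - \<delta> * h n + h n)"
        unfolding P_def
        by (rule Henstock_Kurzweil_Integration.integral_combine[OF _ _ \<phi>i]) (use that \<delta> h(1)[of n] in \<open>auto simp: A_def\<close>)
      then show ?thesis by (simp add: m_def)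
    qed
    moreover have "continuous_on {a..b} (\<lambda>t. (P (t - \<delta> * h n + h n) - P (t - \<delta> * h n)) / h n)"
    proof (intro continuous_intros)
      show "continuous_on {a..b} (\<lambda>t. P (t - \<delta> * h n + h n))"
        by (rule continuous_on_compose2[OF cP]) (use \<delta> h(1)[of n] in \<open>auto simp: A_def intro!: continuous_intros\<close>)
      show "continuous_on {a..b} (\<lambda>t. P (t - \<delta> * h n))"
        by (rule continuous_on_compose2[OF cP]) (use \<delta> h(1)[of n] in \<open>auto simp: A_def intro!: continuous_intros\<close>)
      show "\<forall>x\<in>{a..b}. h n \<noteq> 0" using h(1)[of n] by simp
    qed
    ultimately have "continuous_on {a..b} (m n)" by (subst continuous_on_cong[OF refl]) auto
    then show ?thesis by (intro continuous_imp_measurable_on_sets_lebesgue) auto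
  qed
  have \<phi>m: "\<phi> \<in> borel_measurable (lebesgue_on {a..b})"
    using integrable_lebesgue_imp_interval(2)[OF \<phi>(1)] by auto
  show "integrable (lebesgue_on {a..b}) (\<lambda>t. W t * (integral {t - \<delta> * h n..t - \<delta> * h n + h n} \<phi> / h n))" for n
    using integrable_mult_bounded[OF Wi m_meas m1] by (simp only: m_def)
  show "integrable (lebesgue_on {a..b}) (\<lambda>t. W t * \<phi> t)"
    by (rule integrable_mult_bounded[OF Wi \<phi>m \<phi>(2)])
  show "(\<lambda>n. LINT t|lebesgue_on {a..b}. W t * (integral {t - \<delta> * h n..t - \<delta> * h n + h n} \<phi> / h n))
      \<longlonglongrightarrow> (LINT t|lebesgue_on {a..b}. W t * \<phi> t)"
    unfolding m_def[symmetric]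
  proof (rule integral_dominated_convergence[where w = "\<lambda>t. \<bar>W t\<bar>"])
    have "AE t in lebesgue_on {a..b}. (\<lambda>n. m n t) \<longlonglongrightarrow> \<phi> t"
      using average_tendsto_AE[OF \<phi>(1) h \<delta>] unfolding m_def
      by (simp add: AE_restrict_space_iff) (erule eventually_mono, simp)
    then show "AE t in lebesgue_on {a..b}. (\<lambda>n. W t * m n t) \<longlonglongrightarrow> W t * \<phi> t"
      by eventually_elim (intro tendsto_intros)
    show "AE t in lebesgue_on {a..b}. norm (W t * m n t) \<le> \<bar>W t\<bar>" for n
      using m1 by (auto simp: abs_mult intro!: mult_left_le)
  qed (use Wi m_meas \<phi>m in auto)
qed

text \<open>Averaging over r near t does not see the diagonal of a general kernel, but it does for a
  finite sum of products. The approximation error is allowed only in the split form \<rho>(r) +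
  \<kappa>(t): its average in r is a difference quotient of a primitive of \<rho> plus \<kappa>(t),
  and both can be integrated in t and followed to the limit. Applied to K and to -K with opposite
  sides \<delta>, it yields an equality.\<close>

proposition kernel_diagonal_le:
  fixes f :: "real \<Rightarrow> real" and K :: "real \<Rightarrow> real \<Rightarrow> real"
  assumes f: "continuous_on {0..T} f" and ab: "0 < a" "a < b" "b < T" and \<delta>: "\<delta> = 0 \<or> \<delta> = 1"
    and N: "negligible N"
    and inc: "\<And>t h. t \<in> {0<..<T} - N \<Longrightarrow> 0 < h \<Longrightarrow> 0 < t - \<delta> * h \<Longrightarrow> t - \<delta> * h + h < T \<Longrightarrow>
      (\<lambda>r. K r t) integrable_on {t - \<delta> * h..t - \<delta> * h + h} \<and>
      integral {t - \<delta> * h..t - \<delta> * h + h} (\<lambda>r. K r t) \<le> f (t - \<delta> * h + h) - f (t - \<delta> * h)"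
    and diag: "integrable (lebesgue_on {a..b}) (\<lambda>t. K t t)"
    and approx: "\<And>e. e > 0 \<Longrightarrow> \<exists>C \<phi> W \<rho> \<kappa>. finite (C :: 'c set) \<and>
      (\<forall>c\<in>C. integrable lebesgue (\<phi> c) \<and> (\<forall>r. \<bar>\<phi> c r\<bar> \<le> 1) \<and> integrable lebesgue (W c)) \<and>
      integrable lebesgue \<rho> \<and> integrable lebesgue \<kappa> \<and>
      (LINT t|lebesgue_on {a..b}. \<rho> t) + (LINT t|lebesgue_on {a..b}. \<kappa> t) \<le> e \<and>
      (\<forall>r\<in>{0<..<T} - N. \<forall>t\<in>{0<..<T} - N. \<bar>K r t - (\<Sum>c\<in>C. \<phi> c r * W c t)\<bar> \<le> \<rho> r + \<kappa> t)"
  shows "(LINT t|lebesgue_on {a..b}. K t t) \<le> f b - f a"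
proof (rule field_le_epsilon)
  fix e :: real assume "e > 0"
  \<comment> \<open>The error is paid twice, once in the averaged inequality and once when the sum
    of products is replaced by K on the diagonal.\<close>
  then have "e / 2 > 0" by simp
  from approx[OF this] obtain C :: "'c set" and \<phi> W \<rho> \<kappa> where C: "finite C"
    and CC: "\<forall>c\<in>C. integrable lebesgue (\<phi> c) \<and> (\<forall>r. \<bar>\<phi> c r\<bar> \<le> 1) \<and> integrable lebesgue (W c)"
    and \<rho>: "integrable lebesgue \<rho>" and \<kappa>: "integrable lebesgue \<kappa>"
    and small: "(LINT t|lebesgue_on {a..b}. \<rho> t) + (LINT t|lebesgue_on {a..b}. \<kappa> t) \<le> e / 2"
    and KK: "\<forall>r\<in>{0<..<T} - N. \<forall>t\<in>{0<..<T} - N. \<bar>K r t - (\<Sum>c\<in>C. \<phi> c r * W c t)\<bar> \<le> \<rho> r + \<kappa> t"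
    by (elim exE conjE) (rule that)
  have \<phi>: "integrable lebesgue (\<phi> c)" "\<bar>\<phi> c r\<bar> \<le> 1" and W: "integrable lebesgue (W c)" if "c \<in> C" for c r
    using CC that by simp_all
  have K: "\<bar>K r t - (\<Sum>c\<in>C. \<phi> c r * W c t)\<bar> \<le> \<rho> r + \<kappa> t" if "r \<in> {0<..<T} - N" "t \<in> {0<..<T} - N" for r t
    using KK that by blast
  \<comment> \<open>The averages of \<rho> are difference quotients of \<open>P\<close>; adding
    \<open>P\<close> to \<open>f\<close> absorbs them into the telescoping term.\<close>
  define P where "P t = integral {0..t} \<rho>" for t
  define Q where "Q t = f t + P t" for t
  note \<rho>i = integrable_lebesgue_imp_interval(1)[OF \<rho>]
  have Q: "continuous_on {0..T} Q"
    unfolding Q_def P_def by (intro continuous_intros f indefinite_integral_continuous_1 \<rho>i)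
  \<comment> \<open>Steps below \<open>m\<close> keep every averaging interval of a point of [a,b]
    inside (0,T).\<close>
  define m where "m = min a (T - b)"
  have m: "m > 0" using ab by (simp add: m_def)
  define h where "h n = m / 2 * inverse (real (Suc n))" for n
  have h: "h n > 0" for n using m by (simp add: h_def)
  have hm: "h n < m" for n
  proof -
    have "m / 2 * inverse (real (Suc n)) \<le> m / 2 * 1"
      using m by (intro mult_left_mono) (auto simp: inverse_le_1_iff)
    then show ?thesis using m by (simp add: h_def)
  qed
  have h0: "h \<longlonglongrightarrow> 0"
    using tendsto_mult_right_zero[OF LIMSEQ_inverse_real_of_nat, of "m / 2"] by (simp add: h_def[abs_def])
  define J where "J n t = {t - \<delta> * h n..t - \<delta> * h n + h n}" for n t
  define A where "A n t = (\<Sum>c\<in>C. W c t * (integral (J n t) (\<phi> c) / h n))" for n t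
  define B where "B n t = (Q (t - \<delta> * h n + h n) - Q (t - \<delta> * h n)) / h n" for n t
  have AB: "A n t \<le> B n t + \<kappa> t" if t: "t \<in> {a..b} - N" for n t
  proof -
    have tT: "t \<in> {0<..<T} - N" using t ab by auto
    have in_I: "0 < t - \<delta> * h n" "t - \<delta> * h n + h n < T"
      using t \<delta> hm[of n] h[of n] ab by (auto simp: m_def)
    then have J_sub: "J n t \<subseteq> {0<..<T}" by (auto simp: J_def)
    note ic = inc[OF tT h in_I, folded J_def]
    have \<phi>J: "\<phi> c integrable_on J n t" if "c \<in> C" for c
      unfolding J_def by (rule integrable_lebesgue_imp_interval(1)[OF \<phi>(1)[OF that]])
    have \<rho>J: "\<rho> integrable_on J n t" unfolding J_def by (rule \<rho>i)
    \<comment> \<open>A lower bound for K(r,t) in r, valid off \<open>N\<close>, whose integral over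
      the averaging interval is explicit.\<close>
    define L where "L r = (\<Sum>c\<in>C. \<phi> c r * W c t) - \<rho> r - \<kappa> t" for r
    have L: "(L has_integral (\<Sum>c\<in>C. integral (J n t) (\<phi> c) * W c t) - integral (J n t) \<rho> - h n *\<^sub>R \<kappa> t) (J n t)"
      unfolding L_def
    proof (intro has_integral_diff has_integral_sum C has_integral_mult_left)
      show "(\<phi> c has_integral integral (J n t) (\<phi> c)) (J n t)" if "c \<in> C" for c
        using \<phi>J[OF that] by (rule integrable_integral)
      show "(\<rho> has_integral integral (J n t) \<rho>) (J n t)" using \<rho>J by (rule integrable_integral)
      show "((\<lambda>_. \<kappa> t) has_integral h n *\<^sub>R \<kappa> t) (J n t)"
        using has_integral_const_real[of "\<kappa> t" "t - \<delta> * h n" "t - \<delta> * h n + h n"] h[of n] by (simp add: J_def)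
    qed
    \<comment> \<open>Altering K on the null set \<open>N\<close> leaves the integral unchanged and
      makes the comparison hold at every r of the interval.\<close>
    define K' where "K' r = (if r \<in> N then L r else K r t)" for r
    have "((\<lambda>r. K r t) has_integral integral (J n t) (\<lambda>r. K r t)) (J n t)"
      using ic by (auto intro: integrable_integral)
    then have "(K' has_integral integral (J n t) (\<lambda>r. K r t)) (J n t)"
      by (rule has_integral_spike[OF N, rotated]) (simp add: K'_def)
    with L have "(\<Sum>c\<in>C. integral (J n t) (\<phi> c) * W c t) - integral (J n t) \<rho> - h n *\<^sub>R \<kappa> t \<le> integral (J n t) (\<lambda>r. K r t)"
    proof (rule has_integral_le)
      fix r assume "r \<in> J n t"
      show "L r \<le> K' r"
      proof (cases "r \<in> N")
        case False
        with \<open>r \<in> J n t\<close> J_sub have "r \<in> {0<..<T} - N" by blast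
        from K[OF this tT] False show ?thesis by (simp add: L_def K'_def abs_le_iff)
      qed (simp add: K'_def)
    qed
    also have "\<dots> \<le> f (t - \<delta> * h n + h n) - f (t - \<delta> * h n)" using ic by simp
    finally have "(\<Sum>c\<in>C. integral (J n t) (\<phi> c) * W c t) \<le>
        f (t - \<delta> * h n + h n) - f (t - \<delta> * h n) + integral (J n t) \<rho> + h n * \<kappa> t" by simp
    also have "integral (J n t) \<rho> = P (t - \<delta> * h n + h n) - P (t - \<delta> * h n)"
    proof -
      have "P (t - \<delta> * h n) + integral (J n t) \<rho> = P (t - \<delta> * h n + h n)"
        unfolding P_def J_def
        by (rule Henstock_Kurzweil_Integration.integral_combine[OF _ _ \<rho>i]) (use in_I h[of n] in auto)
      then show ?thesis by simp
    qed
    finally have "(\<Sum>c\<in>C. integral (J n t) (\<phi> c) * W c t) / h n \<le>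
        (Q (t - \<delta> * h n + h n) - Q (t - \<delta> * h n) + h n * \<kappa> t) / h n"
      using h[of n] by (intro divide_right_mono) (auto simp: Q_def)
    also have "\<dots> = B n t + \<kappa> t" using h[of n] by (simp add: B_def add_divide_distrib)
    also have "(\<Sum>c\<in>C. integral (J n t) (\<phi> c) * W c t) / h n = A n t"
      by (simp add: A_def sum_divide_distrib mult.commute)
    finally show ?thesis .
  qed
  have not_N: "AE t in lebesgue_on {a..b}. t \<in> {a..b} - N"
  proof -
    have "AE t in lebesgue. t \<notin> N" using N by (intro AE_not_in) (simp add: negligible_iff_null_sets)
    then have "AE t in lebesgue. t \<in> {a..b} \<longrightarrow> t \<in> {a..b} - N" by (rule eventually_mono) auto
    then show ?thesis by (simp add: AE_restrict_space_iff)
  qed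
  have cB: "continuous_on {a..b} (B n)" for n
    unfolding B_def
  proof (intro continuous_intros)
    show "continuous_on {a..b} (\<lambda>t. Q (t - \<delta> * h n + h n))"
      by (rule continuous_on_compose2[OF Q])
        (use \<delta> hm[of n] h[of n] ab in \<open>auto simp: m_def intro!: continuous_intros\<close>)
    show "continuous_on {a..b} (\<lambda>t. Q (t - \<delta> * h n))"
      by (rule continuous_on_compose2[OF Q])
        (use \<delta> hm[of n] h[of n] ab in \<open>auto simp: m_def intro!: continuous_intros\<close>)
    show "\<forall>x\<in>{a..b}. h n \<noteq> 0" using h[of n] by simp
  qed
  have B_int: "integrable (lebesgue_on {a..b}) (B n)" for n
    using cB by (rule continuous_imp_integrable_real)
  have A_int: "integrable (lebesgue_on {a..b}) (A n)" for n
    unfolding A_def J_def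
    by (intro Bochner_Integration.integrable_sum weighted_average_tendsto(1)[OF \<phi> W h h0 \<delta>]) (use ab in auto)
  have \<kappa>_int: "integrable (lebesgue_on {a..b}) \<kappa>" and \<rho>_int: "integrable (lebesgue_on {a..b}) \<rho>"
    using integrable_lebesgue_imp_interval(2) \<kappa> \<rho> by blast+
  have W\<phi>: "integrable (lebesgue_on {a..b}) (\<lambda>t. W c t * \<phi> c t)" if "c \<in> C" for c
    by (rule weighted_average_tendsto(2)[OF \<phi>(1)[OF that] \<phi>(2)[OF that] W[OF that] h h0 \<delta>]) (use ab in auto)
  have "(\<Sum>c\<in>C. (LINT t|lebesgue_on {a..b}. W c t * \<phi> c t)) \<le> (Q b - Q a) + (LINT t|lebesgue_on {a..b}. \<kappa> t)"
  proof (rule LIMSEQ_le)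
    have "(LINT t|lebesgue_on {a..b}. A n t) = (\<Sum>c\<in>C. (LINT t|lebesgue_on {a..b}. W c t * (integral (J n t) (\<phi> c) / h n)))" for n
      unfolding A_def J_def
      by (intro Bochner_Integration.integral_sum weighted_average_tendsto(1)[OF \<phi> W h h0 \<delta>]) (use ab in auto)
    moreover have "(\<lambda>n. \<Sum>c\<in>C. (LINT t|lebesgue_on {a..b}. W c t * (integral (J n t) (\<phi> c) / h n)))
        \<longlonglongrightarrow> (\<Sum>c\<in>C. (LINT t|lebesgue_on {a..b}. W c t * \<phi> c t))"
      unfolding J_def
      by (intro tendsto_sum weighted_average_tendsto(3)[OF \<phi> W h h0 \<delta>]) (use ab in auto)
    ultimately show "(\<lambda>n. LINT t|lebesgue_on {a..b}. A n t) \<longlonglongrightarrow> (\<Sum>c\<in>C. (LINT t|lebesgue_on {a..b}. W c t * \<phi> c t))"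
      by (simp only:)
    have "(LINT t|lebesgue_on {a..b}. B n t) = integral {a..b} (B n)" for n
      by (rule lebesgue_integral_eq_integral[OF B_int]) simp
    moreover have "(\<lambda>n. integral {a..b} (B n)) \<longlonglongrightarrow> Q b - Q a"
      unfolding B_def
      by (rule increments_average_tendsto[OF Q ab h h0 \<delta>]) (use hm in \<open>auto simp: m_def\<close>)
    ultimately have "(\<lambda>n. LINT t|lebesgue_on {a..b}. B n t) \<longlonglongrightarrow> Q b - Q a" by (simp only:)
    then show "(\<lambda>n. (LINT t|lebesgue_on {a..b}. B n t) + (LINT t|lebesgue_on {a..b}. \<kappa> t)) \<longlonglongrightarrow>
        (Q b - Q a) + (LINT t|lebesgue_on {a..b}. \<kappa> t)"
      by (intro tendsto_intros)
    have "(LINT t|lebesgue_on {a..b}. A n t) \<le> (LINT t|lebesgue_on {a..b}. B n t + \<kappa> t)" for n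
    proof (rule integral_mono_AE[OF A_int Bochner_Integration.integrable_add[OF B_int \<kappa>_int]])
      show "AE t in lebesgue_on {a..b}. A n t \<le> B n t + \<kappa> t"
        using not_N by (rule eventually_mono) (rule AB)
    qed
    then show "\<exists>N. \<forall>n\<ge>N. (LINT t|lebesgue_on {a..b}. A n t) \<le> (LINT t|lebesgue_on {a..b}. B n t) + (LINT t|lebesgue_on {a..b}. \<kappa> t)"
      using B_int \<kappa>_int by simp
  qed
  moreover have "Q b - Q a = f b - f a + (LINT t|lebesgue_on {a..b}. \<rho> t)"
  proof -
    have "P a + integral {a..b} \<rho> = P b"
      unfolding P_def by (rule Henstock_Kurzweil_Integration.integral_combine[OF _ _ \<rho>i]) (use ab in auto)
    then show ?thesis by (simp add: Q_def lebesgue_integral_eq_integral[OF \<rho>_int])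
  qed
  moreover have "(LINT t|lebesgue_on {a..b}. K t t) \<le> (LINT t|lebesgue_on {a..b}. (\<Sum>c\<in>C. W c t * \<phi> c t) + (\<rho> t + \<kappa> t))"
  proof (rule integral_mono_AE[OF diag])
    show "integrable (lebesgue_on {a..b}) (\<lambda>t. (\<Sum>c\<in>C. W c t * \<phi> c t) + (\<rho> t + \<kappa> t))"
      by (intro Bochner_Integration.integrable_add Bochner_Integration.integrable_sum W\<phi> \<rho>_int \<kappa>_int)
    show "AE t in lebesgue_on {a..b}. K t t \<le> (\<Sum>c\<in>C. W c t * \<phi> c t) + (\<rho> t + \<kappa> t)"
      using not_N
    proof eventually_elim
      case (elim t)
      then have "t \<in> {0<..<T} - N" using ab by auto
      from K[OF this this] show ?case by (simp add: abs_le_iff mult.commute)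
    qed
  qed
  moreover have "(LINT t|lebesgue_on {a..b}. (\<Sum>c\<in>C. W c t * \<phi> c t) + (\<rho> t + \<kappa> t)) =
      (\<Sum>c\<in>C. (LINT t|lebesgue_on {a..b}. W c t * \<phi> c t)) +
      ((LINT t|lebesgue_on {a..b}. \<rho> t) + (LINT t|lebesgue_on {a..b}. \<kappa> t))"
    using W\<phi> \<rho>_int \<kappa>_int by simp
  ultimately show "(LINT t|lebesgue_on {a..b}. K t t) \<le> f b - f a + e"
    using small by linarith
qed

subsection \<open>The weak time derivative\<close>

lemma AE_lborel_translate:
  fixes h :: "'a::euclidean_space"
  assumes "AE x in lborel. P x"
  shows "AE x in lborel. P (x + h)"
proof -
  have "AE x in distr lborel borel ((+) h). P x" using assms by (simp only: lborel_distr_plus)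
  then have "AE x in lborel. P (h + x)" by (rule AE_distrD[rotated]) simp
  then show ?thesis by (simp add: add.commute)
qed

lemma test_functions_DERIV_real:
  fixes \<phi> :: "real \<Rightarrow> real"
  assumes "\<phi> \<in> test_functions S"
  shows "(\<phi> has_real_derivative frechet_derivative \<phi> (at t) 1) (at t)"
proof -
  have D: "(\<phi> has_derivative frechet_derivative \<phi> (at t)) (at t)"
    by (rule test_functions_has_derivative[OF assms])
  have "frechet_derivative \<phi> (at t) y = frechet_derivative \<phi> (at t) 1 * y" for y
    using linear_scale[OF has_derivative_linear[OF D], of y 1] by (simp add: mult.commute)
  then have "frechet_derivative \<phi> (at t) = (*) (frechet_derivative \<phi> (at t) 1)" by (rule ext)
  with D show ?thesis by (simp only: has_field_derivative_def)
qed

text \<open>The increment lemma in the domain (0,T) with direction 1 gives the identity for almost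
  every starting point. Both sides are continuous in that point, so it holds for every one. This
  matters because later the same t serves for all h at once.\<close>

lemma weak_derivative_increment:
  fixes p k :: "real \<Rightarrow> real"
  assumes p: "continuous_on {0..T} p" and k: "integrable (lebesgue_on {0<..<T}) k"
    and weak: "\<And>\<phi>. \<phi> \<in> test_functions {0<..<T} \<Longrightarrow>
      (LINT t|lebesgue_on {0<..<T}. deriv \<phi> t * p t) = - (LINT t|lebesgue_on {0<..<T}. \<phi> t * k t)"
    and t: "0 < t" "0 < h" "t + h < T"
  shows "k integrable_on {t..t + h}" "integral {t..t + h} k = p (t + h) - p t"
proof -
  let ?I = "{0<..<T}"
  have Il: "?I \<in> sets lebesgue" and Ib: "?I \<in> sets borel" by simp_all
  have pI: "integrable (lebesgue_on ?I) p"
    by (rule integrable_lebesgue_on_subset[OF continuous_imp_integrable_real[OF p]]) auto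
  obtain p' where p': "p' \<in> borel_measurable borel" "\<And>x. x \<notin> ?I \<Longrightarrow> p' x = 0"
    "AE x in lebesgue_on ?I. p x = p' x"
    by (rule lebesgue_on_borel_version[OF Ib borel_measurable_integrable[OF pI]]) (rule that; assumption)
  obtain k' where k': "k' \<in> borel_measurable borel" "\<And>x. x \<notin> ?I \<Longrightarrow> k' x = 0"
    "AE x in lebesgue_on ?I. k x = k' x"
    by (rule lebesgue_on_borel_version[OF Ib borel_measurable_integrable[OF k]]) (rule that; assumption)
  have p'i: "integrable lborel p'"
    using pI integral_lebesgue_on_AE(2)[OF Il borel_measurable_integrable[OF pI] p'(3)]
      integral_lebesgue_on_eq_lborel(2)[OF Ib p'(1,2)] by simp
  have k'i: "integrable lborel k'"
    using k integral_lebesgue_on_AE(2)[OF Il borel_measurable_integrable[OF k] k'(3)]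
      integral_lebesgue_on_eq_lborel(2)[OF Ib k'(1,2)] by simp
  have w: "weak_partial_lborel ?I 1 p' k'"
    unfolding weak_partial_lborel_def
  proof
    fix \<phi> assume \<phi>: "\<phi> \<in> test_functions ?I"
    have b: "(1::real) \<in> Basis" by simp
    have d: "deriv \<phi> s = frechet_derivative \<phi> (at s) 1" for s
      by (rule DERIV_imp_deriv[OF test_functions_DERIV_real[OF \<phi>]])
    have m: "\<phi> \<in> borel_measurable borel" "(\<lambda>x. frechet_derivative \<phi> (at x) 1) \<in> borel_measurable borel"
      by (intro borel_measurable_continuous_onI test_functions_continuous[OF \<phi>]
          test_functions_continuous_partial[OF \<phi> b])+
    have mI: "\<phi> \<in> borel_measurable (lebesgue_on ?I)" "(\<lambda>x. frechet_derivative \<phi> (at x) 1) \<in> borel_measurable (lebesgue_on ?I)"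
      by (intro continuous_imp_measurable_on_sets_lebesgue Il test_functions_continuous[OF \<phi>]
          test_functions_continuous_partial[OF \<phi> b])+
    have "(LINT x|lborel. p' x * frechet_derivative \<phi> (at x) 1) = (LINT x|lebesgue_on ?I. p' x * frechet_derivative \<phi> (at x) 1)"
      by (rule integral_lebesgue_on_eq_lborel(1)[OF Ib, symmetric]) (use p' m in auto)
    also have "\<dots> = (LINT x|lebesgue_on ?I. deriv \<phi> x * p x)"
    proof (rule integral_lebesgue_on_AE(1)[OF Il, symmetric])
      show "(\<lambda>x. deriv \<phi> x * p x) \<in> borel_measurable (lebesgue_on ?I)"
        using mI(2) borel_measurable_integrable[OF pI] unfolding d by simp
      show "AE x in lebesgue_on ?I. deriv \<phi> x * p x = p' x * frechet_derivative \<phi> (at x) 1"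
        using p'(3) by eventually_elim (simp add: d)
    qed
    also have "\<dots> = - (LINT x|lebesgue_on ?I. \<phi> x * k x)" by (rule weak[OF \<phi>])
    also have "(LINT x|lebesgue_on ?I. \<phi> x * k x) = (LINT x|lebesgue_on ?I. k' x * \<phi> x)"
    proof (rule integral_lebesgue_on_AE(1)[OF Il])
      show "(\<lambda>x. \<phi> x * k x) \<in> borel_measurable (lebesgue_on ?I)"
        using mI(1) borel_measurable_integrable[OF k] by simp
      show "AE x in lebesgue_on ?I. \<phi> x * k x = k' x * \<phi> x"
        using k'(3) by eventually_elim simp
    qed
    also have "\<dots> = (LINT x|lborel. k' x * \<phi> x)"
      by (rule integral_lebesgue_on_eq_lborel(1)[OF Ib]) (use k' m in auto)
    finally show "(LINT x|lborel. p' x * frechet_derivative \<phi> (at x) 1) = - (LINT x|lborel. k' x * \<phi> x)" .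
  qed
  have k'l: "integrable lebesgue k'" using k'i k'(1) by (simp add: integrable_completion)
  note k'int = integrable_lebesgue_imp_interval[OF k'l]
  define P where "P x = integral {0..x} k'" for x
  have P: "continuous_on {0..T} P"
    unfolding P_def by (rule indefinite_integral_continuous_1[OF k'int(1)])
  have PP: "integral {x..x + h} k' = P (x + h) - P x" if "0 \<le> x" for x
  proof -
    have "integral {0..x} k' + integral {x..x + h} k' = integral {0..x + h} k'"
      by (rule Henstock_Kurzweil_Integration.integral_combine[OF _ _ k'int(1)]) (use that t in auto)
    then show ?thesis by (simp add: P_def)
  qed
  \<comment> \<open>The points from which a step of length at most h stays in (0,T).\<close>
  define U where "U = {0<..<T - h}"
  have "AE x in lborel. x \<in> U \<longrightarrow> p' (x + h *\<^sub>R 1) - p' x = dir_integral 1 h k' x"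
    by (rule weak_partial_increment[OF _ p'i k'i w]) (use t in \<open>auto simp: U_def\<close>)
  moreover have "AE x in lborel. x \<in> ?I \<longrightarrow> p x = p' x"
    using p'(3) by (simp add: AE_restrict_space_iff AE_completion_iff)
  moreover from this have "AE x in lborel. x + h \<in> ?I \<longrightarrow> p (x + h) = p' (x + h)"
    by (rule AE_lborel_translate)
  ultimately have "AE x in lborel. x \<in> U \<longrightarrow> p (x + h) - p x - (P (x + h) - P x) = 0"
  proof eventually_elim
    case (elim x)
    show ?case
    proof
      assume x: "x \<in> U"
      have "dir_integral 1 h k' x = (LINT s|lborel. indicator {x..x + h} (s + x) * k' (s + x))"
        unfolding dir_integral_def
        by (intro Bochner_Integration.integral_cong) (auto simp: indicator_def add.commute)
      also have "\<dots> = (LINT r|lborel. indicator {x..x + h} r * k' r)"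
        using k'(1) by (intro integral_lborel_translate[where f = "\<lambda>r. indicator {x..x + h} r * k' r"]) simp
      also have "\<dots> = (LINT r|lebesgue_on {x..x + h}. k' r)"
        using k'(1) by (simp add: integral_restrict_space integral_completion)
      also have "\<dots> = integral {x..x + h} k'"
        by (rule lebesgue_integral_eq_integral[OF k'int(2)]) simp
      also have "\<dots> = P (x + h) - P x" by (rule PP) (use x in \<open>simp add: U_def\<close>)
      finally show "p (x + h) - p x - (P (x + h) - P x) = 0"
        using elim x t by (auto simp: U_def)
    qed
  qed
  then have ae: "AE x in lebesgue. x \<in> U \<longrightarrow> p (x + h) - p x - (P (x + h) - P x) = 0"
    by (simp add: AE_completion_iff)
  define D where "D x = p (x + h) - p x - (P (x + h) - P x)" for x
  have cD: "continuous_on U D"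
    unfolding D_def
    by (intro continuous_intros continuous_on_compose2[OF p] continuous_on_compose2[OF P]
        continuous_on_subset[OF p] continuous_on_subset[OF P]) (use t in \<open>auto simp: U_def\<close>)
  \<comment> \<open>The set where the identity fails is open by continuity and null, hence
    empty.\<close>
  have "open (U \<inter> D -` (- {0}))"
    by (rule continuous_open_preimage[OF cD]) (auto simp: U_def)
  moreover have "negligible (U \<inter> D -` (- {0}))"
  proof -
    have "{x \<in> space lebesgue. \<not> (x \<in> U \<longrightarrow> D x = 0)} \<in> null_sets lebesgue"
      using ae by (simp only: completion.AE_iff_null_sets D_def)
    moreover have "{x \<in> space lebesgue. \<not> (x \<in> U \<longrightarrow> D x = 0)} = U \<inter> D -` (- {0})" by auto
    ultimately show ?thesis by (simp only: negligible_iff_null_sets)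
  qed
  ultimately have "U \<inter> D -` (- {0}) = {}" using open_not_negligible by blast
  moreover have "t \<in> U" using t by (simp add: U_def)
  ultimately have "D t = 0" by auto
  then have "integral {t..t + h} k' = p (t + h) - p t" using PP[of t] t by (simp add: D_def)
  moreover have sub: "{t..t + h} \<subseteq> ?I" using t by auto
  have kJ: "integrable (lebesgue_on {t..t + h}) k"
    by (rule integrable_lebesgue_on_subset[OF k Il _ sub]) simp
  have "AE x in lebesgue. x \<in> ?I \<longrightarrow> k x = k' x"
    using k'(3) by (simp add: AE_restrict_space_iff)
  then have "AE x in lebesgue. x \<in> {t..t + h} \<longrightarrow> k x = k' x"
    by (rule eventually_mono) (use sub in blast)
  then have "AE x in lebesgue_on {t..t + h}. k x = k' x" by (simp add: AE_restrict_space_iff)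
  from integral_lebesgue_on_AE(1)[OF _ borel_measurable_integrable[OF kJ] this]
  have "(LINT x|lebesgue_on {t..t + h}. k x) = (LINT x|lebesgue_on {t..t + h}. k' x)"
    by simp
  ultimately show "integral {t..t + h} k = p (t + h) - p t"
    using lebesgue_integral_eq_integral[OF kJ] lebesgue_integral_eq_integral[OF k'int(2)] by simp
  show "k integrable_on {t..t + h}" by (rule integrable_on_lebesgue_on[OF kJ]) simp
qed

lemma H1_dual_diff_arg:
  assumes \<Omega>: "open \<Omega>" and l: "l \<in> H1_dual \<Omega>" and v: "v \<in> H1 \<Omega>" and w: "w \<in> H1 \<Omega>"
  shows "l v - l w = l (\<lambda>x. v x - w x)"
proof -
  have "(\<lambda>x. v x - w x) \<in> H1 \<Omega>" using H1_lincomb(1)[OF \<Omega> v w, of 1 "-1"] by simp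
  then have "l (\<lambda>x. (v x - w x) + w x) = l (\<lambda>x. v x - w x) + l w"
    using l w by (simp only: H1_dual_def mem_Collect_eq)
  then show ?thesis by simp
qed

text \<open>Composing a simple function with the positive part and a functional is again simple.
  Continuity of the positive part on H^1 then makes these compositions converge at almost every
  t.\<close>

lemma pos_part_weakly_measurable:
  fixes S :: "real set"
  assumes \<Omega>: "open \<Omega>" and S: "S \<in> sets lebesgue"
    and u: "strongly_measurable_in (lebesgue_on S) (H1 \<Omega>) (H1_norm \<Omega>) u" and c: "c \<in> H1_dual \<Omega>"
  shows "(\<lambda>t. c (pos_part (u t))) \<in> borel_measurable (lebesgue_on S)"
proof -
  obtain s where uX: "AE t in lebesgue_on S. u t \<in> H1 \<Omega>"
    and s: "\<And>k::nat. simple_in (lebesgue_on S) (H1 \<Omega>) (s k)"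
    and lim: "AE t in lebesgue_on S. (\<lambda>k. H1_norm \<Omega> (\<lambda>v. u t v - s k t v)) \<longlonglongrightarrow> 0"
    using u by (auto simp: strongly_measurable_in_def)
  have S_AE: "AE t in lebesgue_on S. t \<in> S" using AE_space[of "lebesgue_on S"] by simp
  show ?thesis
  proof (rule borel_measurable_AE_limit[OF S])
    show "(\<lambda>t. c (pos_part (s k t))) \<in> borel_measurable (lebesgue_on S)" for k
      using s[of k] simple_in_dual_measurable[of "lebesgue_on S" "s k" "\<lambda>v. c (pos_part v)"]
      by (simp add: simple_in_def)
    show "AE t in lebesgue_on S. (\<lambda>k. c (pos_part (s k t))) \<longlonglongrightarrow> c (pos_part (u t))"
      using uX lim S_AE
    proof eventually_elim
      case (elim t)
      have st: "s k t \<in> H1 \<Omega>" for k using s[of k] elim(3) by (auto simp: simple_in_def)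
      have "H1_norm \<Omega> (\<lambda>x. s k t x - u t x) = H1_norm \<Omega> (\<lambda>x. u t x - s k t x)" for k
      proof -
        have "(\<lambda>x. u t x - s k t x) \<in> H1 \<Omega>" using H1_lincomb(1)[OF \<Omega> elim(1) st[of k], of 1 "-1"] by simp
        from H1_scale(2)[OF \<Omega> this, of "-1"] show ?thesis by simp
      qed
      with elim(2) have "(\<lambda>k. H1_norm \<Omega> (\<lambda>x. s k t x - u t x)) \<longlonglongrightarrow> 0" by simp
      from pos_part_H1_continuous[OF \<Omega> elim(1) st this]
      have 0: "(\<lambda>k. H1_norm \<Omega> (\<lambda>x. pos_part (s k t) x - pos_part (u t) x)) \<longlonglongrightarrow> 0" .
      have "(\<lambda>k. c (pos_part (s k t)) - c (pos_part (u t))) \<longlonglongrightarrow> 0"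
      proof (rule Lim_null_comparison)
        show "(\<lambda>k. H1_dual_norm \<Omega> c * H1_norm \<Omega> (\<lambda>x. pos_part (s k t) x - pos_part (u t) x)) \<longlonglongrightarrow> 0"
          by (rule tendsto_mult_right_zero[OF 0])
        have "\<bar>c (pos_part (s k t)) - c (pos_part (u t))\<bar> \<le>
            H1_dual_norm \<Omega> c * H1_norm \<Omega> (\<lambda>x. pos_part (s k t) x - pos_part (u t) x)" for k
        proof -
          note ps = pos_part_H1(1)[OF \<Omega> st[of k]] and pu = pos_part_H1(1)[OF \<Omega> elim(1)]
          have "(\<lambda>x. pos_part (s k t) x - pos_part (u t) x) \<in> H1 \<Omega>"
            using H1_lincomb(1)[OF \<Omega> ps pu, of 1 "-1"] by simp
          from H1_dual_bound[OF \<Omega> c this] show ?thesis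
            by (simp only: H1_dual_diff_arg[OF \<Omega> c ps pu])
        qed
        then show "\<forall>\<^sub>F k in sequentially. norm (c (pos_part (s k t)) - c (pos_part (u t))) \<le>
            H1_dual_norm \<Omega> c * H1_norm \<Omega> (\<lambda>x. pos_part (s k t) x - pos_part (u t) x)"
          by simp
      qed
      then show ?case by (rule LIM_zero_cancel)
    qed
  qed
qed

section \<open>The squared norm of the positive part on L^2\<close>

lemma L2_inner_diff_left:
  assumes "f \<in> L2 \<Omega>" "g \<in> L2 \<Omega>" "v \<in> L2 \<Omega>"
  shows "L2_inner \<Omega> f v - L2_inner \<Omega> g v = L2_inner \<Omega> (\<lambda>x. f x - g x) v"
  unfolding L2_inner_def
  using L2_integrable_mult[OF assms(1,3)] L2_integrable_mult[OF assms(2,3)]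
  by (simp add: left_diff_distrib)

lemma L2_inner_continuous:
  assumes u: "u \<in> C_in {0..T} (L2 \<Omega>) (L2_norm \<Omega>)" and v: "v \<in> L2 \<Omega>"
  shows "continuous_on {0..T} (\<lambda>t. L2_inner \<Omega> (u t) v)"
  unfolding continuous_on_def
proof
  fix t assume t: "t \<in> {0..T}"
  have uL: "u s \<in> L2 \<Omega>" if "s \<in> {0..T}" for s using u that by (simp add: C_in_def)
  have lim: "((\<lambda>s. L2_norm \<Omega> (\<lambda>x. u s x - u t x)) \<longlongrightarrow> 0) (at t within {0..T})"
    using u t by (simp add: C_in_def)
  have "((\<lambda>s. L2_inner \<Omega> (u s) v - L2_inner \<Omega> (u t) v) \<longlongrightarrow> 0) (at t within {0..T})"
  proof (rule Lim_null_comparison)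
    show "((\<lambda>s. L2_norm \<Omega> (\<lambda>x. u s x - u t x) * L2_norm \<Omega> v) \<longlongrightarrow> 0) (at t within {0..T})"
      by (rule tendsto_mult_left_zero[OF lim])
    have "norm (L2_inner \<Omega> (u s) v - L2_inner \<Omega> (u t) v) \<le> L2_norm \<Omega> (\<lambda>x. u s x - u t x) * L2_norm \<Omega> v"
      if "s \<in> {0..T}" for s
    proof -
      have "(\<lambda>x. u s x - u t x) \<in> L2 \<Omega>" using L2_lincomb[OF uL[OF that] uL[OF t], of 1 "-1"] by simp
      from L2_Cauchy_Schwarz[OF this v] show ?thesis
        by (simp add: L2_inner_diff_left[OF uL[OF that] uL[OF t] v])
    qed
    then show "\<forall>\<^sub>F s in at t within {0..T}. norm (L2_inner \<Omega> (u s) v - L2_inner \<Omega> (u t) v) \<le>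
        L2_norm \<Omega> (\<lambda>x. u s x - u t x) * L2_norm \<Omega> v"
      by (auto simp: eventually_at_filter)
  qed
  then show "((\<lambda>s. L2_inner \<Omega> (u s) v) \<longlongrightarrow> L2_inner \<Omega> (u t) v) (at t within {0..T})"
    by (rule LIM_zero_cancel)
qed

lemma pos_part_L2: "f \<in> L2 \<Omega> \<Longrightarrow> pos_part f \<in> L2 \<Omega>"
  by (rule L2_bound[of f]) (auto simp: L2_def pos_part_def[abs_def] max_def)

text \<open>The positive part is 1-Lipschitz pointwise, hence in L^2. Writing u(s)+ = a + b with b =
  u(t)+, the squared norms differ by |a|^2 + 2 (a, b), and |a| is at most the distance of u(s) and
  u(t).\<close>

lemma L2_norm_pos_part_continuous:
  assumes u: "u \<in> C_in {0..T} (L2 \<Omega>) (L2_norm \<Omega>)"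
  shows "continuous_on {0..T} (\<lambda>t. (L2_norm \<Omega> (pos_part (u t)))\<^sup>2)"
  unfolding continuous_on_def
proof
  fix t assume t: "t \<in> {0..T}"
  have uL: "u s \<in> L2 \<Omega>" if "s \<in> {0..T}" for s using u that by (simp add: C_in_def)
  define d where "d s = L2_norm \<Omega> (\<lambda>x. u s x - u t x)" for s
  define b where "b = pos_part (u t)"
  have b: "b \<in> L2 \<Omega>" unfolding b_def by (rule pos_part_L2[OF uL[OF t]])
  have lim: "(d \<longlongrightarrow> 0) (at t within {0..T})"
    using u t by (simp add: C_in_def d_def[abs_def])
  have "((\<lambda>s. (L2_norm \<Omega> (pos_part (u s)))\<^sup>2 - (L2_norm \<Omega> b)\<^sup>2) \<longlongrightarrow> 0) (at t within {0..T})"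
  proof (rule Lim_null_comparison)
    have "((\<lambda>s. (d s)\<^sup>2 + 2 * (d s * L2_norm \<Omega> b)) \<longlongrightarrow> 0\<^sup>2 + 2 * (0 * L2_norm \<Omega> b)) (at t within {0..T})"
      by (intro tendsto_intros lim)
    then show "((\<lambda>s. (d s)\<^sup>2 + 2 * (d s * L2_norm \<Omega> b)) \<longlongrightarrow> 0) (at t within {0..T})" by simp
    have "\<bar>(L2_norm \<Omega> (pos_part (u s)))\<^sup>2 - (L2_norm \<Omega> b)\<^sup>2\<bar> \<le> (d s)\<^sup>2 + 2 * (d s * L2_norm \<Omega> b)"
      if s: "s \<in> {0..T}" for s
    proof -
      define a where "a x = pos_part (u s) x - b x" for x
      have a: "a \<in> L2 \<Omega>"
        using L2_lincomb[OF pos_part_L2[OF uL[OF s]] b, of 1 "-1"] by (simp add: a_def[abs_def])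
      have dL: "(\<lambda>x. u s x - u t x) \<in> L2 \<Omega>" using L2_lincomb[OF uL[OF s] uL[OF t], of 1 "-1"] by simp
      have "(L2_norm \<Omega> a)\<^sup>2 \<le> (d s)\<^sup>2"
        unfolding d_def L2_norm_sq
        by (rule integral_mono) (use a dL in \<open>auto simp: L2_def a_def b_def pos_part_def max_def abs_le_square_iff[symmetric]\<close>)
      then have ad: "L2_norm \<Omega> a \<le> d s"
        by (rule power2_le_imp_le) (simp add: d_def L2_norm_nonneg)
      have "(L2_norm \<Omega> (pos_part (u s)))\<^sup>2 = (LINT x|lebesgue_on \<Omega>. (a x)\<^sup>2 + 2 * (a x * b x) + (b x)\<^sup>2)"
        unfolding L2_norm_sq by (simp add: a_def power2_eq_square algebra_simps)
      also have "\<dots> = (L2_norm \<Omega> a)\<^sup>2 + 2 * L2_inner \<Omega> a b + (L2_norm \<Omega> b)\<^sup>2"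
        using a b L2_integrable_mult[OF a b] by (simp add: L2_norm_sq L2_inner_def L2_def)
      finally have "\<bar>(L2_norm \<Omega> (pos_part (u s)))\<^sup>2 - (L2_norm \<Omega> b)\<^sup>2\<bar> \<le> (L2_norm \<Omega> a)\<^sup>2 + 2 * \<bar>L2_inner \<Omega> a b\<bar>"
        using zero_le_power2[of "L2_norm \<Omega> a"] by linarith
      moreover have "\<bar>L2_inner \<Omega> a b\<bar> \<le> d s * L2_norm \<Omega> b"
        by (rule order_trans[OF L2_Cauchy_Schwarz[OF a b] mult_right_mono[OF ad L2_norm_nonneg]])
      ultimately show ?thesis using \<open>(L2_norm \<Omega> a)\<^sup>2 \<le> (d s)\<^sup>2\<close> by linarith
    qed
    then show "\<forall>\<^sub>F s in at t within {0..T}. norm ((L2_norm \<Omega> (pos_part (u s)))\<^sup>2 - (L2_norm \<Omega> b)\<^sup>2) \<le>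
        (d s)\<^sup>2 + 2 * (d s * L2_norm \<Omega> b)"
      by (auto simp: eventually_at_filter)
  qed
  then show "((\<lambda>s. (L2_norm \<Omega> (pos_part (u s)))\<^sup>2) \<longlongrightarrow> (L2_norm \<Omega> (pos_part (u t)))\<^sup>2) (at t within {0..T})"
    unfolding b_def by (rule LIM_zero_cancel)
qed

text \<open>Pointwise: where f > 0 one has f = f+ and g \<le> g+, elsewhere the factor f+ is 0; so
  (g - f) f+ \<le> (g+ - f+) f+, and the square of g+ - f+ is nonnegative. Later \<open>f\<close> is
  the value at t, and \<open>g\<close> the value at t + h or at t - h.\<close>

lemma pos_part_gradient_ineq:
  assumes f: "f \<in> L2 \<Omega>" and g: "g \<in> L2 \<Omega>"
  shows "L2_inner \<Omega> g (pos_part f) - L2_inner \<Omega> f (pos_part f) \<le>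
    1 / 2 * (L2_norm \<Omega> (pos_part g))\<^sup>2 - 1 / 2 * (L2_norm \<Omega> (pos_part f))\<^sup>2"
proof -
  note pf = pos_part_L2[OF f] and pg = pos_part_L2[OF g]
  have dL: "(\<lambda>x. g x - f x) \<in> L2 \<Omega>" using L2_lincomb[OF g f, of 1 "-1"] by simp
  have "(LINT x|lebesgue_on \<Omega>. (g x - f x) * pos_part f x) \<le>
      (LINT x|lebesgue_on \<Omega>. 1 / 2 * (pos_part g x)\<^sup>2 - 1 / 2 * (pos_part f x)\<^sup>2)"
  proof (rule integral_mono[OF L2_integrable_mult[OF dL pf]])
    show "integrable (lebesgue_on \<Omega>) (\<lambda>x. 1 / 2 * (pos_part g x)\<^sup>2 - 1 / 2 * (pos_part f x)\<^sup>2)"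
      using pf pg by (simp add: L2_def)
    show "(g x - f x) * pos_part f x \<le> 1 / 2 * (pos_part g x)\<^sup>2 - 1 / 2 * (pos_part f x)\<^sup>2" for x
    proof -
      define p q where "p = pos_part f x" and "q = pos_part g x"
      have "(g x - f x) * p \<le> (q - p) * p"
        by (cases "f x > 0") (auto simp: p_def q_def pos_part_def max_def intro!: mult_right_mono)
      moreover have "(q - p) * p \<le> 1 / 2 * q\<^sup>2 - 1 / 2 * p\<^sup>2"
        using zero_le_power2[of "q - p"] by (simp add: power2_eq_square algebra_simps)
      ultimately show ?thesis by (simp add: p_def q_def)
    qed
  qed
  also have "\<dots> = 1 / 2 * (L2_norm \<Omega> (pos_part g))\<^sup>2 - 1 / 2 * (L2_norm \<Omega> (pos_part f))\<^sup>2"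
    using pf pg by (simp add: L2_def L2_norm_sq)
  finally show ?thesis
    unfolding L2_inner_diff_left[OF g f pf] unfolding L2_inner_def .
qed

section \<open>Integrals and primitives on a time interval\<close>

lemma integrable_extend_zero:
  fixes g :: "real \<Rightarrow> real"
  assumes "S \<in> sets lebesgue" "integrable (lebesgue_on S) g"
  shows "integrable lebesgue (\<lambda>t. indicator S t * g t)"
    "(LINT t|lebesgue. indicator S t * g t) = (LINT t|lebesgue_on S. g t)"
  using assms by (simp_all add: integrable_restrict_space integral_restrict_space)

lemma integral_interval_le:
  fixes g :: "real \<Rightarrow> real"
  assumes "integrable lebesgue g" "\<And>t. 0 \<le> g t"
  shows "(LINT t|lebesgue_on {a..b}. g t) \<le> (LINT t|lebesgue. g t)"
proof -
  have "integrable lebesgue (\<lambda>t. indicator {a..b} t *\<^sub>R g t)"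
    using integrable_lebesgue_imp_interval(2)[OF assms(1), of a b] by (simp add: integrable_restrict_space)
  then have "(LINT t|lebesgue. indicator {a..b} t *\<^sub>R g t) \<le> (LINT t|lebesgue. g t)"
    by (rule integral_mono[OF _ assms(1)]) (use assms(2) in \<open>auto simp: indicator_def\<close>)
  then show ?thesis by (simp add: integral_restrict_space)
qed

text \<open>The increments over interior intervals make \<open>F\<close> minus a primitive of
  \<open>g\<close> constant on (0,T), and by continuity on [0,T], which yields the values at the end
  points. As \<open>g\<close> is merely integrable, the integration by parts is Fubini's theorem on
  the triangle r \<le> t.\<close>

lemma weak_derivative_of_primitive:
  fixes F g :: "real \<Rightarrow> real"
  assumes T: "T > 0" and F: "continuous_on {0..T} F" and g: "integrable (lebesgue_on {0<..<T}) g"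
    and incr: "\<And>a b. 0 < a \<Longrightarrow> a < b \<Longrightarrow> b < T \<Longrightarrow> (LINT t|lebesgue_on {a..b}. g t) = F b - F a"
  shows "has_weak_partial {0<..<T} 1 F g" "(LINT t|lebesgue_on {0<..<T}. g t) = F T - F 0"
proof -
  let ?I = "{0<..<T}"
  have Il: "?I \<in> sets lebesgue" and Ib: "?I \<in> sets borel" by simp_all
  obtain k where k: "k \<in> borel_measurable borel" "\<And>x. x \<notin> ?I \<Longrightarrow> k x = 0"
    "AE x in lebesgue_on ?I. g x = k x"
    by (rule lebesgue_on_borel_version[OF Ib borel_measurable_integrable[OF g]]) (rule that; assumption)
  note [measurable] = k(1)
  have gk: "(LINT t|lebesgue_on ?I. g t) = (LINT t|lborel. k t)" and ki: "integrable lborel k"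
    using g integral_lebesgue_on_AE[OF Il borel_measurable_integrable[OF g] k(3)]
      integral_lebesgue_on_eq_lborel[OF Ib k(1,2)] by simp_all
  have kl: "integrable lebesgue k" using ki k(1) by (simp add: integrable_completion)
  note kint = integrable_lebesgue_imp_interval[OF kl]
  define G where "G t = integral {0..t} k" for t
  have G: "continuous_on {0..T} G"
    unfolding G_def by (rule indefinite_integral_continuous_1[OF kint(1)])
  have G_lborel: "G t = (LINT r|lborel. indicator {..t} r * k r)" for t
  proof -
    have "G t = (LINT r|lebesgue_on {0..t}. k r)"
      unfolding G_def by (rule lebesgue_integral_eq_integral[OF kint(2), symmetric]) simp
    also have "\<dots> = (LINT r|lborel. indicator {0..t} r * k r)"
      by (simp add: integral_restrict_space integral_completion)
    also have "\<dots> = (LINT r|lborel. indicator {..t} r * k r)"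
      using k(2) by (intro Bochner_Integration.integral_cong) (auto simp: indicator_def)
    finally show ?thesis .
  qed
  have incr': "G b - G a = F b - F a" if ab: "0 < a" "a < b" "b < T" for a b
  proof -
    have sub: "{a..b} \<subseteq> ?I" using ab by auto
    have gJ: "integrable (lebesgue_on {a..b}) g"
      by (rule integrable_lebesgue_on_subset[OF g Il _ sub]) simp
    have "AE x in lebesgue. x \<in> ?I \<longrightarrow> g x = k x"
      using k(3) by (simp add: AE_restrict_space_iff)
    then have "AE x in lebesgue. x \<in> {a..b} \<longrightarrow> g x = k x"
      by (rule eventually_mono) (use sub in blast)
    then have "AE x in lebesgue_on {a..b}. g x = k x" by (simp add: AE_restrict_space_iff)
    from integral_lebesgue_on_AE(1)[OF _ borel_measurable_integrable[OF gJ] this]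
    have "(LINT x|lebesgue_on {a..b}. g x) = (LINT x|lebesgue_on {a..b}. k x)" by simp
    also have "\<dots> = integral {a..b} k" by (rule lebesgue_integral_eq_integral[OF kint(2)]) simp
    also have "integral {0..a} k + integral {a..b} k = integral {0..b} k"
      by (rule Henstock_Kurzweil_Integration.integral_combine[OF _ _ kint(1)]) (use ab in auto)
    then have "integral {a..b} k = G b - G a" by (simp add: G_def)
    finally show ?thesis using incr[OF ab] by simp
  qed
  \<comment> \<open>The constant is read off at the midpoint, which can be compared with every other
    interior point.\<close>
  define c where "c = F (T / 2) - G (T / 2)"
  have const: "F t = c + G t" if "t \<in> {0..T}" for t
  proof -
    have "F t - G t = c"
    proof (rule continuous_constant_on_closure[where S = ?I and f = "\<lambda>t. F t - G t"])
      show "continuous_on (closure ?I) (\<lambda>t. F t - G t)" using T F G by (auto intro: continuous_intros)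
      show "F s - G s = c" if "s \<in> ?I" for s
        using incr'[of s "T / 2"] incr'[of "T / 2" s] that T
        by (cases s "T / 2" rule: linorder_cases) (auto simp: c_def)
      show "t \<in> closure ?I" using that T by simp
    qed
    then show ?thesis by simp
  qed
  have "G T = (LINT t|lborel. k t)"
    unfolding G_lborel using k(2) by (intro Bochner_Integration.integral_cong) (auto simp: indicator_def)
  moreover have "G 0 = 0" by (simp add: G_def)
  ultimately show "(LINT t|lebesgue_on ?I. g t) = F T - F 0"
    using gk const[of T] const[of 0] T by simp
  show "has_weak_partial ?I 1 F g"
    unfolding has_weak_partial_def
  proof (intro conjI ballI)
    have FT: "integrable (lebesgue_on {0..T}) F" by (rule continuous_imp_integrable_real[OF F])
    have F_int: "integrable (lebesgue_on ?I) F"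
      by (rule integrable_lebesgue_on_subset[OF FT]) auto
    have loc: "locally_integrable_on q ?I" if "integrable (lebesgue_on ?I) q" for q
      unfolding locally_integrable_on_def
    proof (intro allI impI)
      fix L assume L: "compact L \<and> L \<subseteq> ?I"
      then have "L \<in> sets lebesgue" by (simp add: lmeasurable_compact fmeasurableD)
      with L show "integrable (lebesgue_on L) q"
        using integrable_lebesgue_on_subset[OF that Il] by simp
    qed
    show "locally_integrable_on F ?I" "locally_integrable_on g ?I"
      by (rule loc[OF F_int], rule loc[OF g])
    fix \<phi> assume \<phi>: "\<phi> \<in> test_functions ?I"
    define \<phi>' where "\<phi>' t = frechet_derivative \<phi> (at t) 1" for t
    have b: "(1::real) \<in> Basis" by simp
    obtain L where L: "compact L" "L \<subseteq> ?I" "\<And>x. x \<notin> L \<Longrightarrow> \<phi> x = 0"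
      "\<And>x b. x \<notin> L \<Longrightarrow> frechet_derivative \<phi> (at x) b = 0"
      by (rule test_functions_support[OF \<phi>]) (rule that; assumption)
    have off: "\<phi> x = 0" "\<phi>' x = 0" if "x \<notin> ?I" for x
      unfolding \<phi>'_def by (rule L(3), use that L(2) in blast, rule L(4), use that L(2) in blast)
    have c\<phi>': "continuous_on A \<phi>'" for A
      unfolding \<phi>'_def[abs_def] by (rule test_functions_continuous_partial[OF \<phi> b])
    have [measurable]: "\<phi> \<in> borel_measurable borel" "\<phi>' \<in> borel_measurable borel"
      by (intro borel_measurable_continuous_onI test_functions_continuous[OF \<phi>] c\<phi>')+
    have \<phi>'i: "integrable lborel \<phi>'"
    proof -
      have "integrable lborel (\<lambda>x. indicator {0..T} x * \<phi>' x)"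
        using borel_integrable_atLeastAtMost'[OF c\<phi>', of 0 T] by (simp add: set_integrable_def)
      moreover have "indicator {0..T} x * \<phi>' x = \<phi>' x" for x
        using off(2)[of x] by (cases "x \<in> ?I") auto
      ultimately show ?thesis by simp
    qed
    \<comment> \<open>Integrating up to max r T covers the rest of the support, including the case r
      > T, where both sides are 0.\<close>
    have tail: "(LINT t|lborel. indicator {r..} t * \<phi>' t) = - \<phi> r" for r
    proof -
      define m where "m = max r T"
      have "(\<phi>' has_integral \<phi> m - \<phi> r) {r..m}"
        using test_functions_DERIV_real[OF \<phi>] unfolding \<phi>'_def[abs_def]
        by (intro fundamental_theorem_of_calculus)
          (auto simp: m_def has_real_derivative_iff_has_vector_derivative[symmetric] intro: has_field_derivative_at_within)
      moreover have "(LINT t:{r..m}|lborel. \<phi>' t) = integral {r..m} \<phi>'"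
        by (rule set_borel_integral_eq_integral[OF borel_integrable_atLeastAtMost'[OF c\<phi>']])
      moreover have "\<phi> m = 0" by (rule off(1)) (simp add: m_def)
      ultimately have "(LINT t|lborel. indicator {r..m} t * \<phi>' t) = - \<phi> r"
        by (simp add: integral_unique set_lebesgue_integral_def)
      moreover have "indicator {r..m} t * \<phi>' t = indicator {r..} t * \<phi>' t" for t
        using off(2)[of t] by (cases "t \<in> ?I") (auto simp: m_def indicator_def)
      ultimately show ?thesis by simp
    qed
    have \<phi>'0: "(LINT t|lborel. \<phi>' t) = 0"
    proof -
      have "(LINT t|lborel. indicator {0..} t * \<phi>' t) = 0" using tail[of 0] off(1)[of 0] by simp
      moreover have "indicator {0..} t * \<phi>' t = \<phi>' t" for t
        using off(2)[of t] by (cases "t \<in> ?I") auto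
      ultimately show ?thesis by simp
    qed
    \<comment> \<open>Integration over r gives the test derivative times the primitive
      \<open>G\<close>; integration over t gives -k times the test function. Equating the iterated
      integrals is the integration by parts.\<close>
    define H where "H t r = \<phi>' t * k r * (indicator {..t} r :: real)" for t r
    have H: "integrable (lborel \<Otimes>\<^sub>M lborel) (case_prod H)"
    proof -
      have "integrable (lborel \<Otimes>\<^sub>M lborel) (\<lambda>z. (case z of (t, r) \<Rightarrow> \<phi>' t * k r) * (if snd z \<le> fst z then 1 else 0))"
        by (rule integrable_mult_bounded[OF integrable_lborel_pair_product(2)[OF \<phi>'i ki], where C = 1]) auto
      moreover have "(\<lambda>z. (case z of (t, r) \<Rightarrow> \<phi>' t * k r) * (if snd z \<le> fst z then 1 else 0)) = case_prod H"
        by (auto simp: H_def indicator_def fun_eq_iff)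
      ultimately show ?thesis by simp
    qed
    have HG: "(LINT r|lborel. H t r) = \<phi>' t * G t" for t
      unfolding H_def G_lborel by (simp add: mult.assoc mult.commute[of "k _"])
    have H\<phi>: "(LINT t|lborel. H t r) = - k r * \<phi> r" for r
    proof -
      have "(LINT t|lborel. H t r) = (LINT t|lborel. k r * (indicator {r..} t * \<phi>' t))"
        by (intro Bochner_Integration.integral_cong) (auto simp: H_def indicator_def)
      then show ?thesis by (simp add: tail)
    qed
    have Hi: "integrable lborel (\<lambda>t. \<phi>' t * G t)"
      using integral_pair_swap(3)[OF H] by (simp only: HG)
    have "(LINT t|lebesgue_on ?I. F t * \<phi>' t) = (LINT t|lebesgue_on ?I. c * \<phi>' t + \<phi>' t * G t)"
      by (rule Bochner_Integration.integral_cong) (auto simp: const algebra_simps)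
    also have "\<dots> = (LINT t|lborel. c * \<phi>' t + \<phi>' t * G t)"
      using Hi off by (intro integral_lebesgue_on_eq_lborel(1)[OF Ib]) auto
    also have "\<dots> = (LINT t|lborel. \<phi>' t * G t)" using \<phi>'i Hi \<phi>'0 by simp
    also have "\<dots> = - (LINT r|lborel. k r * \<phi> r)"
      using integral_pair_swap(1)[OF H] unfolding HG H\<phi> by simp
    also have "(LINT r|lborel. k r * \<phi> r) = (LINT r|lebesgue_on ?I. k r * \<phi> r)"
      using off k(2) by (intro integral_lebesgue_on_eq_lborel(1)[OF Ib, symmetric]) auto
    also have "\<dots> = (LINT r|lebesgue_on ?I. g r * \<phi> r)"
    proof (rule integral_lebesgue_on_AE(1)[OF Il, symmetric])
      have "\<phi> \<in> borel_measurable (lebesgue_on ?I)"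
        by (intro continuous_imp_measurable_on_sets_lebesgue Il test_functions_continuous[OF \<phi>])
      then show "(\<lambda>r. g r * \<phi> r) \<in> borel_measurable (lebesgue_on ?I)"
        using borel_measurable_integrable[OF g] by simp
      show "AE r in lebesgue_on ?I. g r * \<phi> r = k r * \<phi> r" using k(3) by eventually_elim simp
    qed
    finally show "(LINT x|lebesgue_on ?I. F x * frechet_derivative \<phi> (at x) 1) = - (LINT x|lebesgue_on ?I. g x * \<phi> x)"
      by (simp only: \<phi>'_def)
  qed
qed

subsection \<open>The energy identity\<close>

text \<open>If u' is approximated by a simple function \<sigma> with values in the finite set
  \<open>C\<close>, the kernel \<sigma>(r) applied to u+(t) is a sum over c in \<open>C\<close> of
  the indicator of {\<sigma> = c} at r times c(u+(t)). The error is at most d(r) n(t), with d the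
  dual distance and n the H^1 norm of u, and Young's inequality with weight \<open>l\<close>
  separates the variables. The scalar \<open>s\<close> is there for the two signs of the
  kernel.\<close>

lemma duality_kernel_approximation:
  fixes u :: "real \<Rightarrow> 'a::euclidean_space \<Rightarrow> real"
  assumes \<Omega>: "open \<Omega>"
    and u: "u \<in> L2_in (lebesgue_on {0<..<T}) (H1 \<Omega>) (H1_norm \<Omega>)"
    and u': "u' \<in> L2_in (lebesgue_on {0<..<T}) (H1_dual \<Omega>) (H1_dual_norm \<Omega>)"
    and N: "\<And>t. t \<in> {0<..<T} - N \<Longrightarrow> u t \<in> H1 \<Omega> \<and> u' t \<in> H1_dual \<Omega>"
    and e: "e > 0"
  shows "\<exists>C \<phi> W \<rho> \<kappa>. finite (C :: (('a \<Rightarrow> real) \<Rightarrow> real) set) \<and>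
      (\<forall>c\<in>C. integrable lebesgue (\<phi> c) \<and> (\<forall>r. \<bar>\<phi> c r\<bar> \<le> 1) \<and> integrable lebesgue (W c)) \<and>
      integrable lebesgue \<rho> \<and> integrable lebesgue \<kappa> \<and>
      (LINT t|lebesgue_on {a..b}. \<rho> t) + (LINT t|lebesgue_on {a..b}. \<kappa> t) \<le> e \<and>
      (\<forall>r\<in>{0<..<T} - N. \<forall>t\<in>{0<..<T} - N.
        \<bar>s * u' r (pos_part (u t)) - (\<Sum>c\<in>C. \<phi> c r * W c t)\<bar> \<le> \<bar>s\<bar> * (\<rho> r + \<kappa> t))"
proof -
  let ?I = "{0<..<T}"
  have Il: "?I \<in> sets lebesgue" by simp
  define n where "n t = H1_norm \<Omega> (u t)" for t
  have n2: "integrable (lebesgue_on ?I) (\<lambda>t. (n t)\<^sup>2)" and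
    um: "strongly_measurable_in (lebesgue_on ?I) (H1 \<Omega>) (H1_norm \<Omega>) u"
    using u by (auto simp: L2_in_def n_def)
  have uH: "AE t in lebesgue_on ?I. u t \<in> H1 \<Omega>" using um by (simp add: strongly_measurable_in_def)
  define A where "A = (LINT t|lebesgue_on ?I. (n t)\<^sup>2)"
  have A: "A \<ge> 0" by (simp add: A_def)
  \<comment> \<open>The weight is fixed before \<sigma>: it gives \<kappa> an integral of at most l
    A / 2 \<le> e / 2. Choosing \<sigma> with squared error below e l then gives \<rho> an integral
    of at most e l / (2 l) = e / 2. The summand 1 avoids division by zero.\<close>
  define l where "l = e / (A + 1)"
  have l: "l > 0" using e A by (simp add: l_def)
  have lA: "l * A \<le> e" using e A by (simp add: l_def divide_simps mult_left_mono)
  obtain \<sigma> where \<sigma>: "simple_in (lebesgue_on ?I) (H1_dual \<Omega>) \<sigma>"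
    and d2: "integrable (lebesgue_on ?I) (\<lambda>t. (H1_dual_norm \<Omega> (\<lambda>v. u' t v - \<sigma> t v))\<^sup>2)"
    and small: "(LINT t|lebesgue_on ?I. (H1_dual_norm \<Omega> (\<lambda>v. u' t v - \<sigma> t v))\<^sup>2) < e * l"
    by (rule dual_simple_approximation[OF \<Omega> Il u' mult_pos_pos[OF e l]]) (rule that; assumption)
  define d where "d t = H1_dual_norm \<Omega> (\<lambda>v. u' t v - \<sigma> t v)" for t
  have sf: "simple_function (lebesgue_on ?I) \<sigma>" and \<sigma>X: "\<And>t. t \<in> ?I \<Longrightarrow> \<sigma> t \<in> H1_dual \<Omega>"
    using \<sigma> by (auto simp: simple_in_def)
  define C where "C = \<sigma> ` ?I"
  have C: "finite C" using simple_functionD(1)[OF sf] by (simp add: C_def)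
  have CX: "c \<in> H1_dual \<Omega>" if "c \<in> C" for c using that \<sigma>X by (auto simp: C_def)
  define \<phi> where "\<phi> c r = (indicator {r \<in> ?I. \<sigma> r = c} r :: real)" for c r
  define W where "W c t = indicator ?I t * (s * c (pos_part (u t)))" for c t
  define \<rho> where "\<rho> r = indicator ?I r * (1 / (2 * l) * (d r)\<^sup>2)" for r
  define \<kappa> where "\<kappa> t = indicator ?I t * (l / 2 * (n t)\<^sup>2)" for t
  have \<phi>: "integrable lebesgue (\<phi> c)" "\<bar>\<phi> c r\<bar> \<le> 1" for c r
  proof -
    have "{r \<in> ?I. \<sigma> r = c} \<in> sets (lebesgue_on ?I)"
      using simple_functionD(2)[OF sf, of "{c}"] by (simp add: vimage_def Int_def conj_commute)
    then have "{r \<in> ?I. \<sigma> r = c} \<in> sets lebesgue" by (simp add: sets_restrict_space_iff)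
    moreover have "emeasure lebesgue {r \<in> ?I. \<sigma> r = c} \<le> emeasure lebesgue ?I"
      by (rule emeasure_mono) auto
    then have "emeasure lebesgue {r \<in> ?I. \<sigma> r = c} < \<infinity>"
      by (rule order_le_less_trans) (use fmeasurableD2[of ?I lebesgue] in \<open>simp add: less_top\<close>)
    ultimately show "integrable lebesgue (\<phi> c)"
      unfolding \<phi>_def[abs_def] by (rule integrable_real_indicator)
    show "\<bar>\<phi> c r\<bar> \<le> 1" by (simp add: \<phi>_def)
  qed
  have W: "integrable lebesgue (W c)" if "c \<in> C" for c
    unfolding W_def
  proof (rule integrable_extend_zero(1)[OF Il], rule integrable_mult_right, rule Bochner_Integration.integrable_bound)
    show "integrable (lebesgue_on ?I) (\<lambda>t. H1_dual_norm \<Omega> c * (1 + (n t)\<^sup>2))"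
      by (intro integrable_mult_right Bochner_Integration.integrable_add n2
          finite_measure.integrable_const finite_measure_lebesgue_on) simp
    show "(\<lambda>t. c (pos_part (u t))) \<in> borel_measurable (lebesgue_on ?I)"
      by (rule pos_part_weakly_measurable[OF \<Omega> Il um CX[OF that]])
    show "AE t in lebesgue_on ?I. norm (c (pos_part (u t))) \<le> norm (H1_dual_norm \<Omega> c * (1 + (n t)\<^sup>2))"
      using uH
    proof eventually_elim
      case (elim t)
      have "\<bar>c (pos_part (u t))\<bar> \<le> H1_dual_norm \<Omega> c * H1_norm \<Omega> (pos_part (u t))"
        by (rule H1_dual_bound[OF \<Omega> CX[OF that] pos_part_H1(1)[OF \<Omega> elim]])
      also have "\<dots> \<le> H1_dual_norm \<Omega> c * (1 + (n t)\<^sup>2)"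
        using pos_part_H1(2)[OF \<Omega> elim] abs_le_1_plus_square[of "n t"] H1_dual_norm_nonneg[OF \<Omega> CX[OF that]]
        by (intro mult_left_mono) (auto simp: n_def)
      finally show ?case by simp
    qed
  qed
  have \<rho>: "integrable lebesgue \<rho>" "(LINT t|lebesgue. \<rho> t) \<le> e / 2"
  proof -
    have i: "integrable (lebesgue_on ?I) (\<lambda>t. 1 / (2 * l) * (d t)\<^sup>2)" using d2 unfolding d_def by simp
    show "integrable lebesgue \<rho>" unfolding \<rho>_def by (rule integrable_extend_zero(1)[OF Il i])
    have "(LINT t|lebesgue. \<rho> t) = 1 / (2 * l) * (LINT t|lebesgue_on ?I. (d t)\<^sup>2)"
      unfolding \<rho>_def by (subst integrable_extend_zero(2)[OF Il i]) simp
    also have "\<dots> \<le> 1 / (2 * l) * (e * l)" using small l unfolding d_def by (intro mult_left_mono) auto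
    also have "\<dots> = e / 2" using l by simp
    finally show "(LINT t|lebesgue. \<rho> t) \<le> e / 2" .
  qed
  have \<kappa>: "integrable lebesgue \<kappa>" "(LINT t|lebesgue. \<kappa> t) \<le> e / 2"
  proof -
    have i: "integrable (lebesgue_on ?I) (\<lambda>t. l / 2 * (n t)\<^sup>2)" using n2 by simp
    show "integrable lebesgue \<kappa>" unfolding \<kappa>_def by (rule integrable_extend_zero(1)[OF Il i])
    have "(LINT t|lebesgue. \<kappa> t) = l / 2 * A"
      unfolding \<kappa>_def A_def by (subst integrable_extend_zero(2)[OF Il i]) simp
    then show "(LINT t|lebesgue. \<kappa> t) \<le> e / 2" using lA by simp
  qed
  have nonneg: "0 \<le> \<rho> t" "0 \<le> \<kappa> t" for t using l by (auto simp: \<rho>_def \<kappa>_def)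
  have total: "(LINT t|lebesgue_on {a..b}. \<rho> t) + (LINT t|lebesgue_on {a..b}. \<kappa> t) \<le> e"
    using integral_interval_le[OF \<rho>(1) nonneg(1), of a b] integral_interval_le[OF \<kappa>(1) nonneg(2), of a b] \<rho>(2) \<kappa>(2)
    by linarith
  have approx: "\<bar>s * u' r (pos_part (u t)) - (\<Sum>c\<in>C. \<phi> c r * W c t)\<bar> \<le> \<bar>s\<bar> * (\<rho> r + \<kappa> t)"
    if r: "r \<in> ?I - N" and t: "t \<in> ?I - N" for r t
  proof -
    define w where "w = pos_part (u t)"
    have w: "w \<in> H1 \<Omega>" "H1_norm \<Omega> w \<le> n t"
      using pos_part_H1(1,2)[OF \<Omega>, of "u t"] N[OF t] by (auto simp: w_def n_def)
    have "(\<Sum>c\<in>C. \<phi> c r * W c t) = (\<Sum>c\<in>C. if c = \<sigma> r then s * c w else 0)"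
      using r t by (intro sum.cong) (auto simp: \<phi>_def W_def w_def)
    also have "\<dots> = s * \<sigma> r w" using C r by (simp add: C_def)
    finally have "s * u' r w - (\<Sum>c\<in>C. \<phi> c r * W c t) = s * (u' r w - \<sigma> r w)"
      by (simp add: right_diff_distrib)
    moreover have "\<bar>u' r w - \<sigma> r w\<bar> \<le> \<rho> r + \<kappa> t"
    proof -
      have X: "(\<lambda>v. u' r v - \<sigma> r v) \<in> H1_dual \<Omega>"
        using N[OF r] \<sigma>X r by (intro H1_dual_diff) auto
      have "\<bar>u' r w - \<sigma> r w\<bar> \<le> d r * H1_norm \<Omega> w"
        unfolding d_def by (rule H1_dual_bound[OF \<Omega> X w(1)])
      also have "\<dots> \<le> d r * n t"
        by (rule mult_left_mono[OF w(2)]) (simp add: d_def H1_dual_norm_nonneg[OF \<Omega> X])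
      also have "\<dots> \<le> 1 / (2 * l) * (d r)\<^sup>2 + l / 2 * (n t)\<^sup>2"
      proof -
        have "0 \<le> 1 / (2 * l) * (d r - l * n t)\<^sup>2" using l by simp
        also have "\<dots> = 1 / (2 * l) * (d r)\<^sup>2 + l / 2 * (n t)\<^sup>2 - d r * n t"
          using l by (simp add: power2_eq_square field_simps)
        finally show ?thesis by simp
      qed
      also have "\<dots> = \<rho> r + \<kappa> t" using r t by (simp add: \<rho>_def \<kappa>_def)
      finally show ?thesis .
    qed
    ultimately show ?thesis by (simp add: w_def abs_mult mult_left_mono)
  qed
  show ?thesis
    by (rule exI[of _ C], rule exI[of _ \<phi>], rule exI[of _ W], rule exI[of _ \<rho>], rule exI[of _ \<kappa>])
      (use C \<phi> W \<rho>(1) \<kappa>(1) total approx in blast)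
qed

text \<open>The two inequalities are instances of \<open>kernel_diagonal_le\<close> for the kernel
  u'(r) applied to u+(t). Averages to the right of t give the upper bound. The negated kernel with
  averages to the left gives the lower one, because the convexity inequality is always used at the
  point t that carries u+(t).\<close>

proposition energy_identity_interior:
  fixes u :: "real \<Rightarrow> 'a::euclidean_space \<Rightarrow> real"
  assumes \<Omega>: "open \<Omega>"
    and u: "u \<in> L2_in (lebesgue_on {0<..<T}) (H1 \<Omega>) (H1_norm \<Omega>)"
    and uC: "u \<in> C_in {0..T} (L2 \<Omega>) (L2_norm \<Omega>)"
    and u': "u' \<in> L2_in (lebesgue_on {0<..<T}) (H1_dual \<Omega>) (H1_dual_norm \<Omega>)"
    and weak: "has_weak_time_derivative \<Omega> T u u'"
  shows "integrable (lebesgue_on {0<..<T}) (\<lambda>t. u' t (pos_part (u t)))"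
    and "\<And>a b. 0 < a \<Longrightarrow> a < b \<Longrightarrow> b < T \<Longrightarrow> (LINT t|lebesgue_on {a..b}. u' t (pos_part (u t))) =
      1 / 2 * (L2_norm \<Omega> (pos_part (u b)))\<^sup>2 - 1 / 2 * (L2_norm \<Omega> (pos_part (u a)))\<^sup>2"
proof -
  let ?I = "{0<..<T}"
  have Il: "?I \<in> sets lebesgue" and Im: "?I \<in> lmeasurable" by simp_all
  have um: "strongly_measurable_in (lebesgue_on ?I) (H1 \<Omega>) (H1_norm \<Omega>) u"
    and u2: "integrable (lebesgue_on ?I) (\<lambda>t. (H1_norm \<Omega> (u t))\<^sup>2)"
    using u by (auto simp: L2_in_def)
  have u'm: "strongly_measurable_in (lebesgue_on ?I) (H1_dual \<Omega>) (H1_dual_norm \<Omega>) u'"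
    and u'2: "integrable (lebesgue_on ?I) (\<lambda>t. (H1_dual_norm \<Omega> (u' t))\<^sup>2)"
    using u' by (auto simp: L2_in_def)
  have uH: "AE t in lebesgue_on ?I. u t \<in> H1 \<Omega>" and u'X: "AE t in lebesgue_on ?I. u' t \<in> H1_dual \<Omega>"
    using um u'm by (simp_all add: strongly_measurable_in_def)
  have uL: "u t \<in> L2 \<Omega>" if "t \<in> {0..T}" for t using uC that by (simp add: C_in_def)
  have product: "integrable (lebesgue_on ?I) (\<lambda>t. u' t (w t))"
    if w: "AE t in lebesgue_on ?I. w t \<in> H1 \<Omega>" "(\<lambda>t. u' t (w t)) \<in> borel_measurable (lebesgue_on ?I)"
      "AE t in lebesgue_on ?I. H1_norm \<Omega> (w t) \<le> m t" "integrable (lebesgue_on ?I) (\<lambda>t. (m t)\<^sup>2)" for w m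
  proof (rule Bochner_Integration.integrable_bound)
    show "integrable (lebesgue_on ?I) (\<lambda>t. (H1_dual_norm \<Omega> (u' t))\<^sup>2 + (m t)\<^sup>2)"
      using u'2 w(4) by (rule Bochner_Integration.integrable_add)
    show "AE t in lebesgue_on ?I. norm (u' t (w t)) \<le> norm ((H1_dual_norm \<Omega> (u' t))\<^sup>2 + (m t)\<^sup>2)"
      using u'X w(1,3)
    proof eventually_elim
      case (elim t)
      have "\<bar>u' t (w t)\<bar> \<le> H1_dual_norm \<Omega> (u' t) * H1_norm \<Omega> (w t)"
        by (rule H1_dual_bound[OF \<Omega> elim(1,2)])
      also have "\<dots> \<le> H1_dual_norm \<Omega> (u' t) * m t"
        by (rule mult_left_mono[OF elim(3) H1_dual_norm_nonneg[OF \<Omega> elim(1)]])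
      also have "\<dots> \<le> (H1_dual_norm \<Omega> (u' t))\<^sup>2 + (m t)\<^sup>2"
        using abs_mult_le_squares[of "H1_dual_norm \<Omega> (u' t)" "m t"] by linarith
      finally show ?case by simp
    qed
  qed (rule w(2))
  show diag: "integrable (lebesgue_on ?I) (\<lambda>t. u' t (pos_part (u t)))"
  proof (rule product[OF _ _ _ u2])
    show w: "AE t in lebesgue_on ?I. pos_part (u t) \<in> H1 \<Omega>"
      using uH by eventually_elim (rule pos_part_H1(1)[OF \<Omega>])
    show "AE t in lebesgue_on ?I. H1_norm \<Omega> (pos_part (u t)) \<le> H1_norm \<Omega> (u t)"
      using uH by eventually_elim (rule pos_part_H1(2)[OF \<Omega>])
    show "(\<lambda>t. u' t (pos_part (u t))) \<in> borel_measurable (lebesgue_on ?I)"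
      by (rule strongly_measurable_dual_apply[OF \<Omega> Il u'm w pos_part_weakly_measurable[OF \<Omega> Il um]])
  qed
  \<comment> \<open>Fixing \<open>v\<close> turns the time derivative into a scalar one. Later
    \<open>v\<close> is u+(t) with t frozen, so no product of two time-dependent factors is
    differentiated.\<close>
  have increment: "(\<lambda>r. u' r v) integrable_on {t..t + h}"
    "integral {t..t + h} (\<lambda>r. u' r v) = L2_inner \<Omega> (u (t + h)) v - L2_inner \<Omega> (u t) v"
    if v: "v \<in> H1 \<Omega>" and t: "0 < t" "0 < h" "t + h < T" for v t h
  proof -
    have k: "integrable (lebesgue_on ?I) (\<lambda>r. u' r v)"
      by (rule product[where m = "\<lambda>_. H1_norm \<Omega> v"], use v in simp,
          rule strongly_measurable_dual_apply[OF \<Omega> Il u'm],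
          use v finite_measure.integrable_const[OF finite_measure_lebesgue_on[OF Im]] in simp_all)
    have w: "(LINT t|lebesgue_on ?I. deriv \<phi> t * L2_inner \<Omega> (u t) v) = - (LINT t|lebesgue_on ?I. \<phi> t * u' t v)"
      if \<phi>: "\<phi> \<in> test_functions ?I" for \<phi>
    proof -
      obtain y where y1: "has_integral_in (lebesgue_on ?I) (H1_dual \<Omega>) (H1_dual_norm \<Omega>)
          (\<lambda>t v. deriv \<phi> t * H_embed \<Omega> (u t) v) y"
        and y2: "has_integral_in (lebesgue_on ?I) (H1_dual \<Omega>) (H1_dual_norm \<Omega>) (\<lambda>t v. \<phi> t * u' t v) (\<lambda>v. - y v)"
        using weak \<phi> unfolding has_weak_time_derivative_def by blast
      show ?thesis
        using has_integral_in_dual_evaluate(2)[OF \<Omega> Im v y1] has_integral_in_dual_evaluate(2)[OF \<Omega> Im v y2]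
        by (simp add: H_embed_def)
    qed
    note wi = weak_derivative_increment[OF L2_inner_continuous[OF uC H1_L2[OF v]] k w t]
    show "(\<lambda>r. u' r v) integrable_on {t..t + h}" by (rule wi(1))
    show "integral {t..t + h} (\<lambda>r. u' r v) = L2_inner \<Omega> (u (t + h)) v - L2_inner \<Omega> (u t) v" by (rule wi(2))
  qed
  \<comment> \<open>Membership in H^1 and its dual holds only almost everywhere for the given
    representatives; the exceptional times form the null set handed to the kernel estimate.\<close>
  define N where "N = {t. \<not> (t \<in> ?I \<longrightarrow> u t \<in> H1 \<Omega> \<and> u' t \<in> H1_dual \<Omega>)}"
  have N: "negligible N"
  proof -
    have "AE t in lebesgue_on ?I. u t \<in> H1 \<Omega> \<and> u' t \<in> H1_dual \<Omega>" using uH u'X by eventually_elim simp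
    then have "AE t in lebesgue. t \<in> ?I \<longrightarrow> u t \<in> H1 \<Omega> \<and> u' t \<in> H1_dual \<Omega>"
      by (rule AE_restrict_space_iff[THEN iffD1, rotated]) simp
    then have "{t \<in> space lebesgue. \<not> (t \<in> ?I \<longrightarrow> u t \<in> H1 \<Omega> \<and> u' t \<in> H1_dual \<Omega>)} \<in> null_sets lebesgue"
      by (simp only: completion.AE_iff_null_sets)
    then show ?thesis by (simp add: N_def negligible_iff_null_sets)
  qed
  have good: "u t \<in> H1 \<Omega> \<and> u' t \<in> H1_dual \<Omega>" if "t \<in> ?I - N" for t
    using that by (auto simp: N_def)
  define f where "f t = 1 / 2 * (L2_norm \<Omega> (pos_part (u t)))\<^sup>2" for t
  have f: "continuous_on {0..T} f"
    unfolding f_def by (intro continuous_intros L2_norm_pos_part_continuous[OF uC])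
  fix a b assume ab: "0 < a" "a < b" "b < T"
  have diag_ab: "integrable (lebesgue_on {a..b}) (\<lambda>t. u' t (pos_part (u t)))"
    by (rule integrable_lebesgue_on_subset[OF diag Il]) (use ab in auto)
  have approx: "\<exists>C \<phi> W \<rho> \<kappa>. finite (C :: (('a \<Rightarrow> real) \<Rightarrow> real) set) \<and>
      (\<forall>c\<in>C. integrable lebesgue (\<phi> c) \<and> (\<forall>r. \<bar>\<phi> c r\<bar> \<le> 1) \<and> integrable lebesgue (W c)) \<and>
      integrable lebesgue \<rho> \<and> integrable lebesgue \<kappa> \<and>
      (LINT t|lebesgue_on {a..b}. \<rho> t) + (LINT t|lebesgue_on {a..b}. \<kappa> t) \<le> e \<and>
      (\<forall>r\<in>?I - N. \<forall>t\<in>?I - N. \<bar>s * u' r (pos_part (u t)) - (\<Sum>c\<in>C. \<phi> c r * W c t)\<bar> \<le> \<rho> r + \<kappa> t)"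
    if "e > 0" "\<bar>s\<bar> = 1" for e s
    using duality_kernel_approximation[OF \<Omega> u u' good that(1), where a = a and b = b and s = s] unfolding that(2) mult_1 by blast
  \<comment> \<open>Convexity at u(t), compared with u(t + h). The factor 1 matches the form of the
    approximation with a sign.\<close>
  have "(LINT t|lebesgue_on {a..b}. 1 * u' t (pos_part (u t))) \<le> f b - f a"
  proof (rule kernel_diagonal_le[where \<delta> = 0 and N = N and K = "\<lambda>r t. 1 * u' r (pos_part (u t))", OF f ab _ N])
    fix t h assume t: "t \<in> ?I - N" "0 < h" "0 < t - 0 * h" "t - 0 * h + h < T"
    have w: "pos_part (u t) \<in> H1 \<Omega>" using good[OF t(1)] by (intro pos_part_H1(1)[OF \<Omega>]) simp
    have t': "0 < t" "t + h < T" using t by auto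
    show "(\<lambda>r. 1 * u' r (pos_part (u t))) integrable_on {t - 0 * h..t - 0 * h + h} \<and>
        integral {t - 0 * h..t - 0 * h + h} (\<lambda>r. 1 * u' r (pos_part (u t))) \<le> f (t - 0 * h + h) - f (t - 0 * h)"
      using increment[OF w t'(1) t(2) t'(2)] pos_part_gradient_ineq[OF uL uL, of t "t + h"] t t'
      by (simp add: f_def)
  next
    show "integrable (lebesgue_on {a..b}) (\<lambda>t. 1 * u' t (pos_part (u t)))" using diag_ab by simp
  qed (simp, rule approx, simp_all)
  \<comment> \<open>Convexity at u(t), now compared with u(t - h): the increment over [t-h,t] enters
    with a minus sign, so -K and -f satisfy the hypothesis.\<close>
  moreover have "(LINT t|lebesgue_on {a..b}. (-1) * u' t (pos_part (u t))) \<le> (- f b) - (- f a)"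
  proof (rule kernel_diagonal_le[where \<delta> = 1 and N = N and K = "\<lambda>r t. (-1) * u' r (pos_part (u t))" and f = "\<lambda>t. - f t",
        OF continuous_on_minus[OF f] ab _ N])
    fix t h assume t: "t \<in> ?I - N" "0 < h" "0 < t - 1 * h" "t - 1 * h + h < T"
    have w: "pos_part (u t) \<in> H1 \<Omega>" using good[OF t(1)] by (intro pos_part_H1(1)[OF \<Omega>]) simp
    have t': "0 < t - h" "t - h + h < T" using t by auto
    show "(\<lambda>r. (-1) * u' r (pos_part (u t))) integrable_on {t - 1 * h..t - 1 * h + h} \<and>
        integral {t - 1 * h..t - 1 * h + h} (\<lambda>r. (-1) * u' r (pos_part (u t))) \<le> - f (t - 1 * h + h) - - f (t - 1 * h)"
      using increment[OF w t'(1) t(2) t'(2)] pos_part_gradient_ineq[OF uL uL, of t "t - h"] t t'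
      by (simp add: f_def integrable_neg_iff)
  next
    show "integrable (lebesgue_on {a..b}) (\<lambda>t. (-1) * u' t (pos_part (u t)))" using diag_ab by simp
  qed (simp, rule approx, simp_all)
  ultimately show "(LINT t|lebesgue_on {a..b}. u' t (pos_part (u t))) =
      1 / 2 * (L2_norm \<Omega> (pos_part (u b)))\<^sup>2 - 1 / 2 * (L2_norm \<Omega> (pos_part (u a)))\<^sup>2"
    by (simp add: f_def)
qed

theorem lemma3p3:
  fixes \<Omega> :: "'a::euclidean_space set" and T :: real
    and u :: "real \<Rightarrow> 'a \<Rightarrow> real" and u' :: "real \<Rightarrow> ('a \<Rightarrow> real) \<Rightarrow> real"
  assumes "is_domain \<Omega>" and "T > 0"
    and "u \<in> W_space \<Omega> T"
    and "u \<in> C_in {0..T} (L2 \<Omega>) (L2_norm \<Omega>)"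
    and "u' \<in> L2_in (lebesgue_on {0<..<T}) (H1_dual \<Omega>) (H1_dual_norm \<Omega>)"
    and "has_weak_time_derivative \<Omega> T u u'"
  shows "integrable (lebesgue_on {0<..<T}) (\<lambda>t. u' t (pos_part (u t))) \<and>
    (\<exists>g. has_weak_partial {0<..<T} 1 (\<lambda>t. (L2_norm \<Omega> (pos_part (u t)))\<^sup>2) g \<and>
         integrable (lebesgue_on {0<..<T}) g \<and>
         (LINT t|lebesgue_on {0<..<T}. u' t (pos_part (u t))) =
           1 / 2 * (LINT t|lebesgue_on {0<..<T}. g t) \<and>
         1 / 2 * (LINT t|lebesgue_on {0<..<T}. g t) =
           1 / 2 * ((L2_norm \<Omega> (pos_part (u T)))\<^sup>2 - (L2_norm \<Omega> (pos_part (u 0)))\<^sup>2))"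
proof -
  have \<Omega>: "open \<Omega>" using assms(1) by (simp add: is_domain_def)
  have u: "u \<in> L2_in (lebesgue_on {0<..<T}) (H1 \<Omega>) (H1_norm \<Omega>)" using assms(3) by (simp add: W_space_def)
  note energy = energy_identity_interior[OF \<Omega> u assms(4-6)]
  \<comment> \<open>By the interior identity, this is the weak derivative of the squared norm of u+;
    the factor 2 cancels the 1/2 in the energy.\<close>
  define g where "g t = 2 * u' t (pos_part (u t))" for t
  have g: "integrable (lebesgue_on {0<..<T}) g" unfolding g_def using energy(1) by simp
  have "(LINT t|lebesgue_on {a..b}. g t) = (L2_norm \<Omega> (pos_part (u b)))\<^sup>2 - (L2_norm \<Omega> (pos_part (u a)))\<^sup>2"
    if "0 < a" "a < b" "b < T" for a b
    using energy(2)[OF that] by (simp add: g_def)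
  note primitive = weak_derivative_of_primitive[OF assms(2) L2_norm_pos_part_continuous[OF assms(4)] g this]
  have "(LINT t|lebesgue_on {0<..<T}. g t) = 2 * (LINT t|lebesgue_on {0<..<T}. u' t (pos_part (u t)))"
    by (simp add: g_def)
  then show ?thesis
    using energy(1) g primitive by (intro conjI exI[of _ g]) simp_all
qed

end
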